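(* Let $\xi_1,\dots,\xi_m$ be $\mathbb{Q}$-linearly independent complex numbers which generate a field of transcendence degree one over $\mathbb{Q}$. Let $\beta,\sigma,\tau,\nu\in\mathbb{R}$ with $\sigma\ge0$, $\tau\ge0$, $\beta>1>\frac{3m\sigma}{m+2}+\tau$ and $\nu>1+\beta-\frac{2m\sigma}{m+2}-\tau$. Then for infinitely many integers $n\ge1$, there is no non-zero polynomial $P\in\mathbb{Z}[T]$ of degree at most $n$ and height at most $\exp(n^\beta)$ satisfying $|P^{[j]}(i_1\xi_1+\cdots+i_m\xi_m)|\le\exp(-n^\nu)$ for every choice of integers $i_1,\dots,i_m,j$ with $0\le i_1,\dots,i_m\le n^\sigma$ and $0\le j<n^\tau$.
   Context: For non-zero $P\in\mathbb{Q}[T]$, $\|P\|$ is the maximum absolute value of its coefficients, $\mathrm{cont}(P)$ the positive rational $c$ with $c^{-1}P$ primitive in $\mathbb{Z}[T]$, and $H(P)=\|P\|/\mathrm{cont}(P)$. $P^{[j]}$ is the $j$-th derivative divided by $j!$. *)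

theory Defs
  imports
    Complex_Main
    "HOL-Computational_Algebra.Computational_Algebra"
    "HOL-Library.Poly_Mapping"
begin

interpretation complex_over_rat: vector_space "\<lambda>q::rat. (*) (of_rat q :: complex)"
  by unfold_locales (auto simp: algebra_simps of_rat_add of_rat_mult)

definition is_subfield :: "complex set \<Rightarrow> bool" where
  "is_subfield K \<longleftrightarrow> 0 \<in> K \<and> 1 \<in> K \<and>
     (\<forall>x\<in>K. \<forall>y\<in>K. x - y \<in> K \<and> x * y \<in> K) \<and> (\<forall>x\<in>K. inverse x \<in> K)"

text \<open>Every subfield of the complex numbers contains the rationals, so this is the field
  generated by \<^term>\<open>S\<close> over the rationals.\<close>

definition generated_field :: "complex set \<Rightarrow> complex set" where
  "generated_field S = is_subfield hull S"

definition algebraic_over :: "complex set \<Rightarrow> complex \<Rightarrow> bool" where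
  "algebraic_over K x \<longleftrightarrow> (\<exists>p. p \<noteq> 0 \<and> (\<forall>i. coeff p i \<in> K) \<and> poly p x = 0)"

text \<open>A polynomial over the rationals in indeterminates indexed by complex numbers is a finitely
  supported map from monomials to coefficients, a monomial being a finitely supported map from
  indeterminates to exponents. Evaluation substitutes for each indeterminate its own index.\<close>

definition eval_mpoly :: "((complex \<Rightarrow>\<^sub>0 nat) \<Rightarrow>\<^sub>0 rat) \<Rightarrow> complex" where
  "eval_mpoly p =
     (\<Sum>u\<in>Poly_Mapping.keys p.
        of_rat (Poly_Mapping.lookup p u) * (\<Prod>x\<in>Poly_Mapping.keys u. x ^ Poly_Mapping.lookup u x))"

definition algebraically_independent :: "complex set \<Rightarrow> bool" where
  "algebraically_independent B \<longleftrightarrow>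
     (\<forall>p. p \<noteq> 0 \<and> (\<forall>u\<in>Poly_Mapping.keys p. Poly_Mapping.keys u \<subseteq> B) \<longrightarrow> eval_mpoly p \<noteq> 0)"

definition transcendence_basis :: "complex set \<Rightarrow> complex set \<Rightarrow> bool" where
  "transcendence_basis K B \<longleftrightarrow>
     B \<subseteq> K \<and> algebraically_independent B \<and> (\<forall>x\<in>K. algebraic_over (generated_field B) x)"

definition has_transcendence_degree :: "complex set \<Rightarrow> nat \<Rightarrow> bool" where
  "has_transcendence_degree K d \<longleftrightarrow> (\<exists>B. transcendence_basis K B \<and> finite B \<and> card B = d)"

definition poly_norm :: "rat poly \<Rightarrow> rat" where
  "poly_norm P = Max ((\<lambda>i. \<bar>coeff P i\<bar>) ` {..degree P})"

abbreviation rat_poly :: "int poly \<Rightarrow> rat poly" where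
  "rat_poly \<equiv> map_poly of_int"

definition poly_cont :: "rat poly \<Rightarrow> rat" where
  "poly_cont P = (THE c. c > 0 \<and> (\<exists>Q. content Q = 1 \<and> smult (inverse c) P = rat_poly Q))"

definition poly_height :: "rat poly \<Rightarrow> rat" where
  "poly_height P = poly_norm P / poly_cont P"

lemma content_unique:
  assumes "c > 0" "d > 0" "content Q = 1" "content R = 1"
    and "smult (inverse c) P = rat_poly Q" "smult (inverse d) P = rat_poly R"
  shows "c = d"
proof -
  have P: "P = smult c (rat_poly Q)" "P = smult d (rat_poly R)"
    using assms by (auto simp flip: assms(5,6))
  obtain a b where ab: "c / d = of_int a / of_int b" "b > 0"
    by (metis quotient_of_div quotient_of_denom_pos surj_pair)
  have "0 < (of_int a :: rat) / of_int b"
    using assms(1,2) ab(1) by (metis divide_pos_pos)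
  hence a: "a > 0" using ab(2) by (simp add: zero_less_divide_iff)
  have "of_int a * d = of_int b * c"
    using ab assms(1,2) by (auto simp: field_simps)
  have "smult a Q = smult b R"
  proof (rule poly_eqI)
    fix i
    have "c * of_int (coeff Q i) = d * of_int (coeff R i)"
      using arg_cong[OF P(1), of "\<lambda>p. coeff p i"] arg_cong[OF P(2), of "\<lambda>p. coeff p i"]
      by (simp add: coeff_map_poly)
    hence "(c / d) * of_int (coeff Q i) = of_int (coeff R i)"
      using assms(2) by (simp add: field_simps)
    hence "of_int (a * coeff Q i) = (of_int (b * coeff R i) :: rat)"
      using ab by (simp add: field_simps)
    thus "coeff (smult a Q) i = coeff (smult b R) i"
      by (simp only: of_int_eq_iff coeff_smult)
  qed
  from arg_cong[OF this, of content] have "a = b"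
    using a ab(2) assms(3,4) by simp
  thus ?thesis using ab assms(2) by simp
qed

lemma content_exists:
  fixes P :: "rat poly"
  assumes "P \<noteq> 0"
  shows "\<exists>c Q. c > 0 \<and> content Q = 1 \<and> smult (inverse c) P = rat_poly Q"
proof -
  define D where "D = (\<Prod>i\<le>degree P. snd (quotient_of (coeff P i)))"
  have D: "D > 0" unfolding D_def by (intro prod_pos) (auto intro: quotient_of_denom_pos')
  have "of_int D * coeff P i \<in> \<int>" for i
  proof (cases "i \<le> degree P")
    case True
    let ?e = "snd (quotient_of (coeff P i))"
    obtain k where k: "D = ?e * k"
      unfolding D_def using True by (meson atMost_iff dvdE dvd_prodI finite_atMost)
    have "of_int ?e * coeff P i = of_int (fst (quotient_of (coeff P i)))"
      using quotient_of_div[of "coeff P i"] quotient_of_denom_pos'[of "coeff P i"]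
      by (metis mult.commute nonzero_eq_divide_eq of_int_0_eq_iff order_less_irrefl prod.collapse)
    hence "of_int D * coeff P i = of_int (k * fst (quotient_of (coeff P i)))"
      by (subst k) (simp add: mult.assoc mult.left_commute)
    thus ?thesis by (metis Ints_of_int)
  qed (simp add: coeff_eq_0)
  hence fl: "of_int \<lfloor>of_int D * coeff P i\<rfloor> = of_int D * coeff P i" for i
    by (metis Ints_cases floor_of_int)
  define S where "S = map_poly floor (smult (of_int D) P)"
  have S: "rat_poly S = smult (of_int D) P"
    by (rule poly_eqI) (simp add: S_def coeff_map_poly fl)
  have "S \<noteq> 0" using S D assms by auto
  hence cS: "content S > 0"
    by (metis normalize_content normalize_int_def content_eq_zero_iff zero_less_abs_iff)
  have "smult (inverse (of_int (content S) / of_int D)) P = rat_poly (primitive_part S)"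
  proof (rule poly_eqI)
    fix i
    have "of_int D * coeff P i = of_int (content S * coeff (primitive_part S) i)"
      using arg_cong[OF S, of "\<lambda>p. coeff p i"]
      by (metis coeff_map_poly coeff_smult content_times_primitive_part of_int_0)
    thus "coeff (smult (inverse (of_int (content S) / of_int D)) P) i
          = coeff (rat_poly (primitive_part S)) i"
      using cS D by (simp add: coeff_map_poly field_simps)
  qed
  moreover have "content (primitive_part S) = 1"
    using \<open>S \<noteq> 0\<close> by (rule content_primitive_part)
  moreover have "(of_int (content S) / of_int D :: rat) > 0" using cS D by simp
  ultimately show ?thesis by blast
qed

lemma poly_cont_unique:
  "P \<noteq> 0 \<Longrightarrow> \<exists>!c. c > 0 \<and> (\<exists>Q. content Q = 1 \<and> smult (inverse c) P = rat_poly Q)"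
  using content_exists content_unique by (metis (no_types, lifting))

lemma poly_cont_rat_poly:
  assumes "P \<noteq> 0"
  shows "poly_cont (rat_poly P) = of_int (content P)"
proof -
  have c: "content P > 0"
    using assms by (metis normalize_content normalize_int_def content_eq_zero_iff zero_less_abs_iff)
  have "smult (inverse (of_int (content P))) (rat_poly P) = rat_poly (primitive_part P)"
  proof (rule poly_eqI)
    fix i
    have "coeff P i = content P * coeff (primitive_part P) i"
      by (metis coeff_smult content_times_primitive_part)
    hence "rat_of_int (coeff P i) = of_int (content P) * of_int (coeff (primitive_part P) i)"
      by (metis of_int_mult)
    thus "coeff (smult (inverse (of_int (content P))) (rat_poly P)) i
          = coeff (rat_poly (primitive_part P)) i"
      using c by (simp add: coeff_map_poly field_simps)
  qed
  moreover have "rat_poly P \<noteq> 0"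
    using assms by (simp add: map_poly_eq_0_iff)
  ultimately show ?thesis
    unfolding poly_cont_def using poly_cont_unique[of "rat_poly P"] c assms
    by (intro the1_equality) (auto intro!: exI[of _ "primitive_part P"])
qed

definition divided_deriv :: "nat \<Rightarrow> 'a::field_char_0 poly \<Rightarrow> 'a poly" where
  "divided_deriv j P = smult (inverse (fact j)) ((pderiv ^^ j) P)"

end

theory Submission
  imports Defs "Subresultants.Subresultant_Gcd" "HOL-Real_Asymp.Real_Asymp"
    "HOL-Complex_Analysis.Complex_Analysis" "HOL-Computational_Algebra.Field_as_Ring"
begin

text \<open>
  Suppose that such a polynomial \<open>P\<close> exists for every large \<open>n\<close>. Put \<open>\<alpha> = m\<sigma>/(m+2)\<close>, so that
  \<open>m(\<sigma>-\<alpha>) = 2\<alpha>\<close>, and let \<open>Q\<close> be the greatest common divisor of the dilates \<open>P(aT)\<close>, where \<open>a\<close> is \<open>1\<close> or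
  a prime up to \<open>n\<^sup>\<alpha>\<close>. Every irreducible factor of \<open>Q\<close> yields dilated factors of \<open>P\<close>, and an
  edge-isoperimetric inequality for dilation orbits together with Chebyshev's lower bound for the number
  of primes shows that \<open>Q\<close> has degree about \<open>n\<^sup>1\<^sup>-\<^sup>\<alpha>\<close> and logarithmic height about \<open>n\<^sup>\<beta>\<^sup>-\<^sup>\<alpha>\<close>.

  The proximity of a polynomial to a point \<open>x\<close> is the sum of \<open>-log |x-z|\<close>, truncated to \<open>[0,l]\<close>, over its
  roots \<open>z\<close>. As the resultant of coprime integer polynomials is a non-zero integer, the sum over a set of
  points of the product of their two proximities is small. All \<open>P(aT)\<close> have large proximity to the
  grid points \<open>\<Sum> i\<^sub>k\<xi>\<^sub>k\<close> with \<open>i\<^sub>k \<le> n\<^sup>\<sigma>\<^sup>-\<^sup>\<alpha>\<close>; applied to \<open>P(aT)/Q\<close>, the estimate shows that \<open>Q\<close> has large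
  proximity to some grid point, unless two grid points are very close. In that case some linear form
  \<open>\<Sum> j\<^sub>k\<xi>\<^sub>k\<close> is very small, that is, \<open>T\<close> has large proximity to it.

  In both cases a norm carries the polynomial from \<open>\<Sum> j\<^sub>k\<xi>\<^sub>k\<close>, which is algebraic over \<open>\<rat>(\<theta>)\<close>, to the
  transcendental number \<open>\<theta>\<close>, where some irreducible factor \<open>g\<^sub>n\<close> still has large proximity. The resultant
  estimate at the single point \<open>\<theta>\<close> then forces \<open>g\<^sub>n = g\<^sub>n\<^sub>+\<^sub>1\<close> for large \<open>n\<close>, as in Gelfond's criterion. So
  one fixed polynomial has unbounded proximity to \<open>\<theta>\<close> and vanishes there, which is absurd.
\<close>

text \<open>The value of \<alpha> balances two needs: averaging over
  \<open>n^(m(\<sigma>-\<alpha>))\<close> grid points asks for \<nu> above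
  \<open>1+\<beta>-\<tau>-m(\<sigma>-\<alpha>)\<close>, comparing two factors at \<theta> asks for
  \<nu> above \<open>1+\<beta>-\<tau>-2\<alpha>\<close>. By
  \<open>m(\<sigma>-\<alpha>) = 2\<alpha>\<close> both become the hypothesis on \<nu>. Two grid
  points are too close when their distance is below about \<open>exp(-n^\<kappa>)\<close>. Averaging
  wants \<kappa> below \<open>2\<nu>-1-\<beta>\<close>, and comparing a factor from a small linear
  form with one from a grid point wants \<kappa> above \<open>\<beta>-\<alpha>-\<tau>\<close>; the
  hypothesis \<open>3\<alpha>+\<tau> < 1\<close> leaves room in between. Resultants cannot be
  applied to the dilates directly, since these may share factors. After division by Q no irreducible
  polynomial divides all quotients, so each factor of P/Q is coprime to one of them. Q is small
  because w polynomials span at most w log w links by prime dilations, whereas each factor of Q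
  contributes a link for every available prime.\<close>

hide_const (open) Module.smult

subsection \<open>Proximity and the resultant\<close>

text \<open>The value at \<open>a = x\<close> is singled out because \<open>ln 0 = 0\<close>.\<close>

definition kap :: "real \<Rightarrow> complex \<Rightarrow> complex \<Rightarrow> real" where
  "kap l a x = (if x = a then l else min l (max 0 (- ln (cmod (x - a)))))"

text \<open>Roots count with multiplicity. Apart from the leading coefficient, far roots and
  truncation this is \<open>-ln |F x|\<close>, but it is additive in \<open>F\<close> and, for
  \<open>l \<ge> 0\<close>, never negative.\<close>

definition prox :: "real \<Rightarrow> complex poly \<Rightarrow> complex \<Rightarrow> real" where
  "prox l F x = (\<Sum>a\<in>#proots F. kap l a x)"

text \<open>The logarithmic Mahler measure. Unlike the largest coefficient it is exactly additive
  under products, so it can be distributed over irreducible factors.\<close>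

definition lmeas :: "complex poly \<Rightarrow> real" where
  "lmeas F = ln (cmod (lead_coeff F)) + (\<Sum>a\<in>#proots F. ln (max 1 (cmod a)))"

lemma kap_nonneg: "l \<ge> 0 \<Longrightarrow> 0 \<le> kap l a x"
  by (auto simp: kap_def)

lemma kap_le: "kap l a x \<le> l"
  by (auto simp: kap_def)

lemma kap_commute: "kap l a x = kap l x a"
  by (auto simp: kap_def norm_minus_commute)

lemma kap_mono: "l \<le> l' \<Longrightarrow> kap l a x \<le> kap l' a x"
  by (auto simp: kap_def)

lemma kap_ge:
  assumes "cmod (x - a) \<le> exp (- t)" "t \<le> l"
  shows "t \<le> kap l a x"
proof (cases "x = a")
  case False
  hence "ln (cmod (x - a)) \<le> -t" using assms by (metis ln_exp ln_le_cancel_iff exp_gt_zero right_minus_eq zero_less_norm_iff)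
  thus ?thesis using assms False by (auto simp: kap_def)
qed (use assms in \<open>auto simp: kap_def\<close>)

lemma kap_le_ln:
  assumes "cmod (x - a) \<ge> exp (- t)" "t \<ge> 0"
  shows "kap l a x \<le> t"
proof -
  have ne: "x \<noteq> a" using assms(1) by (smt (verit) exp_gt_zero norm_zero right_minus_eq)
  hence "ln (cmod (x - a)) \<ge> -t" using assms
    by (metis ln_exp ln_le_cancel_iff exp_gt_zero right_minus_eq zero_less_norm_iff)
  thus ?thesis using assms ne by (auto simp: kap_def min_def)
qed

text \<open>The distance from \<open>a\<close> to \<open>b\<close> is at most twice the larger of
  their distances to \<open>x\<close>; hence an ultrametric inequality up to
  \<open>ln 2\<close>.\<close>

lemma kap_ultra:
  assumes "l \<ge> 0"
  shows "min (kap l a x) (kap l b x) \<le> kap l a b + ln 2"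
proof -
  consider "x = a" | "x = b" | "a = b" | "x \<noteq> a" "x \<noteq> b" "a \<noteq> b" by blast
  thus ?thesis
  proof cases
    case 1
    have "kap l b a = kap l a b" by (rule kap_commute)
    hence "min (kap l a x) (kap l b x) \<le> kap l a b" using 1 by simp
    thus ?thesis using ln_ge_zero[of "2::real"] by linarith
  next
    case 2
    hence "min (kap l a x) (kap l b x) \<le> kap l a b" by simp
    thus ?thesis using ln_ge_zero[of "2::real"] by linarith
  next
    case 3
    hence "kap l a b = l" by (simp add: kap_def)
    moreover have "kap l a x \<le> l" by (rule kap_le)
    ultimately show ?thesis using ln_ge_zero[of "2::real"] by linarith
  next
    case 4
    let ?m = "max (cmod (x - a)) (cmod (x - b))"
    have m: "?m > 0" using 4 by (simp add: less_max_iff_disj)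
    have "cmod (b - a) \<le> cmod (x - a) + cmod (x - b)"
      by (metis add.commute norm_minus_commute norm_triangle_sub dist_norm dist_triangle dist_commute)
    also have "\<dots> \<le> 2 * ?m" by simp
    finally have "ln (cmod (b - a)) \<le> ln (2 * ?m)" using 4 m by (simp add: ln_le_cancel_iff)
    also have "\<dots> = ln 2 + ln ?m" using m by (simp add: ln_mult)
    finally have 1: "ln (cmod (b - a)) \<le> ln 2 + ln ?m" .
    have 2: "kap l a b = min l (max 0 (- ln (cmod (b - a))))" using 4 by (simp add: kap_def)
    have 3: "min (kap l a x) (kap l b x) \<le> min l (max 0 (- ln ?m))"
      using 4 by (auto simp: kap_def max_def)
    have "min l (max 0 (- ln ?m)) \<le> min l (max 0 (- ln (cmod (b - a)))) + ln 2"
      using 1 ln_ge_zero[of "2::real"] by linarith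
    thus ?thesis using 2 3 by linarith
  qed
qed

text \<open>Of the two factors the smaller one is nearly bounded by \<open>kap l a b\<close>, which
  does not depend on \<open>x\<close>. Summing over many points \<open>x\<close> thus leaves a
  quantity on pairs of roots, which the resultant can bound.\<close>

lemma kap_mult_le:
  assumes l: "l \<ge> 0"
  shows "kap l a x * kap l b x \<le> (kap l a b + ln 2) * (kap l a x + kap l b x)"
proof -
  let ?p = "kap l a x" and ?q = "kap l b x"
  have p: "?p \<ge> 0" "?q \<ge> 0" "kap l a b \<ge> 0" using l by (auto intro: kap_nonneg)
  have "?p * ?q = min ?p ?q * max ?p ?q" by (simp add: min_def max_def)
  also have "\<dots> \<le> (kap l a b + ln 2) * (?p + ?q)"
    using p kap_ultra[OF l, of a x b] by (intro mult_mono) auto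
  finally show ?thesis .
qed

text \<open>The left side is what Jensen's formula yields for a root \<open>a\<close> on the circle
  of radius \<open>exp (-l)\<close> about \<open>x\<close>. So the truncation level of
  \<open>kap\<close> is the logarithm of a radius, up to sign.\<close>

lemma ln_max_kap:
  assumes "l \<ge> 0"
  shows "ln (max (exp (-l)) (cmod (x - a))) = - kap l a x + ln (max 1 (cmod (x - a)))"
proof (cases "x = a")
  case False
  define d where "d = cmod (x - a)"
  have d: "d > 0" using False by (simp add: d_def)
  show ?thesis
  proof (cases "d \<ge> 1")
    case True
    have "exp (-l) \<le> 1" using assms by simp
    hence "max (exp (-l)) d = d" using True by linarith
    moreover have "max 1 d = d" "max 0 (- ln d) = 0" using True by auto
    ultimately
    show ?thesis using True False assms by (simp add: kap_def d_def[symmetric])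
  next
    case d1: False
    hence ld: "ln d < 0" using d by simp
    have eq: "exp (-l) \<le> d \<longleftrightarrow> -l \<le> ln d" using d by (metis exp_le_cancel_iff exp_ln)
    show ?thesis using d1 ld False eq d
      by (simp add: kap_def d_def[symmetric] max_def min_def)
  qed
qed (use assms in \<open>auto simp: kap_def max_def\<close>)

lemma ln_prod_mset:
  assumes "\<And>a. a \<in># A \<Longrightarrow> (f a :: real) > 0"
  shows "ln (\<Prod>a\<in>#A. f a) = (\<Sum>a\<in>#A. ln (f a))" "(\<Prod>a\<in>#A. f a) > 0"
proof -
  have "ln (\<Prod>a\<in>#A. f a) = (\<Sum>a\<in>#A. ln (f a)) \<and> (\<Prod>a\<in>#A. f a) > 0"
    using assms
  proof (induction A)
    case (add x A)
    have IH: "ln (\<Prod>a\<in>#A. f a) = (\<Sum>a\<in>#A. ln (f a))" "(\<Prod>a\<in>#A. f a) > 0"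
      using add.IH add.prems by auto
    have "f x > 0" using add.prems by simp
    with IH have "ln (f x * (\<Prod>a\<in>#A. f a)) = ln (f x) + (\<Sum>a\<in>#A. ln (f a))"
      by (simp add: ln_mult_pos)
    with IH \<open>f x > 0\<close> show ?case by (simp del: mult_eq_0_iff)
  qed auto
  thus "ln (\<Prod>a\<in>#A. f a) = (\<Sum>a\<in>#A. ln (f a))" "(\<Prod>a\<in>#A. f a) > 0" by auto
qed

section \<open>Resultants in terms of roots, and the bilinear proximity estimate\<close>

lemma norm_prod_mset: "cmod (prod_mset A) = (\<Prod>a\<in>#A. cmod a)"
  by (induction A) (auto simp: norm_mult)

lemma poly_prod_mset': "poly (prod_mset A) x = (\<Prod>p\<in>#A. poly p x)"
  by (induction A) auto

lemma poly_eq_proots: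
  "poly F x = lead_coeff F * (\<Prod>a\<in>#proots F. (x - a))" for F :: "complex poly"
proof -
  have "poly F x = poly (smult (lead_coeff F) (\<Prod>x\<in>#proots F. [:-x, 1:])) x"
    by (simp only: complex_poly_decompose_multiset)
  also have "\<dots> = lead_coeff F * (\<Prod>a\<in>#proots F. (x - a))"
    by (simp add: poly_prod_mset' image_mset.compositionality o_def)
  finally show ?thesis .
qed

lemma cmod_poly_proots:
  "cmod (poly F x) = cmod (lead_coeff F) * (\<Prod>a\<in>#proots F. cmod (x - a))"
  by (subst poly_eq_proots) (simp add: norm_mult norm_prod_mset image_mset.compositionality o_def)

lemma prod_mset_swap:
  "(\<Prod>a\<in>#A. \<Prod>b\<in>#B. f a b) = (\<Prod>b\<in>#B. \<Prod>a\<in>#A. (f a b :: real))"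
  by (induction A) (auto simp: prod_mset.distrib)

text \<open>Both sides equal \<open>|lc f|^(deg g) |lc g|^(deg f)\<close> times the product of the
  moduli of all differences of roots.\<close>

lemma resultant_sym_aux:
  fixes f g :: "complex poly"
  shows "cmod (lead_coeff f) ^ degree g * (\<Prod>a\<in>#proots f. cmod (poly g a)) =
         cmod (lead_coeff g) ^ degree f * (\<Prod>a\<in>#proots g. cmod (poly f a))"
proof -
  have "(\<Prod>a\<in>#proots f. cmod (poly g a)) =
        cmod (lead_coeff g) ^ degree f * (\<Prod>a\<in>#proots f. \<Prod>b\<in>#proots g. cmod (a - b))" for f g :: "complex poly"
    by (simp add: cmod_poly_proots prod_mset.distrib size_proots_complex)
  note this[of f g] this[of g f]
  moreover have "(\<Prod>a\<in>#proots f. \<Prod>b\<in>#proots g. cmod (a - b)) = (\<Prod>b\<in>#proots g. \<Prod>a\<in>#proots f. cmod (b - a))"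
    by (subst prod_mset_swap) (simp add: norm_minus_commute)
  ultimately show ?thesis by simp
qed

text \<open>Poisson's formula for the Sylvester determinant, along the Euclidean algorithm:
  \<open>f\<close> and \<open>f mod g\<close> take the same values at the roots of \<open>g\<close>.
  Passing to absolute values removes all signs.\<close>

lemma cmod_resultant:
  fixes f g :: "complex poly"
  assumes "f \<noteq> 0" "g \<noteq> 0"
  shows "cmod (resultant f g) = cmod (lead_coeff f) ^ degree g * (\<Prod>a\<in>#proots f. cmod (poly g a))"
proof -
  have main: "cmod (resultant f g) = cmod (lead_coeff g) ^ degree f * (\<Prod>a\<in>#proots g. cmod (poly f a))"
    if "f \<noteq> 0" "g \<noteq> 0" "degree g \<le> degree f" for f g :: "complex poly"
    using that
  proof (induction "degree g" arbitrary: f g rule: less_induct)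
    case less
    show ?case
    proof (cases "degree g = 0")
      case True
      then obtain c where c: "g = [:c:]" by (metis degree_eq_zeroE)
      thus ?thesis by (simp add: norm_power)
    next
      case False
      define H where "H = f mod g"
      define q where "q = f div g"
      have fqg: "f + (- q) * g = H" by (simp add: H_def q_def minus_mult_div_eq_mod mult.commute)
      have H: "H = 0 \<or> degree H < degree g" using False less.prems unfolding H_def
        by (intro degree_mod_less) auto
      hence dH: "degree H < degree g" using False by auto
      have eq: "poly f b = poly H b" if "b \<in># proots g" for b
      proof -
        have "poly g b = 0" using that less.prems by auto
        thus ?thesis using arg_cong[OF fqg, of "\<lambda>p. poly p b"] by simp
      qed
      have pe: "(\<Prod>a\<in>#proots g. cmod (poly f a)) = (\<Prod>a\<in>#proots g. cmod (poly H a))"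
        by (intro arg_cong[of _ _ prod_mset] image_mset_cong) (simp add: eq)
      show ?thesis
      proof (cases "degree H = 0")
        \<comment> \<open>This includes \<open>H = 0\<close>, where both sides vanish because
          \<open>g\<close> has a root.\<close>
        case True
        then obtain c where c: "H = [:c:]" by (metis degree_eq_zeroE)
        have "subresultant (degree H) f g = smult ((-1)^((degree f - degree H) * (degree g - degree H)) * lead_coeff g ^ (degree f - degree H) * lead_coeff H ^ (degree g - degree H - 1)) H"
          by (rule BT_lemma_1_13[OF fqg]) (use less.prems dH in auto)
        hence "cmod (coeff (subresultant 0 f g) 0) = cmod (lead_coeff g) ^ degree f * (cmod c ^ (degree g - 1) * cmod c)"
          by (simp add: True c norm_mult norm_power)
        also have "cmod c ^ (degree g - 1) * cmod c = cmod c ^ degree g" using False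
          by (metis power_minus_mult neq0_conv)
        finally show ?thesis unfolding coeff_subresultant_0_0_resultant pe
          by (simp add: c size_proots_complex)
      next
        case dH0: False
        have "subresultant 0 f g = smult ((-1)^((degree f - 0) * (degree g - 0)) * lead_coeff g ^ (degree f - degree H)) (subresultant 0 g H)"
          by (rule BT_lemma_1_12[OF fqg]) (use less.prems dH dH0 in auto)
        hence "cmod (coeff (subresultant 0 f g) 0) = cmod (lead_coeff g) ^ (degree f - degree H) * cmod (coeff (subresultant 0 g H) 0)"
          by (simp add: norm_mult norm_power)
        hence "cmod (resultant f g) = cmod (lead_coeff g) ^ (degree f - degree H) * cmod (resultant g H)"
          unfolding coeff_subresultant_0_0_resultant .
        also have "cmod (resultant g H) = cmod (lead_coeff H) ^ degree g * (\<Prod>a\<in>#proots H. cmod (poly g a))"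
          by (rule less.hyps) (use dH dH0 less.prems in auto)
        also have "\<dots> = cmod (lead_coeff g) ^ degree H * (\<Prod>a\<in>#proots g. cmod (poly H a))"
          by (rule resultant_sym_aux)
        also have "cmod (lead_coeff g) ^ (degree f - degree H) * \<dots> =
           cmod (lead_coeff g) ^ (degree f - degree H + degree H) * (\<Prod>a\<in>#proots g. cmod (poly H a))"
          by (simp only: power_add mult.assoc)
        also have "degree f - degree H + degree H = degree f" using dH less.prems by simp
        finally show ?thesis unfolding pe .
      qed
    qed
  qed
  show ?thesis
  proof (cases "degree g \<le> degree f")
    case True
    show ?thesis by (subst resultant_sym_aux) (rule main[OF assms True])
  next
    case False
    hence "cmod (resultant g f) = cmod (lead_coeff f) ^ degree g * (\<Prod>a\<in>#proots f. cmod (poly g a))"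
      using main[of g f] assms by simp
    moreover have "cmod (resultant f g) = cmod (resultant g f)"
      by (subst resultant_swap) (simp add: norm_mult norm_power)
    ultimately show ?thesis by simp
  qed
qed

lemma resultant_lower_bound:
  fixes f g :: "int poly"
  assumes f: "f \<noteq> 0" and g: "g \<noteq> 0"
    and cop: "\<forall>z::complex. \<not> (poly (of_int_poly f) z = 0 \<and> poly (of_int_poly g) z = 0)"
  shows "0 \<le> degree g * ln (cmod (lead_coeff (of_int_poly f))) + degree f * ln (cmod (lead_coeff (of_int_poly g))) +
      (\<Sum>a\<in>#proots (of_int_poly f). \<Sum>b\<in>#proots (of_int_poly g). ln (cmod (a - b)))"
proof -
  let ?f = "of_int_poly f :: complex poly" and ?g = "of_int_poly g :: complex poly"
  have nz: "?f \<noteq> 0" "?g \<noteq> 0" using f g by auto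
  have ne: "a \<noteq> b" if "a \<in># proots ?f" "b \<in># proots ?g" for a b
    using that cop nz by auto
  have lc: "cmod (lead_coeff ?f) > 0" "cmod (lead_coeff ?g) > 0" using nz by auto
  have pg: "cmod (poly ?g a) > 0" if "a \<in># proots ?f" for a
    using that cop nz by auto
  have P: "cmod (resultant ?f ?g) > 0"
    unfolding cmod_resultant[OF nz] using lc ln_prod_mset(2)[of "proots ?f" "\<lambda>a. cmod (poly ?g a)"] pg by auto
  moreover have hom: "resultant ?f ?g = of_int (resultant f g)"
    by (rule of_int_hom.resultant_hom)
  ultimately have "resultant f g \<noteq> 0" by auto
  hence "\<bar>real_of_int (resultant f g)\<bar> \<ge> 1" by (metis of_int_1_le_iff of_int_abs zero_less_abs_iff int_one_le_iff_zero_less)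
  hence "cmod (resultant ?f ?g) \<ge> 1" unfolding hom by simp
  hence "0 \<le> ln (cmod (resultant ?f ?g))" by simp
  also have "\<dots> = ln (cmod (lead_coeff ?f) ^ degree ?g) + ln (\<Prod>a\<in>#proots ?f. cmod (poly ?g a))"
    unfolding cmod_resultant[OF nz] using lc pg by (subst ln_mult) (auto intro!: ln_prod_mset(2))
  also have "ln (cmod (lead_coeff ?f) ^ degree ?g) = degree g * ln (cmod (lead_coeff ?f))"
    using lc by (simp add: ln_realpow)
  also have "ln (\<Prod>a\<in>#proots ?f. cmod (poly ?g a)) = (\<Sum>a\<in>#proots ?f. ln (cmod (poly ?g a)))"
    by (rule ln_prod_mset) (rule pg)
  also have "\<dots> = (\<Sum>a\<in>#proots ?f. ln (cmod (lead_coeff ?g)) + (\<Sum>b\<in>#proots ?g. ln (cmod (a - b))))"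
  proof (rule arg_cong[of _ _ sum_mset], rule image_mset_cong)
    fix a assume a: "a \<in># proots ?f"
    have pos: "(\<Prod>b\<in>#proots ?g. cmod (a - b)) > 0"
      by (rule ln_prod_mset(2)) (use ne a in auto)
    show "ln (cmod (poly ?g a)) = ln (cmod (lead_coeff ?g)) + (\<Sum>b\<in>#proots ?g. ln (cmod (a - b)))"
      unfolding cmod_poly_proots using lc pos
      by (subst ln_mult) (auto intro!: ln_prod_mset(1) simp: ne[OF a])
  qed
  also have "\<dots> = degree f * ln (cmod (lead_coeff ?g)) + (\<Sum>a\<in>#proots ?f. \<Sum>b\<in>#proots ?g. ln (cmod (a - b)))"
    by (simp add: sum_mset.distrib size_proots_complex)
  finally show ?thesis by (simp add: add_ac)
qed

lemma sum_mset_sum_swap: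
  "(\<Sum>y\<in>Y. \<Sum>a\<in>#A. f y a) = (\<Sum>a\<in>#A. \<Sum>y\<in>Y. (f y a :: real))"
  by (induction A) (auto simp: sum.distrib)

lemma sum_mset_cmult:
  "(\<Sum>a\<in>#A. c * f a) = c * (\<Sum>a\<in>#A. (f a :: real))"
  by (induction A) (simp_all add: distrib_left)

lemma sum_mset_minus:
  "(\<Sum>a\<in>#A. f a - g a) = (\<Sum>a\<in>#A. f a) - (\<Sum>a\<in>#A. (g a :: real))"
  by (induction A) simp_all

lemma sum_mset_prod:
  "(\<Sum>a\<in>#A. f a) * (\<Sum>b\<in>#B. g b) = (\<Sum>a\<in>#A. \<Sum>b\<in>#B. f a * (g b :: real))"
  unfolding sum_mset_cmult
  by (induction A) (simp_all only: image_mset_empty sum_mset.empty image_mset_add_mset sum_mset.add_mset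
      distrib_right mult_zero_left)

text \<open>For close roots the left side is at most zero, as \<open>kap\<close> truncates
  \<open>-ln\<close> of the distance; distant roots are paid for by the Mahler measures.\<close>

lemma kap_add_ln_le:
  assumes "a \<noteq> b"
  shows "kap l a b + ln (cmod (a - b)) \<le> ln 2 + ln (max 1 (cmod a)) + ln (max 1 (cmod b))"
proof -
  define d where "d = cmod (a - b)"
  have d: "d > 0" using assms by (simp add: d_def)
  have db: "cmod (b - a) = d" by (simp add: d_def norm_minus_commute)
  have "kap l a b + ln d \<le> max 0 (- ln d) + ln d"
    using assms by (simp add: kap_def db)
  also have "\<dots> = max 0 (ln d)" by auto
  also have "\<dots> = ln (max 1 d)" using d by (auto simp: max_def)
  also have "\<dots> \<le> ln (2 * max 1 (cmod a) * max 1 (cmod b))"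
  proof -
    define A B where "A = max 1 (cmod a)" and "B = max 1 (cmod b)"
    have AB: "A \<ge> 1" "B \<ge> 1" "cmod a \<le> A" "cmod b \<le> B" by (auto simp: A_def B_def)
    have "A * 1 \<le> A * B" "1 * B \<le> A * B" using AB by (auto intro!: mult_mono)
    moreover have "d \<le> cmod a + cmod b" unfolding d_def by (rule norm_triangle_ineq4)
    ultimately have "d \<le> 2 * A * B" "1 \<le> 2 * A * B" using AB by linarith+
    hence "max 1 d \<le> 2 * A * B" by simp
    thus ?thesis unfolding A_def B_def by (intro ln_mono) auto
  qed
  also have "\<dots> = ln 2 + ln (max 1 (cmod a)) + ln (max 1 (cmod b))"
    by (subst ln_mult_pos, simp_all add: less_max_iff_disj)+
  finally show ?thesis by (simp add: d_def)
qed

text \<open>\<open>L\<close> bounds the total proximity of one number to all points of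
  \<open>Y\<close>, so a root may be very near a single point but not near many. The product is
  expanded over pairs of roots and summed over \<open>Y\<close> first; what is left is bounded
  through the logarithm of the resultant.\<close>

lemma prox_bilinear:
  fixes f g :: "int poly"
  defines "F \<equiv> of_int_poly f :: complex poly" and "G \<equiv> of_int_poly g :: complex poly"
  assumes f: "f \<noteq> 0" and g: "g \<noteq> 0"
    and cop: "\<forall>z. \<not> (poly F z = 0 \<and> poly G z = 0)"
    and l: "l \<ge> 0" and L: "\<And>a. (\<Sum>y\<in>Y. kap l a y) \<le> L"
  shows "(\<Sum>y\<in>Y. prox l F y * prox l G y) \<le>
     2 * L * (degree g * lmeas F + degree f * lmeas G + 2 * degree f * degree g * ln 2)"
proof -
  have L0: "L \<ge> 0" using L[of 0] sum_nonneg[of Y "\<lambda>y. kap l 0 y"] kap_nonneg[OF l] by (meson order_trans)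
  have nz: "F \<noteq> 0" "G \<noteq> 0" using f g by (auto simp: F_def G_def)
  have ne: "a \<noteq> b" if "a \<in># proots F" "b \<in># proots G" for a b
    using that cop nz by auto
  have dF: "size (proots F) = degree f" "size (proots G) = degree g"
    by (simp_all add: F_def G_def size_proots_complex)
  have "(\<Sum>y\<in>Y. prox l F y * prox l G y) = (\<Sum>y\<in>Y. \<Sum>a\<in>#proots F. \<Sum>b\<in>#proots G. kap l a y * kap l b y)"
    unfolding prox_def sum_mset_prod ..
  also have "\<dots> = (\<Sum>a\<in>#proots F. \<Sum>b\<in>#proots G. \<Sum>y\<in>Y. kap l a y * kap l b y)"
    by (simp add: sum_mset_sum_swap)
  also have "\<dots> \<le> (\<Sum>a\<in>#proots F. \<Sum>b\<in>#proots G. (kap l a b + ln 2) * (2 * L))"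
  proof (intro sum_mset_mono)
    fix a b
    have "(\<Sum>y\<in>Y. kap l a y * kap l b y) \<le> (\<Sum>y\<in>Y. (kap l a b + ln 2) * (kap l a y + kap l b y))"
      by (intro sum_mono kap_mult_le l)
    also have "\<dots> = (kap l a b + ln 2) * ((\<Sum>y\<in>Y. kap l a y) + (\<Sum>y\<in>Y. kap l b y))"
      by (simp only: sum_distrib_left[symmetric] sum.distrib)
    also have "\<dots> \<le> (kap l a b + ln 2) * (2 * L)"
      using L[of a] L[of b] kap_nonneg[OF l, of a b] by (intro mult_left_mono) auto
    finally show "(\<Sum>y\<in>Y. kap l a y * kap l b y) \<le> (kap l a b + ln 2) * (2 * L)" .
  qed
  also have "\<dots> = 2 * L * (\<Sum>a\<in>#proots F. \<Sum>b\<in>#proots G. kap l a b + ln 2)"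
    by (simp only: mult.commute[of _ "2 * L"] sum_mset_cmult)
  also have "\<dots> \<le> 2 * L * (\<Sum>a\<in>#proots F. \<Sum>b\<in>#proots G.
       2 * ln 2 + ln (max 1 (cmod a)) + ln (max 1 (cmod b)) - ln (cmod (a - b)))"
  proof (intro mult_left_mono sum_mset_mono)
    fix a b assume "a \<in># proots F" "b \<in># proots G"
    hence "a \<noteq> b" by (rule ne)
    from kap_add_ln_le[OF this, of l]
    show "kap l a b + ln 2 \<le> 2 * ln 2 + ln (max 1 (cmod a)) + ln (max 1 (cmod b)) - ln (cmod (a - b))"
      by linarith
  qed (use L0 in auto)
  also have "(\<Sum>a\<in>#proots F. \<Sum>b\<in>#proots G.
       2 * ln 2 + ln (max 1 (cmod a)) + ln (max 1 (cmod b)) - ln (cmod (a - b))) =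
     2 * degree f * degree g * ln 2 + degree g * (\<Sum>a\<in>#proots F. ln (max 1 (cmod a))) +
     degree f * (\<Sum>b\<in>#proots G. ln (max 1 (cmod b))) - (\<Sum>a\<in>#proots F. \<Sum>b\<in>#proots G. ln (cmod (a - b)))"
    by (simp only: sum_mset.distrib sum_mset_minus sum_mset_cmult sum_mset_constant dF) (simp add: algebra_simps)
  also have "\<dots> \<le> degree g * lmeas F + degree f * lmeas G + 2 * degree f * degree g * ln 2"
    using resultant_lower_bound[OF f g cop[unfolded F_def G_def]]
    unfolding lmeas_def F_def G_def distrib_left by linarith
  finally show ?thesis using L0 by (simp add: mult_left_mono)
qed

text \<open>Jensen's inequality for the disc of radius \<open>r\<close> about \<open>x\<close>. The
  linear factor of each root inside the disc is replaced by the reflected factor \<phi>, which has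
  the same modulus on the circle; the new function then has the left side as its modulus at the
  centre.\<close>

lemma mahler_le_sup:
  fixes F :: "complex poly"
  assumes r: "r > 0" and B: "\<And>z. cmod (z - x) = r \<Longrightarrow> cmod (poly F z) \<le> B"
  shows "cmod (lead_coeff F) * (\<Prod>a\<in>#proots F. max r (cmod (x - a))) \<le> B"
proof -
  define \<phi> where "\<phi> = (\<lambda>a z. if cmod (a - x) \<ge> r then z - a else (of_real r ^ 2 - cnj (a - x) * (z - x)) / of_real r)"
  have hol: "(\<lambda>z. \<Prod>a\<in>#A. \<phi> a z) holomorphic_on UNIV" for A
  proof (induction A)
    case (add a A)
    have "\<phi> a holomorphic_on UNIV" unfolding \<phi>_def
      by (cases "cmod (a - x) \<ge> r") (auto intro!: holomorphic_intros simp: r[THEN less_imp_neq, symmetric] \<open>r > 0\<close>)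
    from holomorphic_on_mult[OF this add.IH] show ?case by simp
  qed auto
  define G where "G = (\<lambda>z. lead_coeff F * (\<Prod>a\<in>#proots F. \<phi> a z))"
  have holG: "G holomorphic_on UNIV" unfolding G_def by (intro holomorphic_intros hol)
  have \<phi>1: "cmod (\<phi> a z) = cmod (z - a)" if z: "cmod (z - x) = r" for a z
  proof (cases "cmod (a - x) \<ge> r")
    case False
    have "complex_of_real r ^ 2 = (z - x) * cnj (z - x)"
      using complex_norm_square[of "z - x"] z by simp
    hence "of_real r ^ 2 - cnj (a - x) * (z - x) = (z - x) * cnj (z - a)"
      by (simp add: algebra_simps)
    hence "cmod (\<phi> a z) = cmod (z - x) * cmod (z - a) / r"
      using False r by (simp only: \<phi>_def if_False norm_mult norm_divide complex_mod_cnj norm_of_real)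
    thus ?thesis using z r by simp
  qed (simp add: \<phi>_def)
  have \<phi>2: "cmod (\<phi> a x) = max r (cmod (x - a))" for a
  proof (cases "cmod (a - x) \<ge> r")
    case True
    thus ?thesis by (simp add: \<phi>_def norm_minus_commute max_def)
  next
    case False
    hence "\<phi> a x = of_real r" using r by (simp add: \<phi>_def power2_eq_square)
    thus ?thesis using False r by (simp add: norm_minus_commute max_def)
  qed
  \<comment> \<open>Cauchy's inequality for the derivative of order zero is the maximum principle at
    the centre.\<close>
  have "cmod ((deriv ^^ 0) G x) \<le> fact 0 * B / r ^ 0"
  proof (rule Cauchy_inequality)
    show "G holomorphic_on ball x r" using holG holomorphic_on_subset by blast
    show "continuous_on (cball x r) G" using holG holomorphic_on_imp_continuous_on holomorphic_on_subset by blast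
    fix z assume "cmod (x - z) = r"
    hence z: "cmod (z - x) = r" by (simp add: norm_minus_commute)
    have "cmod (G z) = cmod (poly F z)"
      unfolding G_def cmod_poly_proots using \<phi>1[OF z]
      by (simp add: norm_mult norm_prod_mset image_mset.compositionality o_def)
    thus "cmod (G z) \<le> B" using B[OF z] by simp
  qed (rule r)
  hence "cmod (G x) \<le> B" by simp
  thus ?thesis by (simp add: G_def norm_mult norm_prod_mset image_mset.compositionality o_def \<phi>2)
qed

lemma lmeas_le_sup:
  assumes "F \<noteq> 0" and B: "\<And>z. cmod z = 1 \<Longrightarrow> cmod (poly F z) \<le> exp B"
  shows "lmeas F \<le> B"
proof -
  have "cmod (lead_coeff F) * (\<Prod>a\<in>#proots F. max 1 (cmod (0 - a))) \<le> exp B"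
    by (rule mahler_le_sup) (use B in auto)
  moreover have p: "(\<Prod>a\<in>#proots F. max 1 (cmod a)) > 0" by (rule ln_prod_mset(2)) auto
  moreover have lc: "cmod (lead_coeff F) > 0" using assms by auto
  ultimately have "ln (cmod (lead_coeff F) * (\<Prod>a\<in>#proots F. max 1 (cmod a))) \<le> B"
    using ln_mono[of "cmod (lead_coeff F) * (\<Prod>a\<in>#proots F. max 1 (cmod a))" "exp B"] by simp
  also have "ln (cmod (lead_coeff F) * (\<Prod>a\<in>#proots F. max 1 (cmod a))) = lmeas F"
    unfolding lmeas_def ln_mult_pos[OF lc p] by (subst ln_prod_mset(1)) (simp_all add: less_max_iff_disj)
  finally show ?thesis .
qed

text \<open>Jensen's inequality on the circle of radius \<open>exp (-l)\<close>. Integrality makes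
  the leading coefficient at least 1 in modulus, and distant roots only help, so both are
  dropped.\<close>

lemma prox_ge_of_sup:
  fixes f :: "int poly"
  assumes f: "f \<noteq> 0" and l: "l \<ge> 0"
    and B: "\<And>z. cmod (z - x) = exp (-l) \<Longrightarrow> cmod (poly (of_int_poly f) z) \<le> exp (-B)"
  shows "prox l (of_int_poly f) x \<ge> B"
proof -
  let ?F = "of_int_poly f :: complex poly"
  have "cmod (lead_coeff ?F) * (\<Prod>a\<in>#proots ?F. max (exp (-l)) (cmod (x - a))) \<le> exp (-B)"
    by (rule mahler_le_sup) (use B in auto)
  moreover have p: "(\<Prod>a\<in>#proots ?F. max (exp (-l)) (cmod (x - a))) > 0" by (rule ln_prod_mset(2)) (auto simp: less_max_iff_disj)
  moreover have lc: "cmod (lead_coeff ?F) \<ge> 1"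
  proof -
    have "\<bar>lead_coeff f\<bar> \<ge> 1" using f by (simp add: int_one_le_iff_zero_less)
    hence "real_of_int \<bar>lead_coeff f\<bar> \<ge> 1" by linarith
    thus ?thesis by simp
  qed
  moreover have "1 * (\<Prod>a\<in>#proots ?F. max (exp (-l)) (cmod (x - a))) \<le> cmod (lead_coeff ?F) * (\<Prod>a\<in>#proots ?F. max (exp (-l)) (cmod (x - a)))"
    by (rule mult_right_mono[OF lc]) (use p in simp)
  ultimately have "(\<Prod>a\<in>#proots ?F. max (exp (-l)) (cmod (x - a))) \<le> exp (-B)"
    by linarith
  from ln_mono[OF this p] have "ln (\<Prod>a\<in>#proots ?F. max (exp (-l)) (cmod (x - a))) \<le> - B"
    by simp
  also have "ln (\<Prod>a\<in>#proots ?F. max (exp (-l)) (cmod (x - a))) = (\<Sum>a\<in>#proots ?F. ln (max (exp (-l)) (cmod (x - a))))"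
    by (rule ln_prod_mset(1)) (auto simp: less_max_iff_disj)
  also have "\<dots> = - prox l ?F x + (\<Sum>a\<in>#proots ?F. ln (max 1 (cmod (x - a))))"
    unfolding ln_max_kap[OF l] prox_def by (simp add: sum_mset_minus)
  finally have "prox l ?F x \<ge> B + (\<Sum>a\<in>#proots ?F. ln (max 1 (cmod (x - a))))" by simp
  moreover have "(\<Sum>a\<in>#proots ?F. ln (max 1 (cmod (x - a)))) \<ge> 0"
    using sum_mset_mono[of "proots ?F" "\<lambda>_. 0" "\<lambda>a. ln (max 1 (cmod (x - a)))"] by auto
  ultimately show ?thesis by linarith
qed

lemma prox_mult:
  assumes "F \<noteq> 0" "G \<noteq> 0"
  shows "prox l (F * G) x = prox l F x + prox l G x"
proof -
  have "proots (F * G) = proots F + proots G" using assms by (intro proots_mult) auto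
  thus ?thesis by (simp only: prox_def image_mset_union sum_mset.union)
qed

lemma prox_smult: "c \<noteq> 0 \<Longrightarrow> prox l (smult c F) x = prox l F x"
  by (simp add: prox_def)

lemma prox_nonneg: "l \<ge> 0 \<Longrightarrow> prox l F x \<ge> 0"
  unfolding prox_def using sum_mset_mono[of "proots F" "\<lambda>_. 0" "\<lambda>a. kap l a x"] kap_nonneg by auto

lemma prox_mono: "l \<le> l' \<Longrightarrow> prox l F x \<le> prox l' F x"
  unfolding prox_def by (intro sum_mset_mono kap_mono)

lemma lmeas_mult:
  assumes "F \<noteq> 0" "G \<noteq> 0"
  shows "lmeas (F * G) = lmeas F + lmeas G"
proof -
  have 1: "proots (F * G) = proots F + proots G" using assms by (intro proots_mult) auto
  have "cmod (lead_coeff F) > 0" "cmod (lead_coeff G) > 0" using assms by auto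
  hence 2: "ln (cmod (lead_coeff (F * G))) = ln (cmod (lead_coeff F)) + ln (cmod (lead_coeff G))"
    by (simp only: lead_coeff_mult norm_mult ln_mult_pos)
  show ?thesis by (simp only: lmeas_def 1 2 image_mset_union sum_mset.union)
qed

lemma lmeas_int_nonneg:
  assumes "f \<noteq> 0"
  shows "lmeas (of_int_poly f) \<ge> 0"
proof -
  have "\<bar>lead_coeff f\<bar> \<ge> 1" using assms by (simp add: int_one_le_iff_zero_less)
  hence "real_of_int \<bar>lead_coeff f\<bar> \<ge> 1" by linarith
  moreover have "(\<Sum>a\<in>#proots (of_int_poly f :: complex poly). ln (max 1 (cmod a))) \<ge> 0"
    using sum_mset_mono[of "proots (of_int_poly f)" "\<lambda>_. 0" "\<lambda>a. ln (max 1 (cmod a))"] by auto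
  ultimately show ?thesis by (simp add: lmeas_def)
qed

text \<open>The entropy inequality behind edge isoperimetry: \<open>min a b\<close> pays for the
  edges between two parts of sizes \<open>a\<close> and \<open>b\<close>.\<close>

lemma x_log_x_superadditive:
  fixes a b :: real
  assumes "a > 0" "b > 0"
  shows "a * log 2 a + b * log 2 b + min a b \<le> (a + b) * log 2 (a + b)"
proof -
  have main: "a * log 2 a + b * log 2 b + a \<le> (a + b) * log 2 (a + b)" if "0 < a" "a \<le> b" for a b :: real
  proof -
    have "log 2 (2 * a) \<le> log 2 (a + b)" using that by (intro log_mono) auto
    hence "log 2 a + 1 \<le> log 2 (a + b)" using that by (simp add: log_mult)
    hence "a * (log 2 a + 1) \<le> a * log 2 (a + b)" using that by (intro mult_left_mono) auto
    moreover have "b * log 2 b \<le> b * log 2 (a + b)" using that by (intro mult_left_mono log_mono) auto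
    ultimately show ?thesis by (simp add: algebra_simps)
  qed
  show ?thesis
    using main[of a b] main[of b a] assms by (cases "a \<le> b") (auto simp: min_def algebra_simps)
qed

subsection \<open>Edge isoperimetry for dilations\<close>

text \<open>Free actions of the monoid of positive integers under multiplication. Commensurable
  points differ by a fraction \<open>s/t\<close> and so have a relative exponent at each prime,
  which takes the place of a coordinate.\<close>

locale free_dilation =
  fixes act :: "nat \<Rightarrow> 'a \<Rightarrow> 'a" and C :: "'a set"
  assumes closed: "x \<in> C \<Longrightarrow> s > 0 \<Longrightarrow> act s x \<in> C"
    and comp: "x \<in> C \<Longrightarrow> s > 0 \<Longrightarrow> t > 0 \<Longrightarrow> act s (act t x) = act (s * t) x"
    and inject: "x \<in> C \<Longrightarrow> y \<in> C \<Longrightarrow> s > 0 \<Longrightarrow> act s x = act s y \<Longrightarrow> x = y"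
    and free: "x \<in> C \<Longrightarrow> s > 0 \<Longrightarrow> t > 0 \<Longrightarrow> act s x = act t x \<Longrightarrow> s = t"
begin

definition edges :: "nat set \<Rightarrow> 'a set \<Rightarrow> ('a \<times> nat) set" where
  "edges Pr W = {(x, p). x \<in> W \<and> p \<in> Pr \<and> act p x \<in> W}"

lemma finite_edges: "finite Pr \<Longrightarrow> finite W \<Longrightarrow> finite (edges Pr W)"
  by (rule finite_subset[of _ "W \<times> Pr"]) (auto simp: edges_def)

text \<open>Induction by cutting \<open>W\<close> at a prime \<open>p\<close> that labels some edge.
  All edges between the two parts carry the label \<open>p\<close> and point the same way, so their
  number is at most the size of either part.\<close>

lemma card_edges_le:
  assumes Pr: "finite Pr" "\<And>p. p \<in> Pr \<Longrightarrow> prime p" and W: "finite W" "W \<subseteq> C"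
  shows "real (card (edges Pr W)) \<le> card W * log 2 (card W)"
  using W
proof (induction "card W" arbitrary: W rule: less_induct)
  case less
  show ?case
  proof (cases "edges Pr W = {}")
    case True
    thus ?thesis by (cases "card W = 0") auto
  next
    case False
    then obtain x0 p where x0: "x0 \<in> W" "p \<in> Pr" "act p x0 \<in> W" by (auto simp: edges_def)
    have p: "prime p" "p > 0" using Pr x0 prime_gt_0_nat by auto
    have C0: "x0 \<in> C" using x0 less.prems by auto
    \<comment> \<open>The points whose exponent of \<open>p\<close> relative to \<open>x0\<close> is
      positive. Points not commensurable with \<open>x0\<close> stay in \<open>W1\<close>.\<close>
    define W2 where "W2 = {w \<in> W. \<exists>s t. s > 0 \<and> t > 0 \<and> p dvd s \<and> \<not> p dvd t \<and> act t w = act s x0}"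
    define W1 where "W1 = W - W2"
    have "x0 \<notin> W2"
    proof
      assume "x0 \<in> W2"
      then obtain s t where st: "s > 0" "t > 0" "p dvd s" "\<not> p dvd t" "act t x0 = act s x0"
        by (auto simp: W2_def)
      thus False using free[OF C0 st(2,1) st(5)] by auto
    qed
    hence x01: "x0 \<in> W1" using x0 by (simp add: W1_def)
    have "act 1 (act p x0) = act p x0" using comp[OF C0, of 1 p] p by simp
    hence "act p x0 \<in> W2" unfolding W2_def mem_Collect_eq using x0 p not_prime_1
      by (intro conjI exI[of _ p] exI[of _ "1::nat"]) auto
    hence ne2: "W2 \<noteq> {}" by auto
    have fin: "finite W1" "finite W2" and sub: "W1 \<subseteq> C" "W2 \<subseteq> C" and WW: "W = W1 \<union> W2" "W1 \<inter> W2 = {}"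
      using less.prems by (auto simp: W1_def W2_def)
    have cW: "card W = card W1 + card W2" using WW fin by (simp add: card_Un_disjoint)
    have pos: "card W1 > 0" "card W2 > 0" using fin x01 ne2 by (auto simp: card_gt_0_iff)
    define X where "X = {x \<in> W1. act p x \<in> W2}"
    have "edges Pr W \<subseteq> edges Pr W1 \<union> edges Pr W2 \<union> (\<lambda>x. (x, p)) ` X"
    proof
      fix e assume "e \<in> edges Pr W"
      then obtain x q where e: "e = (x, q)" "x \<in> W" "q \<in> Pr" "act q x \<in> W" by (auto simp: edges_def)
      have q: "prime q" "q > 0" using Pr e prime_gt_0_nat by auto
      have xC: "x \<in> C" using e less.prems by auto
      consider "x \<in> W1" "act q x \<in> W1" | "x \<in> W2" "act q x \<in> W2" | "x \<in> W1" "act q x \<in> W2" | "x \<in> W2" "act q x \<in> W1"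
        using e WW by blast
      thus "e \<in> edges Pr W1 \<union> edges Pr W2 \<union> (\<lambda>x. (x, p)) ` X"
      proof cases
        \<comment> \<open>An edge with a label other than \<open>p\<close> leaves the exponent of
          \<open>p\<close> unchanged, so it cannot lead from \<open>W1\<close> into
          \<open>W2\<close>.\<close>
        case 3
        then obtain s t where st: "s > 0" "t > 0" "p dvd s" "\<not> p dvd t" "act t (act q x) = act s x0"
          by (auto simp: W2_def)
        have "q = p"
        proof (rule ccontr)
          assume "q \<noteq> p"
          hence "\<not> p dvd q" using p q primes_dvd_imp_eq by blast
          hence "\<not> p dvd t * q" using st p by (simp add: prime_dvd_mult_iff)
          moreover have "act (t * q) x = act s x0" using comp[OF xC st(2) q(2)] st by simp
          ultimately have "x \<in> W2" using st e q unfolding W2_def mem_Collect_eq by (intro conjI exI[of _ s] exI[of _ "t * q"]) auto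
          thus False using 3 by (auto simp: W1_def)
        qed
        thus ?thesis using 3 e by (auto simp: X_def)
      next
        \<comment> \<open>Dilation never lowers the exponent of \<open>p\<close>, so no edge leaves
          \<open>W2\<close>.\<close>
        case 4
        then obtain s t where st: "s > 0" "t > 0" "p dvd s" "\<not> p dvd t" "act t x = act s x0"
          by (auto simp: W2_def)
        have "act t (act q x) = act q (act t x)" using comp[OF xC, of t q] comp[OF xC, of q t] st q by (simp add: mult.commute)
        also have "\<dots> = act (q * s) x0" using comp[OF C0] st q by simp
        finally have "act q x \<in> W2" using e st q unfolding W2_def mem_Collect_eq by (intro conjI exI[of _ "q * s"] exI[of _ t]) auto
        thus ?thesis using 4 by (auto simp: W1_def)
      qed (use e in \<open>auto simp: edges_def\<close>)
    qed
    hence "card (edges Pr W) \<le> card (edges Pr W1 \<union> edges Pr W2 \<union> (\<lambda>x. (x, p)) ` X)"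
      using fin Pr by (intro card_mono) (auto simp: finite_edges X_def)
    also have "\<dots> \<le> card (edges Pr W1) + card (edges Pr W2) + card X"
    proof -
      have "card ((\<lambda>x. (x, p)) ` X) \<le> card X" by (rule card_image_le) (use fin in \<open>simp add: X_def\<close>)
      thus ?thesis
        using card_Un_le[of "edges Pr W1 \<union> edges Pr W2" "(\<lambda>x. (x, p)) ` X"] card_Un_le[of "edges Pr W1" "edges Pr W2"]
        by linarith
    qed
    finally have "card (edges Pr W) \<le> card (edges Pr W1) + card (edges Pr W2) + card X" .
    moreover have "card X \<le> card W1" using fin by (auto simp: X_def intro!: card_mono)
    moreover have "card X \<le> card W2"
    proof (rule card_inj_on_le)
      show "inj_on (act p) X" using inject sub p by (auto simp: inj_on_def X_def)
      show "act p ` X \<subseteq> W2" by (auto simp: X_def)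
    qed (rule fin)
    moreover have "real (card (edges Pr W1)) \<le> card W1 * log 2 (card W1)"
      by (rule less.hyps) (use fin sub cW pos in auto)
    moreover have "real (card (edges Pr W2)) \<le> card W2 * log 2 (card W2)"
      by (rule less.hyps) (use fin sub cW pos in auto)
    moreover have "card W1 * log 2 (card W1) + card W2 * log 2 (card W2) + min (real (card W1)) (real (card W2))
        \<le> (real (card W1) + real (card W2)) * log 2 (real (card W1) + real (card W2))"
      by (rule x_log_x_superadditive) (use pos in auto)
    ultimately show ?thesis unfolding cW by (simp add: min_def split: if_splits)
  qed
qed

text \<open>Level sets: subtracting the minimum of \<open>F\<close> costs this minimum times the
  edge count, and leaves a weight that vanishes at the minimiser, which can then be removed.\<close>

lemma sum_edges_le:
  assumes Pr: "finite Pr" "\<And>p. p \<in> Pr \<Longrightarrow> prime p" and W: "finite W" "W \<subseteq> C"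
    and n: "card W \<le> n" and F: "\<And>x. x \<in> W \<Longrightarrow> F x \<ge> (0::real)"
  shows "(\<Sum>(x, p)\<in>edges Pr W. min (F x) (F (act p x))) \<le> log 2 n * (\<Sum>x\<in>W. F x)"
  using W n F
proof (induction "card W" arbitrary: W F)
  case 0
  hence "W = {}" by auto
  thus ?case by (simp add: edges_def)
next
  case (Suc k)
  have "W \<noteq> {}" using Suc by auto
  then obtain z where z: "z \<in> W" "\<And>x. x \<in> W \<Longrightarrow> F z \<le> F x"
    using Suc.prems(1) arg_min_if_finite[of W F] by (metis linorder_not_less)
  define m where "m = F z"
  define G where "G = (\<lambda>x. F x - m)"
  have m0: "m \<ge> 0" using Suc.prems z by (simp add: m_def)
  have G0: "G x \<ge> 0" if "x \<in> W" for x using z that by (simp add: G_def m_def)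
  have Gz: "G z = 0" by (simp add: G_def m_def)
  have fin: "finite (edges Pr W)" using finite_edges Pr Suc.prems by blast
  have "(\<Sum>(x, p)\<in>edges Pr W. min (F x) (F (act p x))) = (\<Sum>(x, p)\<in>edges Pr W. m + min (G x) (G (act p x)))"
    by (intro sum.cong) (auto simp: G_def min_def)
  also have "\<dots> = m * card (edges Pr W) + (\<Sum>(x, p)\<in>edges Pr W. min (G x) (G (act p x)))"
    by (simp add: case_prod_unfold sum.distrib)
  also have "(\<Sum>(x, p)\<in>edges Pr W. min (G x) (G (act p x))) = (\<Sum>(x, p)\<in>edges Pr (W - {z}). min (G x) (G (act p x)))"
  proof (rule sum.mono_neutral_right[OF fin])
    show "\<forall>e\<in>edges Pr W - edges Pr (W - {z}). (case e of (x, p) \<Rightarrow> min (G x) (G (act p x))) = 0"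
    proof (clarify, rename_tac x p)
      fix x p assume e: "(x, p) \<in> edges Pr W" "(x, p) \<notin> edges Pr (W - {z})"
      hence "G x \<ge> 0" "G (act p x) \<ge> 0" "G x = 0 \<or> G (act p x) = 0"
        using G0 Gz by (auto simp: edges_def)
      thus "min (G x) (G (act p x)) = 0" by linarith
    qed
  qed (auto simp: edges_def)
  also have "\<dots> \<le> log 2 n * (\<Sum>x\<in>W - {z}. G x)"
    by (rule Suc.hyps(1)) (use Suc z G0 in auto)
  also have "(\<Sum>x\<in>W - {z}. G x) = (\<Sum>x\<in>W. G x)"
    using z(1) Suc.prems(1) Gz by (simp add: sum_diff1)
  also have "\<dots> = (\<Sum>x\<in>W. F x) - m * card W" by (simp add: G_def sum_subtractf)
  also have "m * card (edges Pr W) \<le> m * (card W * log 2 n)"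
  proof (rule mult_left_mono)
    have "card W > 0" using Suc by simp
    hence "log 2 (card W) \<le> log 2 n" using Suc.prems by (intro log_mono) auto
    hence "card W * log 2 (card W) \<le> card W * log 2 n" by (intro mult_left_mono) auto
    thus "real (card (edges Pr W)) \<le> card W * log 2 n"
      using card_edges_le[OF Pr Suc.prems(1,2)] by linarith
  qed (rule m0)
  finally show ?case by (simp add: algebra_simps)
qed

text \<open>Every \<open>u\<close> of positive weight has an incoming edge for each prime of
  \<open>Pr\<close>, starting at a point whose weight \<open>F'\<close> is at least
  \<open>F u\<close>. So the weighted edge count is at least \<open>card Pr\<close> times the weight
  of \<open>F\<close>. A second weight \<open>F'\<close> is allowed because heights grow under
  dilation.\<close>

lemma expansion:
  fixes F F' :: "'a \<Rightarrow> real"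
  assumes Pr: "finite Pr" "\<And>p. p \<in> Pr \<Longrightarrow> prime p" and W: "finite W" "W \<subseteq> C"
    and n: "card W \<le> n" and F: "\<And>x. x \<in> W \<Longrightarrow> 0 \<le> F x" "\<And>x. x \<in> W \<Longrightarrow> F x \<le> F' x"
    and ex: "\<And>u p. u \<in> W \<Longrightarrow> p \<in> Pr \<Longrightarrow> F u > 0 \<Longrightarrow> \<exists>v\<in>W. act p v = u \<and> F u \<le> F' v"
  shows "card Pr * (\<Sum>x\<in>W. F x) \<le> log 2 n * (\<Sum>x\<in>W. F' x)"
proof -
  define D where "D = {u \<in> W. F u > 0} \<times> Pr"
  obtain v where v: "\<And>u p. (u, p) \<in> D \<Longrightarrow> v u p \<in> W \<and> act p (v u p) = u \<and> F u \<le> F' (v u p)"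
    using ex unfolding D_def by (metis (no_types, lifting) mem_Collect_eq mem_Sigma_iff)
  have v2: "act p (v u p) = u" if "(u, p) \<in> D" for u p using v[OF that] by simp
  have F'0: "F' x \<ge> 0" if "x \<in> W" for x using F that by force
  have "card Pr * (\<Sum>x\<in>W. F x) = card Pr * (\<Sum>x\<in>{u \<in> W. F u > 0}. F x)"
  proof -
    have "(\<Sum>x\<in>W. F x) = (\<Sum>x\<in>{u \<in> W. F u > 0}. F x)"
      using W F by (intro sum.mono_neutral_right) (auto simp: not_less antisym)
    thus ?thesis by simp
  qed
  also have "\<dots> = (\<Sum>(u, p)\<in>D. F u)"
    unfolding D_def sum.cartesian_product[symmetric] by (simp add: sum_distrib_left)
  also have "\<dots> \<le> (\<Sum>(u, p)\<in>D. min (F' (v u p)) (F' (act p (v u p))))"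
    using v F by (intro sum_mono) (auto simp: D_def)
  also have "\<dots> = (\<Sum>(x, p)\<in>(\<lambda>(u, p). (v u p, p)) ` D. min (F' x) (F' (act p x)))"
  proof -
    \<comment> \<open>An edge determines its end point \<open>u = act p v\<close>, so distinct pairs
      give distinct edges.\<close>
    have "inj_on (\<lambda>(u, p). (v u p, p)) D"
    proof (rule inj_onI)
      fix e e' assume e: "e \<in> D" "e' \<in> D" "(case e of (u, p) \<Rightarrow> (v u p, p)) = (case e' of (u, p) \<Rightarrow> (v u p, p))"
      obtain u p u' p' where uv: "e = (u, p)" "e' = (u', p')" by (cases e, cases e') auto
      have "act p (v u p) = u" using e(1) unfolding uv(1) by (rule v2)
      moreover have "act p' (v u' p') = u'" using e(2) unfolding uv(2) by (rule v2)
      ultimately show "e = e'" using e(3) unfolding uv by (simp only: split prod.inject) metis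
    qed
    from sum.reindex[OF this, of "\<lambda>(x, p). min (F' x) (F' (act p x))"] show ?thesis
      by (simp add: case_prod_unfold o_def)
  qed
  also have "\<dots> \<le> (\<Sum>(x, p)\<in>edges Pr W. min (F' x) (F' (act p x)))"
  proof (rule sum_mono2)
    show "(\<lambda>(u, p). (v u p, p)) ` D \<subseteq> edges Pr W"
    proof clarify
      fix u p assume "(u, p) \<in> D"
      thus "(v u p, p) \<in> edges Pr W" using v[of u p] by (auto simp: edges_def D_def)
    qed
  qed (use finite_edges Pr W F'0 in \<open>auto simp: edges_def\<close>)
  also have "\<dots> \<le> log 2 n * (\<Sum>x\<in>W. F' x)"
    by (rule sum_edges_le) (use Pr W n F'0 in auto)
  finally show ?thesis .
qed

end

subsection \<open>A lower bound for the number of primes\<close>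

lemma prime_power_dvd_Lcm:
  fixes p N :: nat
  assumes "prime p" "p ^ e dvd Lcm {1..N}" "N \<ge> 1"
  shows "\<exists>k\<in>{1..N}. p ^ e dvd k"
  using assms(3,2)
proof (induction N rule: nat_induct_at_least)
  case (Suc N)
  have "{1..Suc N} = insert (Suc N) {1..N}" by auto
  hence L: "Lcm {1..Suc N} = lcm (Suc N) (Lcm {1..N})" by simp
  have nz: "Suc N \<noteq> 0" "Lcm {1..N} \<noteq> 0" by (auto simp: Lcm_0_iff)
  have e: "e \<le> multiplicity p (lcm (Suc N) (Lcm {1..N}))"
    using Suc.prems assms(1) nz unfolding L by (intro multiplicity_geI) (auto simp: lcm_eq_0_iff)
  also have "\<dots> = max (multiplicity p (Suc N)) (multiplicity p (Lcm {1..N}))"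
    using nz by (rule multiplicity_lcm) (use assms in auto)
  finally consider "e \<le> multiplicity p (Suc N)" | "e \<le> multiplicity p (Lcm {1..N})" by linarith
  thus ?case
  proof cases
    case 1
    hence "p ^ e dvd Suc N" by (rule multiplicity_dvd')
    thus ?thesis by (intro bexI[of _ "Suc N"]) auto
  next
    case 2
    hence "p ^ e dvd Lcm {1..N}" by (rule multiplicity_dvd')
    from Suc.IH[OF this] show ?thesis by force
  qed
qed auto

text \<open>A prime power dividing the least common multiple divides one of the numbers up to
  \<open>N\<close>, hence is at most \<open>N\<close>; there is at most one such factor for each
  prime up to \<open>N\<close>.\<close>

lemma Lcm_le_power_prime_count:
  assumes "N \<ge> (1::nat)"
  shows "Lcm {1..N} \<le> N ^ card {p. prime p \<and> p \<le> N}"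
proof -
  let ?L = "Lcm {1..N}"
  have nz: "?L \<noteq> 0" by (auto simp: Lcm_0_iff)
  have le: "p ^ multiplicity p ?L \<le> N \<and> p \<le> N" if "p \<in> prime_factors ?L" for p
  proof -
    have p: "prime p" "p dvd ?L" using that by auto
    obtain k where k: "k \<in> {1..N}" "p ^ multiplicity p ?L dvd k"
      using prime_power_dvd_Lcm[OF p(1) multiplicity_dvd assms] by blast
    have "p ^ 1 dvd ?L" using p by simp
    then obtain j where j: "j \<in> {1..N}" "p ^ 1 dvd j"
      using prime_power_dvd_Lcm[OF p(1) _ assms, of 1] by blast
    have "p ^ multiplicity p ?L \<le> k" using k by (intro dvd_imp_le) auto
    moreover have "p ^ 1 \<le> j" using j by (intro dvd_imp_le) auto
    ultimately show ?thesis using j k by simp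
  qed
  have "?L = (\<Prod>p\<in>prime_factors ?L. p ^ multiplicity p ?L)"
    using prod_prime_factors[OF nz] by (simp only: normalize_nat_def id_apply)
  also have "\<dots> \<le> (\<Prod>p\<in>prime_factors ?L. N)"
    by (rule prod_mono) (use le in blast)
  also have "\<dots> = N ^ card (prime_factors ?L)" by simp
  also have "\<dots> \<le> N ^ card {p. prime p \<and> p \<le> N}"
  proof (intro power_increasing card_mono)
    show "finite {p. prime p \<and> p \<le> N}" by (rule finite_subset[of _ "{..N}"]) auto
    show "prime_factors ?L \<subseteq> {p. prime p \<and> p \<le> N}" using le by blast
  qed (rule assms)
  finally show ?thesis .
qed

text \<open>The integral \<open>I\<close> of \<open>(x(1-x))\<^sup>m\<close> over \<open>[0,1]\<close> satisfies \<open>0 < I \<le> 4\<^sup>-\<^sup>m\<close> and becomes an integer after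
  multiplication by the least common multiple.\<close>

lemma four_power_le_Lcm: "4 ^ m \<le> Lcm {1..2 * m + 1 :: nat}"
proof -
  let ?L = "Lcm {1..2 * m + 1 :: nat}"
  define q :: "int poly" where "q = [:0, 1, -1:] ^ m"
  have dq: "degree q \<le> 2 * m"
  proof -
    have "degree q \<le> degree [:0, 1, -1 :: int:] * m"
      unfolding q_def by (rule degree_power_le)
    thus ?thesis by simp
  qed
  define I where "I = (\<Sum>j\<le>2 * m. real_of_int (coeff q j) / (j + 1))"
  define F where "F = (\<lambda>x::real. \<Sum>j\<le>2 * m. real_of_int (coeff q j) / (j + 1) * x ^ (j + 1))"
  have qr: "(\<Sum>j\<le>2 * m. real_of_int (coeff q j) * x ^ j) = (x * (1 - x)) ^ m" for x :: real
  proof -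
    have "(\<Sum>j\<le>2 * m. real_of_int (coeff q j) * x ^ j) = poly (of_int_poly q) x"
      unfolding poly_altdef using dq
      by (intro sum.mono_neutral_cong_right) (auto simp: coeff_eq_0)
    also have "of_int_poly q = [:0, 1, -1 :: real:] ^ m"
      unfolding q_def by (simp add: of_int_poly_hom.hom_power)
    finally show ?thesis by (simp add: poly_power algebra_simps)
  qed
  have dF: "(F has_real_derivative ((x * (1 - x)) ^ m)) (at x)" for x
    unfolding F_def qr[symmetric]
  proof (rule DERIV_sum)
    fix j assume "j \<in> {..2 * m}"
    have "((\<lambda>x. real_of_int (coeff q j) / (j + 1) * x ^ (j + 1)) has_real_derivative
       (real_of_int (coeff q j) / (j + 1) * (real (j + 1) * x ^ (j + 1 - Suc 0)))) (at x)"
      by (rule DERIV_cmult[OF DERIV_pow])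
    thus "((\<lambda>x. real_of_int (coeff q j) / (j + 1) * x ^ (j + 1)) has_real_derivative real_of_int (coeff q j) * x ^ j) (at x)"
      by simp
  qed
  have "\<exists>z>0. z < 1 \<and> F 1 - F 0 = (1 - 0) * (z * (1 - z)) ^ m"
    using MVT2[of 0 1 F "\<lambda>x. (x * (1 - x)) ^ m"] dF by auto
  then obtain z where z: "z > 0" "z < 1" "F 1 - F 0 = (z * (1 - z)) ^ m" by auto
  have I: "I = F 1 - F 0" by (simp add: I_def F_def)
  have "z * (1 - z) \<le> 1 / 4" using zero_le_power2[of "z - 1/2"] by (simp add: power2_eq_square algebra_simps)
  hence I1: "I \<le> (1 / 4) ^ m" unfolding I z using z by (intro power_mono) auto
  have I0: "I > 0" unfolding I z using z by simp
  have "real ?L * I = (\<Sum>j\<le>2 * m. real_of_int (coeff q j * int (?L div (j + 1))))"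
    unfolding I_def sum_distrib_left
  proof (intro sum.cong refl)
    fix j assume "j \<in> {..2 * m}"
    hence "j + 1 dvd ?L" by (intro dvd_Lcm) auto
    hence "real ?L = real (j + 1) * real (?L div (j + 1))" by (metis dvd_mult_div_cancel of_nat_mult)
    thus "real ?L * (real_of_int (coeff q j) / (j + 1)) = real_of_int (coeff q j * int (?L div (j + 1)))"
      by simp
  qed
  also have "\<dots> = real_of_int (\<Sum>j\<le>2 * m. coeff q j * int (?L div (j + 1)))" by simp
  finally obtain k where k: "real ?L * I = real_of_int k" by blast
  have "?L \<noteq> 0" by (auto simp: Lcm_0_iff)
  hence "real ?L > 0" by (simp only: of_nat_0_less_iff neq0_conv)
  hence "real ?L * I > 0" using I0 by (rule mult_pos_pos)
  hence "real ?L * I \<ge> 1" unfolding k by simp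
  also have "real ?L * I \<le> real ?L * (1 / 4) ^ m" by (intro mult_left_mono I1) auto
  finally have "4 ^ m \<le> real ?L" by (simp add: field_simps power_one_over)
  thus ?thesis by (metis of_nat_le_iff of_nat_numeral of_nat_power)
qed

lemma prime_count_lower:
  assumes "N \<ge> (2::nat)"
  shows "(real N - 2) * ln 2 \<le> card {p. prime p \<and> p \<le> N} * ln N"
proof -
  \<comment> \<open>The largest \<open>m\<close> with \<open>2 * m + 1 \<le> N\<close>, as
    \<open>four_power_le_Lcm\<close> treats odd bounds.\<close>
  define m where "m = (N - 1) div 2"
  have m: "2 * m + 1 \<le> N" "real N - 2 \<le> 2 * m" using assms by (auto simp: m_def)
  let ?c = "card {p. prime p \<and> p \<le> 2 * m + 1}"
  have "4 ^ m \<le> (2 * m + 1) ^ ?c"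
    using four_power_le_Lcm[of m] Lcm_le_power_prime_count[of "2 * m + 1"] by linarith
  also have "\<dots> \<le> N ^ ?c" using m by (intro power_mono) auto
  also have "\<dots> \<le> N ^ card {p. prime p \<and> p \<le> N}"
  proof (intro power_increasing card_mono)
    show "finite {p. prime p \<and> p \<le> N}" by (rule finite_subset[of _ "{..N}"]) auto
  qed (use m assms in auto)
  finally have "real (4 ^ m) \<le> real (N ^ card {p. prime p \<and> p \<le> N})" by (simp only: of_nat_le_iff)
  hence "ln (real (4 ^ m)) \<le> ln (real (N ^ card {p. prime p \<and> p \<le> N}))" by (intro ln_mono) auto
  hence "m * ln 4 \<le> card {p. prime p \<and> p \<le> N} * ln N" using assms by (simp add: ln_realpow)
  moreover have "ln (4::real) = 2 * ln 2" using ln_realpow[of 2 2] by simp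
  moreover have "(real N - 2) * ln 2 \<le> (2 * m) * ln 2" using m by (intro mult_right_mono) auto
  moreover have "m * ln 4 = (2 * m) * ln (2::real)" using calculation(2) by simp
  ultimately show ?thesis by linarith
qed

subsection \<open>Rational polynomials: heights and dilations\<close>

hide_const (open) Henstock_Kurzweil_Integration.content

abbreviation crp :: "rat poly \<Rightarrow> complex poly" where
  "crp \<equiv> map_poly of_rat"

lemma crp_mult: "crp (f * g) = crp f * crp g"
  by (rule poly_eqI) (simp add: coeff_map_poly coeff_mult of_rat_sum of_rat_mult)

lemma crp_smult: "crp (smult c f) = smult (of_rat c) (crp f)"
  by (rule poly_eqI) (simp add: coeff_map_poly of_rat_mult)

lemma crp_rat_poly [simp]: "crp (rat_poly f) = of_int_poly f"
  by (rule poly_eqI) (simp add: coeff_map_poly)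

lemma crp_eq_0_iff [simp]: "crp f = 0 \<longleftrightarrow> f = 0"
  by (simp add: map_poly_eq_0_iff)

lemma degree_crp [simp]: "degree (crp f) = degree f"
  by (rule degree_map_poly) auto

text \<open>Demanding a positive scalar fixes the sign, so that the primitive multiple is
  unique.\<close>

definition prim :: "rat poly \<Rightarrow> int poly" where
  "prim f = (SOME Q. content Q = 1 \<and> (\<exists>c>0. f = smult c (rat_poly Q)))"

lemma prim:
  assumes "f \<noteq> 0"
  shows "content (prim f) = 1" "\<exists>c>0. f = smult c (rat_poly (prim f))"
proof -
  obtain c Q where "c > 0" "content Q = 1" "smult (inverse c) f = rat_poly Q"
    using content_exists[OF assms] by blast
  hence "f = smult c (rat_poly Q)"
    by (metis less_irrefl right_inverse smult_1_left smult_smult)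
  hence "\<exists>Q. content Q = 1 \<and> (\<exists>c>0. f = smult c (rat_poly Q))"
    using \<open>c > 0\<close> \<open>content Q = 1\<close> by blast
  from someI_ex[OF this] show "content (prim f) = 1" "\<exists>c>0. f = smult c (rat_poly (prim f))"
    unfolding prim_def by blast+
qed

lemma rat_poly_inject: "rat_poly f = rat_poly g \<Longrightarrow> f = g"
  by (rule of_int_poly_hom.injectivity)

lemma prim_unique:
  assumes "content Q = 1" "c > 0" "f = smult c (rat_poly Q)"
  shows "prim f = Q"
proof -
  have Q0: "Q \<noteq> 0" using assms by auto
  hence f: "f \<noteq> 0" using assms by (simp add: map_poly_eq_0_iff)
  obtain d where d: "d > 0" "f = smult d (rat_poly (prim f))" using prim(2)[OF f] by blast
  have "smult (inverse c) f = rat_poly Q" using assms by simp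
  moreover have "smult (inverse d) f = rat_poly (prim f)" using d by (metis inverse_1 left_inverse less_irrefl smult_1_left smult_smult)
  ultimately have "c = d" using content_unique[OF assms(2) d(1) assms(1) prim(1)[OF f]] by blast
  hence "rat_poly Q = rat_poly (prim f)"
    using \<open>smult (inverse c) f = rat_poly Q\<close> \<open>smult (inverse d) f = rat_poly (prim f)\<close> by simp
  thus ?thesis using rat_poly_inject by metis
qed

lemma prim_nonzero:
  assumes "f \<noteq> 0"
  shows "prim f \<noteq> 0"
proof
  assume "prim f = 0"
  with prim(1)[OF assms] show False by simp
qed

lemma crp_prim:
  assumes f: "f \<noteq> 0"
  shows "\<exists>c\<noteq>0. crp f = smult c (of_int_poly (prim f))"
proof -
  obtain c where c: "c > 0" "f = smult c (rat_poly (prim f))" using prim(2)[OF f] by blast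
  have "crp f = smult (of_rat c) (of_int_poly (prim f))"
    by (subst c(2)) (simp add: crp_smult)
  moreover have "of_rat c \<noteq> (0::complex)" using c(1) by simp
  ultimately show ?thesis by blast
qed

lemma degree_prim:
  assumes f: "f \<noteq> 0"
  shows "degree (prim f) = degree f"
proof -
  obtain c where c: "c \<noteq> 0" "crp f = smult c (of_int_poly (prim f))" using crp_prim[OF f] by blast
  have "degree f = degree (crp f)" by simp
  also have "\<dots> = degree (prim f)" unfolding c(2) using c(1) by simp
  finally show ?thesis ..
qed

lemma prox_prim:
  assumes f: "f \<noteq> 0"
  shows "prox l (of_int_poly (prim f)) x = prox l (crp f) x"
proof -
  obtain c where c: "c \<noteq> 0" "crp f = smult c (of_int_poly (prim f))" using crp_prim[OF f] by blast
  show ?thesis unfolding c(2) using c(1) by (simp add: prox_smult)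
qed

text \<open>A logarithmic height. On the primitive integer multiple it does not depend on scaling,
  and Gauss's lemma makes it exactly additive under products, which \<open>poly_height\<close> is
  not.\<close>

definition height :: "rat poly \<Rightarrow> real" where
  "height f = lmeas (of_int_poly (prim f))"

lemma height_nonneg: "f \<noteq> 0 \<Longrightarrow> height f \<ge> 0"
  by (simp add: height_def lmeas_int_nonneg prim_nonzero)

lemma height_mult:
  assumes "f \<noteq> 0" "g \<noteq> 0"
  shows "height (f * g) = height f + height g"
proof -
  obtain c where c: "c > 0" "f = smult c (rat_poly (prim f))" using prim(2)[OF assms(1)] by blast
  obtain d where d: "d > 0" "g = smult d (rat_poly (prim g))" using prim(2)[OF assms(2)] by blast
  have "f * g = smult c (rat_poly (prim f)) * smult d (rat_poly (prim g))"
    by (rule arg_cong2[of _ _ _ _ times, OF c(2) d(2)])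
  also have "\<dots> = smult (c * d) (rat_poly (prim f * prim g))"
    by (simp add: of_int_poly_hom.hom_mult mult.commute)
  finally have "f * g = smult (c * d) (rat_poly (prim f * prim g))" .
  moreover have "content (prim f * prim g) = 1" using prim(1)[OF assms(1)] prim(1)[OF assms(2)] by (simp add: content_mult)
  moreover have "c * d > 0" using c(1) d(1) by (rule mult_pos_pos)
  ultimately have "prim (f * g) = prim f * prim g" by (intro prim_unique)
  hence eq: "of_int_poly (prim (f * g)) = of_int_poly (prim f) * (of_int_poly (prim g) :: complex poly)"
    by (simp only: of_int_poly_hom.hom_mult)
  have nz: "of_int_poly (prim f) \<noteq> (0 :: complex poly)" "of_int_poly (prim g) \<noteq> (0 :: complex poly)"
    using assms by (simp_all add: prim_nonzero)
  show ?thesis unfolding height_def eq by (rule lmeas_mult[OF nz])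
qed

lemma height_rat_poly_le:
  assumes "f \<noteq> 0"
  shows "height (rat_poly f) \<le> lmeas (of_int_poly f)"
proof -
  have c0: "content f > 0" using assms
    by (metis normalize_content normalize_int_def content_eq_zero_iff zero_less_abs_iff)
  have cf: "coeff f i = content f * coeff (primitive_part f) i" for i
    by (metis coeff_smult content_times_primitive_part)
  have "rat_poly f = smult (of_int (content f)) (rat_poly (primitive_part f))"
    by (rule poly_eqI) (simp add: coeff_map_poly cf[of _])
  hence p: "prim (rat_poly f) = primitive_part f"
    using c0 assms by (intro prim_unique) auto
  have "of_int_poly f = of_int_poly [:content f:] * (of_int_poly (primitive_part f) :: complex poly)"
    by (simp only: of_int_poly_hom.hom_mult[symmetric] mult_pCons_left content_times_primitive_part) simp
  hence "lmeas (of_int_poly f) = lmeas (of_int_poly [:content f:]) + lmeas (of_int_poly (primitive_part f))"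
    using c0 assms by (simp only:) (rule lmeas_mult, auto)
  moreover have "lmeas (of_int_poly [:content f:]) \<ge> 0" by (rule lmeas_int_nonneg) (use assms in simp)
  ultimately show ?thesis by (simp only: height_def p)
qed

lemma height_const: "c \<noteq> 0 \<Longrightarrow> height [:c:] = 0"
proof -
  assume c: "c \<noteq> 0"
  have "[:c:] = smult \<bar>c\<bar> (rat_poly [:if c > 0 then 1 else -1:])" by simp
  hence "prim [:c:] = [:if c > 0 then 1 else -1:]" using c by (intro prim_unique) auto
  thus ?thesis by (simp add: height_def lmeas_def)
qed

text \<open>Degree, height and proximity all turn products into sums and vanish on constants; this
  is the common source of their expansions over irreducible factors.\<close>

lemma additive_prime_factorization:
  fixes \<phi> :: "rat poly \<Rightarrow> real"
  assumes add: "\<And>f g. f \<noteq> 0 \<Longrightarrow> g \<noteq> 0 \<Longrightarrow> \<phi> (f * g) = \<phi> f + \<phi> g"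
    and const: "\<And>c. c \<noteq> 0 \<Longrightarrow> \<phi> [:c:] = 0" and f: "f \<noteq> 0"
  shows "\<phi> f = (\<Sum>g\<in>#prime_factorization f. \<phi> g)"
proof -
  have one: "\<phi> 1 = 0" using const[of 1] by simp
  have *: "\<phi> (prod_mset M) = (\<Sum>g\<in>#M. \<phi> g)" if "0 \<notin># M" for M
    using that
  proof (induction M)
    case (add x M)
    hence "prod_mset M \<noteq> 0" "x \<noteq> 0" by (auto simp: prod_mset_zero_iff)
    with add assms(1)[of x "prod_mset M"] show ?case by simp
  qed (simp add: one)
  have "\<phi> f = \<phi> (unit_factor f * normalize f)" by simp
  also have "\<dots> = \<phi> (unit_factor f) + \<phi> (normalize f)" using f by (intro add) auto
  also have "\<phi> (unit_factor f) = 0"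
    using f by (simp add: unit_factor_poly_def unit_factor_rat_def const)
  also have "normalize f = prod_mset (prime_factorization f)"
    using f by (simp add: prod_mset_prime_factorization)
  also have "\<phi> \<dots> = (\<Sum>g\<in>#prime_factorization f. \<phi> g)"
    by (rule *) auto
  finally show ?thesis by simp
qed

lemma sum_mset_count:
  fixes f :: "'a \<Rightarrow> real"
  assumes "finite W" "set_mset M \<subseteq> W"
  shows "(\<Sum>x\<in>#M. f x) = (\<Sum>x\<in>W. count M x * f x)"
  using assms(2)
proof (induction M)
  case (add a M)
  have "(\<Sum>x\<in>W. count (add_mset a M) x * f x) = (\<Sum>x\<in>W. count M x * f x + (if x = a then f x else 0))"
    by (intro sum.cong) (auto simp: algebra_simps)
  also have "\<dots> = (\<Sum>x\<in>W. count M x * f x) + f a"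
    using assms(1) add.prems by (simp add: sum.distrib)
  finally show ?case using add by simp
qed auto

lemma height_prime_factorization:
  "f \<noteq> 0 \<Longrightarrow> height f = (\<Sum>g\<in>#prime_factorization f. height g)"
  by (rule additive_prime_factorization) (auto simp: height_mult height_const)

lemma degree_prime_factorization:
  "f \<noteq> 0 \<Longrightarrow> real (degree f) = (\<Sum>g\<in>#prime_factorization f. real (degree g))" for f :: "rat poly"
  by (rule additive_prime_factorization) (auto simp: degree_mult_eq)

lemma prox_prime_factorization:
  "f \<noteq> 0 \<Longrightarrow> prox l (crp f) x = (\<Sum>g\<in>#prime_factorization f. prox l (crp g) x)"
proof (rule additive_prime_factorization)
  have "crp [:c:] = [:of_rat c:]" for c
    by (rule poly_eqI) (simp add: coeff_map_poly coeff_pCons split: nat.split)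
  thus "prox l (crp [:c:]) x = 0" if "c \<noteq> 0" for c by (simp add: prox_def)
qed (auto simp: crp_mult prox_mult)

text \<open>\<open>prime\<close> includes normalisation, which over a field means monic; so
  different primes are never associated.\<close>

lemma prime_poly_monic:
  fixes u :: "rat poly"
  assumes "prime u"
  shows "lead_coeff u = 1" "degree u > 0" "u \<noteq> 0"
proof -
  have u2: "normalize u = u" using assms unfolding prime_def by blast
  have pe: "prime_elem u" using assms unfolding prime_def by blast
  have u: "u \<noteq> 0" "u \<noteq> 0" "\<not> is_unit u" using pe unfolding prime_elem_def by blast+
  show "u \<noteq> 0" by (rule u)
  have "unit_factor u * u = 1 * u" using unit_factor_mult_normalize[of u] unfolding u2 by simp
  hence "unit_factor u = 1" using u(1) by (simp only: mult_cancel_right) blast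
  hence "[:lead_coeff u:] = 1" by (simp only: unit_factor_poly_def unit_factor_rat_def unit_factor_field_def)
  thus "lead_coeff u = 1" by (simp only: one_pCons pCons_eq_iff)
  show "degree u > 0" using u(3) is_unit_iff_degree[OF u(1)] by (simp only: neq0_conv[symmetric]) blast
qed

text \<open>A Bezout identity over the rationals survives evaluation at \<open>z\<close>.\<close>

lemma prime_dvd_common_root:
  fixes u v :: "rat poly" and z :: complex
  assumes "prime u" "\<not> u dvd v" "v \<noteq> 0"
  shows "\<not> (poly (crp u) z = 0 \<and> poly (crp v) z = 0)"
proof
  assume z: "poly (crp u) z = 0 \<and> poly (crp v) z = 0"
  have "coprime u v" by (rule prime_imp_coprime[OF assms(1,2)])
  hence g: "gcd u v = 1" by (rule coprime_imp_gcd_eq_1)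
  obtain a b where "a * u + b * v = 1"
    using bezout_coefficients_fst_snd[of u v] unfolding g by blast
  hence "poly (crp (a * u + b * v)) z = poly (crp 1) z" by simp
  moreover have "crp (a * u + b * v) = crp a * crp u + crp b * crp v"
    by (simp add: crp_mult[symmetric]) (rule poly_eqI, simp add: coeff_map_poly of_rat_add)
  ultimately show False using z by simp
qed

section \<open>Dilations of polynomials and their effect on proximity and height\<close>

definition dil :: "'a::field_char_0 \<Rightarrow> 'a poly \<Rightarrow> 'a poly" where
  "dil r f = pcompose f [:0, r:]"

lemma coeff_dil: "coeff (dil r f) i = r ^ i * coeff f i"
  by (simp add: dil_def coeff_pcompose_linear)

lemma degree_dil: "r \<noteq> 0 \<Longrightarrow> degree (dil r f) = degree f"
  by (simp add: dil_def)

lemma dil_mult: "dil r (f * g) = dil r f * dil r g"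
  by (simp add: dil_def pcompose_mult)

lemma dil_power: "dil r (f ^ k) = dil r f ^ k"
  by (induction k) (simp_all add: dil_mult, simp add: dil_def)

lemma dil_dil: "dil r (dil s f) = dil (r * s) f"
  by (rule poly_eqI) (simp add: coeff_dil power_mult_distrib)

lemma dil_1 [simp]: "dil 1 f = f"
  by (rule poly_eqI) (simp add: coeff_dil)

lemma dil_0 [simp]: "dil r 0 = 0"
  by (simp add: dil_def)

lemma dil_eq_0_iff:
  assumes r: "r \<noteq> 0"
  shows "dil r f = 0 \<longleftrightarrow> f = 0"
proof
  assume "dil r f = 0"
  hence "dil (inverse r) (dil r f) = 0" by simp
  thus "f = 0" using r by (simp add: dil_dil)
qed simp

lemma dil_dvd: "f dvd g \<Longrightarrow> dil r f dvd dil r g"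
  by (auto simp: dvd_def dil_mult)

lemma crp_dil: "crp (dil r f) = dil (of_rat r) (crp f)"
  by (rule poly_eqI) (simp add: coeff_dil coeff_map_poly of_rat_mult of_rat_power)

lemma dil_smult: "dil r (smult c f) = smult c (dil r f)"
  by (simp add: dil_def pcompose_smult)

lemma proots_dil:
  fixes F :: "complex poly"
  assumes "r \<noteq> 0"
  shows "proots (dil r F) = image_mset (\<lambda>z. z / r) (proots F)"
proof (cases "F = 0")
  case False
  have *: "dil r (\<Prod>x\<in>#A. [:-x, 1:]) = (\<Prod>x\<in>#A. [:-x, r:])" for A
  proof (induction A)
    case (add x A)
    have "dil r [:-x, 1:] = [:-x, r:]" by (simp add: dil_def)
    thus ?case by (simp only: image_mset_add_mset prod_mset.add_mset dil_mult add.IH)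
  qed (simp add: dil_def)
  have **: "proots (\<Prod>x\<in>#A. [:-x, r:]) = image_mset (\<lambda>z. z / r) A" for A :: "complex multiset"
  proof (induction A)
    case (add a A)
    have "(\<Prod>x\<in>#A. [:-x, r:]) \<noteq> 0" using assms by (auto simp: prod_mset_zero_iff)
    hence "proots (\<Prod>x\<in>#add_mset a A. [:-x, r:]) = proots [:-a, r:] + proots (\<Prod>x\<in>#A. [:-x, r:])"
      using assms by (simp add: proots_mult del: mult_pCons_left)
    also have "[:-a, r:] = smult r [:-(a / r), 1:]" using assms by simp
    also have "proots \<dots> = {#a / r#}" using proots_smult[OF assms, of "[:-(a / r), 1:]"]
      by (simp only: proots_linear_factor minus_minus)
    finally show ?case using add by simp
  qed auto
  have "dil r F = dil r (smult (lead_coeff F) (\<Prod>x\<in>#proots F. [:-x, 1:]))"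
    by (simp only: complex_poly_decompose_multiset)
  also have "\<dots> = smult (lead_coeff F) (\<Prod>x\<in>#proots F. [:-x, r:])"
    by (simp only: dil_smult *)
  finally show ?thesis using False by (simp add: **)
qed auto

text \<open>Dilation divides the roots by \<open>a \<ge> 1\<close>, and with them the distances, so
  proximity can only grow.\<close>

lemma prox_dil:
  assumes "l \<ge> 0" "a \<ge> (1::nat)"
  shows "prox l (dil (of_nat a) F) x \<ge> prox l F (of_nat a * x)"
proof -
  have "kap l z (of_nat a * x) \<le> kap l (z / of_nat a) x" for z
  proof (cases "x = z / of_nat a")
    case False
    have a0: "of_nat a \<noteq> (0::complex)" using assms by simp
    hence ne: "of_nat a * x \<noteq> z" using False by (auto simp: field_simps)
    have "of_nat a * x - z = of_nat a * (x - z / of_nat a)" using a0 by (simp add: field_simps)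
    hence "cmod (of_nat a * x - z) = a * cmod (x - z / of_nat a)" by (simp add: norm_mult)
    moreover have "1 * cmod (x - z / of_nat a) \<le> a * cmod (x - z / of_nat a)"
      using assms by (intro mult_right_mono) auto
    ultimately have "cmod (x - z / of_nat a) \<le> cmod (of_nat a * x - z)" by simp
    hence "ln (cmod (x - z / of_nat a)) \<le> ln (cmod (of_nat a * x - z))"
      using False by (intro ln_mono) auto
    thus ?thesis using False ne by (simp only: kap_def if_False)
  qed (use kap_le[of l z] in \<open>auto simp: kap_def\<close>)
  thus ?thesis using assms unfolding prox_def
    by (subst proots_dil) (auto simp: image_mset.compositionality o_def intro!: sum_mset_mono)
qed

text \<open>The roots shrink; only the leading coefficient grows, by the factor
  \<open>a ^ degree F\<close>.\<close>

lemma lmeas_dil: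
  assumes "a \<ge> (1::nat)" "F \<noteq> 0"
  shows "lmeas (dil (of_nat a) F) \<le> lmeas F + degree F * ln a"
proof -
  have a0: "of_nat a \<noteq> (0::complex)" using assms by simp
  have lc: "cmod (lead_coeff F) > 0" using assms by simp
  have "lead_coeff (dil (of_nat a) F) = of_nat a ^ degree F * lead_coeff F"
    by (simp add: coeff_dil degree_dil[OF a0])
  hence "ln (cmod (lead_coeff (dil (of_nat a) F))) = degree F * ln a + ln (cmod (lead_coeff F))"
    using lc assms by (simp add: norm_mult norm_power ln_mult_pos ln_realpow)
  moreover have "(\<Sum>z\<in>#proots (dil (of_nat a) F). ln (max 1 (cmod z))) \<le> (\<Sum>z\<in>#proots F. ln (max 1 (cmod z)))"
    unfolding proots_dil[OF a0] image_mset.compositionality o_def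
  proof (rule sum_mset_mono)
    fix z
    have "cmod z * 1 \<le> cmod z * a" using assms by (intro mult_left_mono) auto
    hence "cmod (z / of_nat a) \<le> cmod z" using assms by (simp add: norm_divide field_simps)
    thus "ln (max 1 (cmod (z / of_nat a))) \<le> ln (max 1 (cmod z))" by (intro ln_mono) auto
  qed
  ultimately show ?thesis by (simp add: lmeas_def)
qed

lemma height_dil:
  assumes a: "a \<ge> (1::nat)" and f: "f \<noteq> 0"
  shows "height (dil (of_nat a) f) \<le> height f + degree f * ln a"
proof -
  obtain c where c: "c > 0" "f = smult c (rat_poly (prim f))" using prim(2)[OF f] by blast
  define g where "g = pcompose (prim f) [:0, int a:]"
  have g: "rat_poly g = dil (of_nat a) (rat_poly (prim f))" "of_int_poly g = dil (of_nat a) (of_int_poly (prim f) :: complex poly)"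
    by (rule poly_eqI, simp add: g_def coeff_map_poly coeff_pcompose_linear coeff_dil)+
  have g0: "g \<noteq> 0"
  proof
    assume "g = 0"
    hence "dil (of_nat a) (rat_poly (prim f)) = 0" using g(1) by simp
    hence "rat_poly (prim f) = 0" using a by (subst (asm) dil_eq_0_iff) auto
    thus False using prim_nonzero[OF f] by simp
  qed
  have "dil (of_nat a) f = dil (of_nat a) (smult c (rat_poly (prim f)))"
    by (simp only: c(2)[symmetric])
  hence "dil (of_nat a) f = [:c:] * rat_poly g" by (simp add: dil_smult g)
  hence "height (dil (of_nat a) f) = height [:c:] + height (rat_poly g)"
    using c(1) g0 by (simp only:) (rule height_mult, auto)
  also have "\<dots> \<le> lmeas (of_int_poly g)" using height_rat_poly_le[OF g0] height_const[of c] c(1) by simp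
  also have "\<dots> \<le> lmeas (of_int_poly (prim f)) + degree (of_int_poly (prim f) :: complex poly) * ln a"
    unfolding g using a prim_nonzero[OF f] by (intro lmeas_dil) auto
  finally show ?thesis using f by (simp add: height_def degree_prim)
qed

text \<open>Normalised so that monic polynomials stay monic and dilates of normalised primes can be
  compared by equality.\<close>

definition mdil :: "nat \<Rightarrow> rat poly \<Rightarrow> rat poly" where
  "mdil a f = smult (inverse (of_nat a ^ degree f)) (dil (of_nat a) f)"

lemma coeff_mdil: "coeff (mdil a f) i = of_nat a ^ i * coeff f i / of_nat a ^ degree f"
  by (simp add: mdil_def coeff_dil field_simps)

lemma degree_mdil: "a > 0 \<Longrightarrow> degree (mdil a f) = degree f"
  by (simp add: mdil_def degree_dil)

text \<open>Freeness is read off the constant term, which dilation by \<open>s\<close> divides by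
  \<open>s ^ degree\<close>. The polynomial \<open>T\<close> has to be excluded, being fixed by
  every normalised dilation.\<close>

interpretation mdil: free_dilation mdil "{f. lead_coeff f = 1 \<and> degree f > 0 \<and> coeff f 0 \<noteq> 0}"
proof
  fix x :: "rat poly" and s t :: nat
  assume x: "x \<in> {f. lead_coeff f = 1 \<and> degree f > 0 \<and> coeff f 0 \<noteq> 0}" and s: "s > 0"
  show "mdil s x \<in> {f. lead_coeff f = 1 \<and> degree f > 0 \<and> coeff f 0 \<noteq> 0}"
    using x s by (simp add: degree_mdil coeff_mdil)
  assume t: "t > 0"
  show "mdil s (mdil t x) = mdil (s * t) x"
    by (rule poly_eqI) (simp add: coeff_mdil degree_mdil t power_mult_distrib mult_ac)
  assume "mdil s x = mdil t x"
  hence "coeff (mdil s x) 0 = coeff (mdil t x) 0" by simp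
  hence "rat_of_nat s ^ degree x = of_nat t ^ degree x" using x s t by (simp add: coeff_mdil field_simps)
  hence "s ^ degree x = t ^ degree x" by (metis of_nat_eq_iff of_nat_power)
  thus "s = t" using x by (simp add: power_eq_iff_eq_base)
next
  fix x y :: "rat poly" and s :: nat
  assume s: "s > 0" and eq: "mdil s x = mdil s y"
  have d: "degree x = degree y" using degree_mdil[OF s] eq by metis
  show "x = y"
  proof (rule poly_eqI)
    fix i
    have "coeff (mdil s x) i = coeff (mdil s y) i" by (simp add: eq)
    thus "coeff x i = coeff y i" using s d by (simp add: coeff_mdil)
  qed
qed

subsection \<open>Common divisors of dilates\<close>

lemma prox_bilinear_prime:
  fixes g v :: "rat poly"
  assumes g: "prime g" "\<not> g dvd v" and v: "v \<noteq> 0"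
    and l: "l \<ge> 0" and L: "\<And>a. (\<Sum>y\<in>Y. kap l a y) \<le> L"
  shows "(\<Sum>y\<in>Y. prox l (crp g) y * prox l (crp v) y) \<le>
     2 * L * (degree v * height g + degree g * height v + 2 * degree g * degree v * ln 2)"
proof -
  have g0: "g \<noteq> 0" using prime_poly_monic[OF g(1)] by blast
  have cop: "\<forall>z::complex. \<not> (poly (of_int_poly (prim g)) z = 0 \<and> poly (of_int_poly (prim v)) z = 0)"
  proof
    fix z :: complex
    obtain c where c: "c \<noteq> 0" "crp g = smult c (of_int_poly (prim g))" using crp_prim[OF g0] by blast
    obtain d where d: "d \<noteq> 0" "crp v = smult d (of_int_poly (prim v))" using crp_prim[OF v] by blast
    show "\<not> (poly (of_int_poly (prim g)) z = 0 \<and> poly (of_int_poly (prim v)) z = 0)"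
      using prime_dvd_common_root[OF g v, of z] unfolding c(2) d(2) by auto
  qed
  show ?thesis
    using prox_bilinear[OF prim_nonzero[OF g0] prim_nonzero[OF v] cop l L]
    unfolding prox_prim[OF g0] prox_prim[OF v] degree_prim[OF g0] degree_prim[OF v] height_def[symmetric] .
qed

text \<open>The bilinear estimate at a single point, where \<open>L = l\<close> is allowed because
  \<open>kap\<close> never exceeds \<open>l\<close>.\<close>

lemma distinct_primes_close:
  assumes "prime g" "prime g'" "g \<noteq> g'" "l \<ge> 0"
  shows "prox l (crp g) x * prox l (crp g') x \<le>
    2 * l * (degree g' * height g + degree g * height g' + 2 * degree g * degree g' * ln 2)"
proof -
  have "\<not> g dvd g'" using assms primes_dvd_imp_eq by blast
  moreover have "g' \<noteq> 0" using prime_poly_monic[OF assms(2)] by blast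
  ultimately show ?thesis using prox_bilinear_prime[OF assms(1) _ _ assms(4), of g' "{x}" l] kap_le by simp
qed

lemma sum_mset_divide: "(\<Sum>a\<in>#A. f a / c) = (\<Sum>a\<in>#A. f a) / (c :: real)"
  by (induction A) (simp_all add: add_divide_distrib)

text \<open>Otherwise additivity would bound the total proximity by \<open>N / 4 * (1 + 1)\<close>.
  Measuring degree and height against \<open>D\<close> and \<open>H\<close> yields one factor whose
  proximity is large compared with both.\<close>

lemma exists_close_prime_factor:
  fixes f :: "rat poly" and N D H :: real
  assumes f: "f \<noteq> 0" and N: "N > 0" "prox l (crp f) x \<ge> N"
    and D: "D > 0" "degree f \<le> D" and H: "H > 0" "height f \<le> H"
  shows "\<exists>g. prime g \<and> g dvd f \<and> prox l (crp g) x \<ge> N / 4 * (degree g / D + height g / H)"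
proof (rule ccontr)
  assume no: "\<not> ?thesis"
  have "prox l (crp f) x = (\<Sum>g\<in>#prime_factorization f. prox l (crp g) x)"
    by (rule prox_prime_factorization[OF f])
  also have "\<dots> \<le> (\<Sum>g\<in>#prime_factorization f. N / 4 * (degree g / D + height g / H))"
  proof (rule sum_mset_mono)
    fix g assume "g \<in># prime_factorization f"
    hence "prime g" "g dvd f" by auto
    thus "prox l (crp g) x \<le> N / 4 * (degree g / D + height g / H)" using no by force
  qed
  also have "\<dots> = N / 4 * (degree f / D + height f / H)"
    by (simp only: sum_mset_cmult sum_mset.distrib sum_mset_divide
        height_prime_factorization[OF f, symmetric] degree_prime_factorization[OF f, symmetric])
  also have "\<dots> \<le> N / 4 * (1 + 1)"
    using N D H by (intro mult_left_mono add_mono) auto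
  finally show False using N by simp
qed

lemma height_smult: "c \<noteq> 0 \<Longrightarrow> f \<noteq> 0 \<Longrightarrow> height (smult c f) = height f"
  using height_mult[of "[:c:]" f] height_const[of c] by simp

lemma height_dvd_le:
  assumes "f dvd g" "g \<noteq> 0"
  shows "height f \<le> height g"
proof -
  obtain k where k: "g = f * k" using assms by blast
  hence "f \<noteq> 0" "k \<noteq> 0" using assms by auto
  thus ?thesis using height_mult[of f k] height_nonneg[of k] k by simp
qed

lemma height_mdil:
  assumes "a \<ge> 1" "f \<noteq> 0"
  shows "height (mdil a f) \<le> height f + degree f * ln a"
proof -
  have "dil (of_nat a) f \<noteq> 0" using assms by (subst dil_eq_0_iff) auto
  hence "height (mdil a f) = height (dil (of_nat a) f)"
    unfolding mdil_def using assms by (intro height_smult) auto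
  thus ?thesis using height_dil[OF assms] by simp
qed

lemma prime_dil:
  fixes u :: "rat poly"
  assumes "prime_elem u" "r \<noteq> 0"
  shows "prime_elem (dil r u)"
proof (rule prime_elemI)
  show "dil r u \<noteq> 0" using assms by (subst dil_eq_0_iff) auto
  have u: "u \<noteq> 0" "\<not> is_unit u" using assms(1) unfolding prime_elem_def by blast+
  hence "degree u \<noteq> 0" using is_unit_iff_degree[OF u(1)] by blast
  thus "\<not> is_unit (dil r u)" using degree_dil[OF assms(2), of u] is_unit_iff_degree[OF \<open>dil r u \<noteq> 0\<close>] by simp
  fix a b assume "dil r u dvd a * b"
  hence "dil (inverse r) (dil r u) dvd dil (inverse r) (a * b)" by (rule dil_dvd)
  hence "u dvd dil (inverse r) a * dil (inverse r) b" using assms by (simp add: dil_dil dil_mult)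
  hence "u dvd dil (inverse r) a \<or> u dvd dil (inverse r) b" using assms(1) prime_elem_dvd_mult_iff by blast
  hence "dil r u dvd dil r (dil (inverse r) a) \<or> dil r u dvd dil r (dil (inverse r) b)" using dil_dvd by blast
  thus "dil r u dvd a \<or> dil r u dvd b" using assms by (simp add: dil_dil)
qed

text \<open>Undoing the dilation: \<open>v\<close> is the monic multiple of \<open>u(T/a)\<close>.
  The power \<open>k\<close> transports multiplicities from the dilate of \<open>P\<close> to
  \<open>P\<close> itself.\<close>

lemma undilate_prime:
  fixes u :: "rat poly"
  assumes u: "prime u" and a: "a > 0" and k: "u ^ k dvd dil (of_nat a) P"
  shows "\<exists>v. prime v \<and> mdil a v = u \<and> v ^ k dvd P"
proof -
  have a0: "(of_nat a :: rat) \<noteq> 0" using a by simp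
  define c :: rat where "c = of_nat a ^ degree u"
  define v where "v = smult c (dil (inverse (of_nat a)) u)"
  have c0: "c \<noteq> 0" using a by (simp add: c_def)
  have dv: "degree v = degree u" using c0 a0 by (simp add: v_def degree_dil)
  have u0: "u \<noteq> 0" "lead_coeff u = 1" using prime_poly_monic[OF u] by blast+
  have "lead_coeff v = 1" using u0 a0 unfolding dv by (simp add: v_def coeff_dil c_def power_inverse)
  hence norm: "normalize v = v"
    by (simp add: normalize_poly_def one_pCons[symmetric])
  have "prime_elem (dil (inverse (of_nat a)) u)" using u a0 by (intro prime_dil) auto
  moreover have "v = [:c:] * dil (inverse (of_nat a)) u" by (simp add: v_def)
  moreover have "is_unit [:c:]" using c0 by (simp add: is_unit_const_poly_iff dvd_field_iff)
  ultimately have "prime_elem v" using prime_elem_mult_unit_left by blast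
  hence pv: "prime v" using norm by (simp add: prime_def)
  have "mdil a v = u"
    by (rule poly_eqI) (use a0 in \<open>simp add: coeff_mdil dv, simp add: v_def coeff_dil c_def power_inverse field_simps\<close>)
  moreover have "v ^ k dvd P"
  proof -
    have "dil (inverse (of_nat a)) (u ^ k) dvd dil (inverse (of_nat a)) (dil (of_nat a) P)"
      using k by (rule dil_dvd)
    hence "dil (inverse (of_nat a)) u ^ k dvd P" using a0 by (simp add: dil_power dil_dil)
    moreover have "v ^ k = smult (c ^ k) (dil (inverse (of_nat a)) u ^ k)" by (simp add: v_def smult_power)
    ultimately show ?thesis using c0 by (simp add: smult_dvd_iff)
  qed
  ultimately show ?thesis using pv by blast
qed

text \<open>\<open>mdil.expansion\<close> on the irreducible factors of \<open>P\<close>, weighted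
  by multiplicity times \<phi>. Since \<open>Q\<close> divides each dilate, a factor
  \<open>u\<close> of \<open>Q\<close> is, for every prime \<open>p\<close>, the normalised dilate
  of a factor \<open>v\<close> of \<open>P\<close> whose multiplicity is at least that of
  \<open>u\<close> in \<open>Q\<close>.\<close>

lemma common_divisor_weight:
  fixes P Q :: "rat poly" and \<phi> \<phi>' :: "rat poly \<Rightarrow> real" and A n :: nat
  assumes P: "P \<noteq> 0" "coeff P 0 \<noteq> 0" "degree P \<le> n" and Q: "Q dvd P"
    and Qp: "\<And>p. prime p \<Longrightarrow> p \<le> A \<Longrightarrow> Q dvd dil (of_nat p) P"
    and pos: "\<And>u. prime u \<Longrightarrow> 0 \<le> \<phi> u" "\<And>u. prime u \<Longrightarrow> \<phi> u \<le> \<phi>' u"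
    and step: "\<And>v p. prime v \<Longrightarrow> prime p \<Longrightarrow> p \<le> A \<Longrightarrow> \<phi> (mdil p v) \<le> \<phi>' v"
  shows "card {p. prime p \<and> p \<le> A} * (\<Sum>g\<in>#prime_factorization Q. \<phi> g) \<le> log 2 n * (\<Sum>g\<in>#prime_factorization P. \<phi>' g)"
proof -
  let ?W = "prime_factors P" and ?Pr = "{p. prime p \<and> p \<le> A}"
  let ?q = "\<lambda>u. count (prime_factorization Q) u" and ?c = "\<lambda>u. count (prime_factorization P) u"
  have Q0: "Q \<noteq> 0" using P Q by auto
  have sub: "prime_factorization Q \<subseteq># prime_factorization P"
    using Q P Q0 by (simp add: prime_factorization_subset_iff_dvd)
  have le: "?q u \<le> ?c u" for u using sub by (rule mset_subset_eq_count)
  have W: "?W \<subseteq> {f. lead_coeff f = 1 \<and> degree f > 0 \<and> coeff f 0 \<noteq> 0}"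
  proof
    fix u assume "u \<in> ?W"
    hence u: "prime u" "u dvd P" by auto
    then obtain k where "P = u * k" by blast
    hence "coeff u 0 \<noteq> 0" using P by (auto simp: coeff_mult)
    thus "u \<in> {f. lead_coeff f = 1 \<and> degree f > 0 \<and> coeff f 0 \<noteq> 0}" using prime_poly_monic[OF u(1)] by blast
  qed
  have card: "card ?W \<le> n"
  proof -
    have "card ?W = (\<Sum>u\<in>?W. 1)" by simp
    also have "\<dots> \<le> (\<Sum>u\<in>?W. ?c u)" by (intro sum_mono) (simp add: Suc_le_eq)
    also have "\<dots> = size (prime_factorization P)" by (simp add: size_multiset_overloaded_eq)
    also have "real (size (prime_factorization P)) = (\<Sum>g\<in>#prime_factorization P. 1)" by simp
    also have "\<dots> \<le> (\<Sum>g\<in>#prime_factorization P. real (degree g))"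
    proof (rule sum_mset_mono)
      fix g assume "g \<in># prime_factorization P"
      hence "prime g" by auto
      thus "1 \<le> real (degree g)" using prime_poly_monic(2)[of g] by simp
    qed
    also have "\<dots> = degree P" by (rule degree_prime_factorization[OF P(1), symmetric])
    finally show ?thesis using P by simp
  qed
  have "card ?Pr * (\<Sum>u\<in>?W. ?q u * \<phi> u) \<le> log 2 n * (\<Sum>u\<in>?W. ?c u * \<phi>' u)"
  proof (rule mdil.expansion)
    show "finite ?Pr" by (rule finite_subset[of _ "{..A}"]) auto
    show "prime p" if "p \<in> ?Pr" for p using that by simp
    show "finite ?W" by simp
    show "?W \<subseteq> {f. lead_coeff f = 1 \<and> degree f > 0 \<and> coeff f 0 \<noteq> 0}" by (rule W)
    show "card ?W \<le> n" by (rule card)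
    show "0 \<le> ?q x * \<phi> x" if "x \<in> ?W" for x
      by (rule mult_nonneg_nonneg) (use pos(1)[OF in_prime_factors_imp_prime[OF that]] in simp_all)
    show "?q x * \<phi> x \<le> ?c x * \<phi>' x" if "x \<in> ?W" for x
      by (rule mult_mono) (use pos[OF in_prime_factors_imp_prime[OF that]] le[of x] in simp_all)
    fix u p assume u: "u \<in> ?W" and p: "p \<in> ?Pr" and gt: "?q u * \<phi> u > 0"
    have pu: "prime u" using u by auto
    have pp: "prime p" "p \<le> A" "p > 0" using p prime_gt_0_nat by auto
    have q: "?q u = multiplicity u Q" using pu by (simp add: count_prime_factorization_prime)
    have q0: "?q u > 0" using gt by (metis gr0I mult_zero_left of_nat_0 less_irrefl)
    have "u ^ ?q u dvd Q" unfolding q by (rule multiplicity_dvd)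
    also have "Q dvd dil (of_nat p) P" using pp by (intro Qp)
    finally obtain v where v: "prime v" "mdil p v = u" "v ^ ?q u dvd P"
      using undilate_prime[OF pu pp(3)] by blast
    have "?q u \<le> multiplicity v P"
      using v P prime_elem_not_unit[of v] by (intro multiplicity_geI) (auto simp: prime_def)
    hence qc: "?q u \<le> ?c v" using v by (simp add: count_prime_factorization_prime)
    have "?c v > 0" using qc q0 by linarith
    hence "v \<in> ?W" by (simp only: count_greater_zero_iff)
    moreover have "?q u * \<phi> u \<le> ?c v * \<phi>' v"
      using qc step[OF v(1) pp(1,2)] pos(1)[OF pu] v(2) by (intro mult_mono) auto
    ultimately show "\<exists>v\<in>?W. mdil p v = u \<and> ?q u * \<phi> u \<le> ?c v * \<phi>' v" using v by blast
  qed
  moreover have "(\<Sum>g\<in>#prime_factorization Q. \<phi> g) = (\<Sum>u\<in>?W. ?q u * \<phi> u)"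
    by (rule sum_mset_count) (use sub in \<open>auto dest: set_mset_mono\<close>)
  moreover have "(\<Sum>g\<in>#prime_factorization P. \<phi>' g) = (\<Sum>u\<in>?W. ?c u * \<phi>' u)"
    by (rule sum_mset_count) auto
  ultimately show ?thesis by simp
qed

lemma common_divisor_small:
  fixes P Q :: "rat poly" and A n :: nat
  assumes P: "P \<noteq> 0" "coeff P 0 \<noteq> 0" "degree P \<le> n" and Q: "Q dvd P" and A: "A \<ge> 1"
    and Qp: "\<And>p. prime p \<Longrightarrow> p \<le> A \<Longrightarrow> Q dvd dil (of_nat p) P"
  shows "card {p. prime p \<and> p \<le> A} * degree Q \<le> log 2 n * degree P"
    and "card {p. prime p \<and> p \<le> A} * height Q \<le> log 2 n * (height P + degree P * ln A)"
proof -
  have Q0: "Q \<noteq> 0" using P Q by auto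
  have "card {p. prime p \<and> p \<le> A} * (\<Sum>g\<in>#prime_factorization Q. real (degree g)) \<le> log 2 n * (\<Sum>g\<in>#prime_factorization P. real (degree g))"
  proof (rule common_divisor_weight[where \<phi> = "\<lambda>g. real (degree g)" and \<phi>' = "\<lambda>g. real (degree g)" and P = P and Q = Q and n = n and A = A])
    show "real (degree (mdil p v)) \<le> real (degree v)" if "prime p" for p v
      using degree_mdil[of p v] prime_gt_0_nat[OF that] by simp
  qed (use P Q Qp in auto)
  thus "card {p. prime p \<and> p \<le> A} * degree Q \<le> log 2 n * degree P"
    unfolding of_nat_mult degree_prime_factorization[OF P(1)] degree_prime_factorization[OF Q0] .
  have "card {p. prime p \<and> p \<le> A} * (\<Sum>g\<in>#prime_factorization Q. height g) \<le> log 2 n * (\<Sum>g\<in>#prime_factorization P. height g + ln A * degree g)"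
  \<comment> \<open>Dilation by a prime up to \<open>A\<close> raises the height by at most
    \<open>degree * ln A\<close>, whence the second weight.\<close>
  proof (rule common_divisor_weight[where \<phi> = height and \<phi>' = "\<lambda>g. height g + ln A * degree g", OF P Q Qp])
    fix u :: "rat poly" assume u: "prime u"
    have u0: "u \<noteq> 0" using prime_poly_monic[OF u] by blast
    show "0 \<le> height u" by (rule height_nonneg[OF u0])
    show "height u \<le> height u + ln A * degree u" using A by simp
    fix p assume p: "prime (p::nat)" "p \<le> A"
    have p1: "p \<ge> 1" using p prime_ge_1_nat by blast
    have "height (mdil p u) \<le> height u + degree u * ln p" by (rule height_mdil[OF p1 u0])
    also have "degree u * ln p \<le> degree u * ln A" using p p1 by (intro mult_left_mono ln_mono) auto
    finally show "height (mdil p u) \<le> height u + ln A * degree u" by (simp add: mult.commute)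
  qed
  also have "(\<Sum>g\<in>#prime_factorization P. height g + ln A * degree g) = height P + degree P * ln A"
    unfolding sum_mset.distrib sum_mset_cmult height_prime_factorization[OF P(1), symmetric]
      degree_prime_factorization[OF P(1), symmetric] by (simp add: mult.commute)
  finally show "card {p. prime p \<and> p \<le> A} * height Q \<le> log 2 n * (height P + degree P * ln A)"
    unfolding height_prime_factorization[OF Q0, symmetric] .
qed

text \<open>A common divisor of largest degree. The greatest common divisor enters only through this
  maximality: no prime can be multiplied into \<open>Q\<close> without losing one of the
  divisibilities.\<close>

lemma gcd_of_dilates:
  fixes P :: "rat poly"
  assumes P: "P \<noteq> 0" and S: "(1::nat) \<in> S"
  obtains Q where "Q \<noteq> 0" "\<And>a. a \<in> S \<Longrightarrow> Q dvd dil (of_nat a) P"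
    "\<And>g. prime g \<Longrightarrow> \<exists>a\<in>S. \<not> g * Q dvd dil (of_nat a) P"
proof -
  define X where "X = (\<lambda>Q. Q \<noteq> 0 \<and> (\<forall>a\<in>S. Q dvd dil (of_nat a) P))"
  have "X 1" by (simp add: X_def)
  moreover have "\<forall>Q. X Q \<longrightarrow> degree Q \<le> degree P"
  proof (intro allI impI)
    fix Q assume "X Q"
    hence "Q dvd dil (of_nat 1) P" using S by (auto simp: X_def)
    thus "degree Q \<le> degree P" using P by (intro dvd_imp_degree_le) auto
  qed
  ultimately obtain Q where Q: "X Q" "\<forall>R. X R \<longrightarrow> degree R \<le> degree Q"
    using ex_has_greatest_nat[of X 1 degree "Suc (degree P)"] by (auto simp: less_Suc_eq_le)
  show thesis
  proof
    show "Q \<noteq> 0" "\<And>a. a \<in> S \<Longrightarrow> Q dvd dil (of_nat a) P" using Q(1) by (auto simp: X_def)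
    fix g :: "rat poly" assume g: "prime g"
    have g0: "g \<noteq> 0" "degree g > 0" using prime_poly_monic[OF g] by blast+
    hence "degree (g * Q) > degree Q" using \<open>Q \<noteq> 0\<close> by (simp add: degree_mult_eq)
    hence "\<not> X (g * Q)" using Q(2) by force
    thus "\<exists>a\<in>S. \<not> g * Q dvd dil (of_nat a) P" using g0 \<open>Q \<noteq> 0\<close> by (auto simp: X_def)
  qed
qed

text \<open>At a bad point every quotient \<open>R a\<close> of a dilate by \<open>Q\<close> keeps
  proximity at least \<open>N / 2\<close>. A prime factor \<open>g\<close> of \<open>R 1\<close>
  fails to divide some \<open>R a\<close>, with \<open>a\<close> depending on \<open>g\<close>; the
  bilinear estimate for \<open>g\<close> and this \<open>R a\<close>, summed over all
  \<open>g\<close>, bounds \<open>(N / 2)^2\<close> times the number of bad points.\<close>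

lemma card_bad_points:
  fixes P Q :: "rat poly" and l L N :: real and A n :: nat
  assumes P: "P \<noteq> 0" "degree P \<le> n" and S: "(1::nat) \<in> S" "S \<subseteq> {1..A}"
    and Q: "Q \<noteq> 0" "\<And>a. a \<in> S \<Longrightarrow> Q dvd dil (of_nat a) P"
      "\<And>g. prime g \<Longrightarrow> \<exists>a\<in>S. \<not> g * Q dvd dil (of_nat a) P"
    and l: "l \<ge> 0" and Y: "finite Y" and L: "\<And>z. (\<Sum>y\<in>Y. kap l z y) \<le> L" and N: "N > 0"
    and small: "\<And>y a. y \<in> Y \<Longrightarrow> a \<in> S \<Longrightarrow> prox l (crp P) (of_nat a * y) \<ge> N"
  shows "card {y \<in> Y. prox l (crp Q) y < N / 2} * N ^ 2 \<le> 16 * L * (n * height P + n ^ 2 * ln A + n ^ 2)"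
proof -
  define B where "B = {y \<in> Y. prox l (crp Q) y < N / 2}"
  define R where "R = (\<lambda>a. dil (of_nat a) P div Q)"
  have QR: "dil (of_nat a) P = Q * R a" if "a \<in> S" for a using Q(2)[OF that] by (simp add: R_def)
  have a1: "a \<ge> 1" "a \<le> A" if "a \<in> S" for a using S that by auto
  have dP0: "dil (of_nat a) P \<noteq> 0" if "a \<in> S" for a using P a1[OF that] by (subst dil_eq_0_iff) auto
  have R0: "R a \<noteq> 0" if "a \<in> S" for a using dP0[OF that] QR[OF that] by auto
  have dR: "degree (R a) \<le> n" if "a \<in> S" for a
  proof -
    have "degree (dil (of_nat a) P) = degree Q + degree (R a)"
      unfolding QR[OF that] using Q(1) R0[OF that] by (simp add: degree_mult_eq)
    moreover have "degree (dil (of_nat a) P) = degree P" using a1[OF that] by (intro degree_dil) auto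
    ultimately show ?thesis using P by simp
  qed
  define h where "h = height P + n * ln A"
  have A1: "A \<ge> 1" using S by force
  have hP: "height P \<ge> 0" by (rule height_nonneg[OF P(1)])
  have hR: "height (R a) \<le> h" if "a \<in> S" for a
  proof -
    have "height (R a) \<le> height (dil (of_nat a) P)"
      using QR[OF that] dP0[OF that] by (intro height_dvd_le) auto
    also have "\<dots> \<le> height P + degree P * ln a" by (rule height_dil[OF a1(1)[OF that] P(1)])
    also have "degree P * ln a \<le> n * ln A" using P a1[OF that] by (intro mult_mono ln_mono) auto
    finally show ?thesis by (simp add: h_def)
  qed
  have hR1: "height (R 1) \<le> height P" using QR[OF S(1)] P by (intro height_dvd_le) (auto simp: dvd_def)
  have proxR: "prox l (crp (R a)) y \<ge> N / 2" if "a \<in> S" "y \<in> B" for a y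
  proof -
    have "N \<le> prox l (crp P) (of_nat a * y)" using that by (intro small) (auto simp: B_def)
    also have "\<dots> \<le> prox l (dil (of_nat a) (crp P)) y" by (rule prox_dil[OF l a1(1)[OF that(1)]])
    also have "dil (of_nat a) (crp P) = crp Q * crp (R a)"
      using QR[OF that(1)] crp_dil[of "of_nat a" P] crp_mult[of Q "R a"] by simp
    also have "prox l \<dots> y = prox l (crp Q) y + prox l (crp (R a)) y"
      using Q(1) R0[OF that(1)] by (intro prox_mult) auto
    finally show ?thesis using that by (simp add: B_def)
  qed
  have finB: "finite B" using Y by (simp add: B_def)
  have LB: "(\<Sum>y\<in>B. kap l z y) \<le> L" for z
    using sum_mono2[of Y B "kap l z"] Y kap_nonneg[OF l] L[of z] by (fastforce simp: B_def)
  have L0: "L \<ge> 0" using LB[of 0] sum_nonneg[of B "kap l 0"] kap_nonneg[OF l] by (meson order_trans)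
  \<comment> \<open>Linear in the height and the degree of \<open>g\<close>, so that summing over
    the factors of \<open>R 1\<close> gives the same expression for \<open>R 1\<close>.\<close>
  define K where "K = (\<lambda>g. 2 * L * (n * height g + (h + 2 * n * ln 2) * degree g))"
  have one: "N / 2 * (\<Sum>y\<in>B. prox l (crp g) y) \<le> K g" if g: "g \<in># prime_factorization (R 1)" for g
  proof -
    have pg: "prime g" using g by auto
    have g0: "g \<noteq> 0" using prime_poly_monic[OF pg] by blast
    obtain a where a: "a \<in> S" "\<not> g * Q dvd dil (of_nat a) P" using Q(3)[OF pg] by blast
    have ng: "\<not> g dvd R a"
    proof
      assume "g dvd R a"
      hence "g * Q dvd R a * Q" by (rule mult_dvd_mono) simp
      thus False using a QR[OF a(1)] by (simp add: mult.commute)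
    qed
    have "N / 2 * (\<Sum>y\<in>B. prox l (crp g) y) = (\<Sum>y\<in>B. prox l (crp g) y * (N / 2))"
      by (simp add: sum_distrib_left sum_distrib_right mult.commute sum_divide_distrib)
    also have "\<dots> \<le> (\<Sum>y\<in>B. prox l (crp g) y * prox l (crp (R a)) y)"
      using proxR[OF a(1)] prox_nonneg[OF l] by (intro sum_mono mult_left_mono) auto
    also have "\<dots> \<le> 2 * L * (degree (R a) * height g + degree g * height (R a) + 2 * degree g * degree (R a) * ln 2)"
      by (rule prox_bilinear_prime[OF pg ng R0[OF a(1)] l LB])
    also have "\<dots> \<le> 2 * L * (n * height g + degree g * h + 2 * degree g * n * ln 2)"
    proof -
      have d: "real (degree (R a)) \<le> real n" using dR[OF a(1)] by simp
      have "degree (R a) * height g \<le> n * height g" by (rule mult_right_mono[OF d height_nonneg[OF g0]])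
      moreover have "degree g * height (R a) \<le> degree g * h" by (rule mult_left_mono[OF hR[OF a(1)]]) simp
      moreover have "real (2 * degree g) * real (degree (R a)) * ln 2 \<le> real (2 * degree g) * real n * ln 2"
        using d by (intro mult_right_mono mult_left_mono) auto
      ultimately show ?thesis using L0 by (intro mult_left_mono) auto
    qed
    also have "\<dots> = K g" by (simp add: K_def algebra_simps)
    finally show ?thesis .
  qed
  have "card B * (N / 2 * (N / 2)) = (\<Sum>y\<in>B. N / 2 * (N / 2))" by simp
  also have "\<dots> \<le> (\<Sum>y\<in>B. N / 2 * prox l (crp (R 1)) y)"
    using proxR[OF S(1)] N by (intro sum_mono mult_left_mono) auto
  also have "\<dots> = N / 2 * (\<Sum>y\<in>B. \<Sum>g\<in>#prime_factorization (R 1). prox l (crp g) y)"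
    unfolding prox_prime_factorization[OF R0[OF S(1)]] by (simp only: sum_distrib_left)
  also have "\<dots> = (\<Sum>g\<in>#prime_factorization (R 1). N / 2 * (\<Sum>y\<in>B. prox l (crp g) y))"
    by (simp only: sum_mset_sum_swap sum_mset_cmult)
  also have "\<dots> \<le> (\<Sum>g\<in>#prime_factorization (R 1). K g)" by (rule sum_mset_mono) (rule one)
  also have "\<dots> = 2 * L * (n * height (R 1) + (h + 2 * n * ln 2) * degree (R 1))"
    unfolding K_def sum_mset_cmult sum_mset.distrib height_prime_factorization[OF R0[OF S(1)], symmetric]
      degree_prime_factorization[OF R0[OF S(1)], symmetric] ..
  also have "\<dots> \<le> 2 * L * (n * height P + (h + 2 * n * ln 2) * n)"
    using hR1 dR[OF S(1)] hP A1 L0 unfolding h_def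
    by (intro mult_left_mono add_mono mult_left_mono) auto
  also have "\<dots> = 2 * L * (2 * (n * height P) + n ^ 2 * ln A + n ^ 2 * (2 * ln 2))"
    by (simp add: h_def algebra_simps power2_eq_square)
  also have "\<dots> \<le> 2 * L * (2 * (n * height P) + 2 * (n ^ 2 * ln A) + n ^ 2 * 2)"
  proof -
    have "real (n ^ 2) * (2 * ln 2) \<le> real (n ^ 2) * 2" by (rule mult_left_mono) (use ln_2_less_1 in auto)
    moreover have "real (n ^ 2) * ln A \<ge> 0" using A1 by simp
    ultimately have "2 * (n * height P) + n ^ 2 * ln A + n ^ 2 * (2 * ln 2) \<le> 2 * (n * height P) + 2 * (n ^ 2 * ln A) + real (n ^ 2) * 2"
      by (simp add: algebra_simps)
    thus ?thesis using L0 by (intro mult_left_mono) auto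
  qed
  finally show ?thesis by (simp add: B_def power2_eq_square field_simps)
qed

hide_const (open) Determinants.det Finite_Cartesian_Product.mat Finite_Cartesian_Product.transpose
  Finite_Cartesian_Product.vec

subsection \<open>Homogeneous evaluation at a matrix\<close>

text \<open>For \<open>degree f \<le> q\<close> this is \<open>b^q f(M/b)\<close>, written by
  Horner's scheme without denominators.\<close>

primrec hev :: "'a::comm_ring_1 \<Rightarrow> 'a mat \<Rightarrow> nat \<Rightarrow> 'a poly \<Rightarrow> 'a mat" where
  "hev b M 0 f = coeff f 0 \<cdot>\<^sub>m 1\<^sub>m (dim_row M)"
| "hev b M (Suc q) f = (coeff f 0 * b ^ Suc q) \<cdot>\<^sub>m 1\<^sub>m (dim_row M) + M * hev b M q (poly_shift 1 f)"

lemma hev_carrier [simp]: "M \<in> carrier_mat n n \<Longrightarrow> hev b M q f \<in> carrier_mat n n"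
  by (induction q arbitrary: f) auto

lemma hev_add:
  assumes M: "M \<in> carrier_mat n n"
  shows "hev b M q (f + g) = hev b M q f + hev b M q g"
proof (induction q arbitrary: f g)
  case 0
  show ?case using M by (simp add: add_smult_distrib_right_mat[of _ n n])
next
  case (Suc q)
  have s: "poly_shift 1 (f + g) = poly_shift 1 f + poly_shift 1 g"
    by (rule poly_eqI) (simp add: coeff_poly_shift)
  have "M * (hev b M q (poly_shift 1 f) + hev b M q (poly_shift 1 g)) =
        M * hev b M q (poly_shift 1 f) + M * hev b M q (poly_shift 1 g)"
    using M by (intro mult_add_distrib_mat[of _ n n _ n]) auto
  moreover have "((coeff f 0 + coeff g 0) * b ^ Suc q) \<cdot>\<^sub>m 1\<^sub>m n =
      (coeff f 0 * b ^ Suc q) \<cdot>\<^sub>m 1\<^sub>m n + (coeff g 0 * b ^ Suc q) \<cdot>\<^sub>m (1\<^sub>m n :: 'a mat)"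
    by (rule eq_matI) (auto simp: algebra_simps)
  ultimately show ?case using M Suc unfolding hev.simps s
    by (intro eq_matI) (auto simp: algebra_simps carrier_matD[OF hev_carrier[OF M]] carrier_matD[OF M])
qed

lemma hev_smult:
  assumes M: "M \<in> carrier_mat n n"
  shows "hev b M q (Polynomial.smult c f) = c \<cdot>\<^sub>m hev b M q f"
proof (induction q arbitrary: f)
  case 0
  show ?case using M by (intro eq_matI) auto
next
  case (Suc q)
  have s: "poly_shift 1 (Polynomial.smult c f) = Polynomial.smult c (poly_shift 1 f)"
    by (rule poly_eqI) (simp add: coeff_poly_shift)
  have "M * (c \<cdot>\<^sub>m hev b M q (poly_shift 1 f)) = c \<cdot>\<^sub>m (M * hev b M q (poly_shift 1 f))"
    using M by (intro mult_smult_distrib[of _ n n _ n]) auto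
  thus ?case using M Suc unfolding hev.simps s
    by (intro eq_matI) (auto simp: algebra_simps carrier_matD[OF hev_carrier[OF M]] carrier_matD[OF M])
qed

lemma hev_Suc_degree:
  assumes M: "M \<in> carrier_mat n n" and "degree f \<le> q"
  shows "hev b M (Suc q) f = b \<cdot>\<^sub>m hev b M q f"
  using assms(2)
proof (induction q arbitrary: f)
  case 0
  hence "poly_shift 1 f = 0" by (intro poly_eqI) (simp add: coeff_poly_shift coeff_eq_0)
  thus ?case using M by (intro eq_matI) auto
next
  case (Suc q)
  have "degree (poly_shift 1 f) \<le> q"
    by (rule degree_le) (use Suc.prems in \<open>auto simp: coeff_poly_shift intro!: coeff_eq_0\<close>)
  from Suc.IH[OF this]
  have IH: "hev b M (Suc q) (poly_shift 1 f) = b \<cdot>\<^sub>m hev b M q (poly_shift 1 f)" .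
  have "hev b M (Suc (Suc q)) f = (coeff f 0 * b ^ Suc (Suc q)) \<cdot>\<^sub>m 1\<^sub>m (dim_row M) + M * hev b M (Suc q) (poly_shift 1 f)"
    by (rule hev.simps)
  also have "M * hev b M (Suc q) (poly_shift 1 f) = b \<cdot>\<^sub>m (M * hev b M q (poly_shift 1 f))"
    unfolding IH using M by (intro mult_smult_distrib[of _ n n _ n]) auto
  also have "(coeff f 0 * b ^ Suc (Suc q)) \<cdot>\<^sub>m 1\<^sub>m (dim_row M) + b \<cdot>\<^sub>m (M * hev b M q (poly_shift 1 f)) = b \<cdot>\<^sub>m hev b M (Suc q) f"
    unfolding hev.simps(2)[of _ _ q] using M by (intro eq_matI) (auto simp: algebra_simps carrier_matD[OF hev_carrier[OF M]] carrier_matD[OF M])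
  finally show ?case .
qed

lemma hev_linear_factor:
  assumes M: "M \<in> carrier_mat n n" and "degree g \<le> q"
  shows "hev b M (Suc q) ([:- a, 1:] * g) = (M + (- a * b) \<cdot>\<^sub>m 1\<^sub>m n) * hev b M q g"
proof -
  have "[:- a, 1:] * g = pCons 0 g + Polynomial.smult (- a) g" by (simp add: algebra_simps)
  hence "hev b M (Suc q) ([:- a, 1:] * g) = hev b M (Suc q) (pCons 0 g) + (- a) \<cdot>\<^sub>m hev b M (Suc q) g"
    by (simp only: hev_add[OF M] hev_smult[OF M])
  also have "hev b M (Suc q) (pCons 0 g) = M * hev b M q g"
  proof -
    have "poly_shift 1 (pCons 0 g) = g" by (rule poly_eqI) (simp add: coeff_poly_shift)
    thus ?thesis using M by (intro eq_matI) (auto simp: carrier_matD[OF hev_carrier[OF M]])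
  qed
  also have "hev b M (Suc q) g = b \<cdot>\<^sub>m hev b M q g" by (rule hev_Suc_degree[OF assms])
  also have "M * hev b M q g + (- a) \<cdot>\<^sub>m (b \<cdot>\<^sub>m hev b M q g) = M * hev b M q g + ((- a * b) \<cdot>\<^sub>m 1\<^sub>m n) * hev b M q g"
  proof -
    have "((- a * b) \<cdot>\<^sub>m 1\<^sub>m n) * hev b M q g = (- a * b) \<cdot>\<^sub>m (1\<^sub>m n * hev b M q g)"
      using M by (intro mult_smult_assoc_mat[of _ n n _ n]) auto
    also have "1\<^sub>m n * hev b M q g = hev b M q g" using M by (intro left_mult_one_mat[of _ n n]) auto
    finally show ?thesis using M by (intro eq_matI) (auto simp: algebra_simps carrier_matD[OF hev_carrier[OF M]] carrier_matD[OF M])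
  qed
  also have "\<dots> = (M + (- a * b) \<cdot>\<^sub>m 1\<^sub>m n) * hev b M q g"
    using M by (intro add_mult_distrib_mat[of _ n n _ _ n, symmetric]) auto
  finally show ?thesis .
qed

text \<open>Splitting \<open>f\<close> into linear factors turns the norm into a product over its
  roots \<open>a\<close> of \<open>det (M - a b)\<close>, so that each root can be estimated
  separately.\<close>

lemma det_hev_complex:
  fixes f :: "complex poly"
  assumes M: "M \<in> carrier_mat n n" and f: "f \<noteq> 0"
  shows "det (hev b M (degree f) f) = lead_coeff f ^ n * (\<Prod>a\<in>#proots f. det (M + (- a * b) \<cdot>\<^sub>m 1\<^sub>m n))"
proof -
  have *: "det (hev b M (size A) (\<Prod>a\<in>#A. [:- a, 1:])) = (\<Prod>a\<in>#A. det (M + (- a * b) \<cdot>\<^sub>m 1\<^sub>m n)) \<and>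
           degree (\<Prod>a\<in>#A. [:- a, 1:]) = size A" for A
  proof (induction A)
    case empty
    have "hev b M 0 1 = 1\<^sub>m n" using M by (intro eq_matI) auto
    thus ?case by simp
  next
    case (add a A)
    let ?g = "\<Prod>a\<in>#A. [:- a, 1:]"
    have g0: "?g \<noteq> 0" by (auto simp: prod_mset_zero_iff)
    have "degree ([:- a, 1:] * ?g) = Suc (size A)"
      using add g0 by (subst degree_mult_eq) auto
    moreover have "det (hev b M (Suc (size A)) ([:- a, 1:] * ?g)) = det (M + (- a * b) \<cdot>\<^sub>m 1\<^sub>m n) * det (hev b M (size A) ?g)"
    proof -
      have "det ((M + (- a * b) \<cdot>\<^sub>m 1\<^sub>m n) * hev b M (size A) ?g) = det (M + (- a * b) \<cdot>\<^sub>m 1\<^sub>m n) * det (hev b M (size A) ?g)"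
        using M by (intro det_mult[of _ n]) auto
      thus ?thesis using add by (subst hev_linear_factor[OF M]) auto
    qed
    ultimately show ?case using add by (simp only: size_add_mset image_mset_add_mset prod_mset.add_mset)
  qed
  have "hev b M (degree f) f = hev b M (degree f) (Polynomial.smult (lead_coeff f) (\<Prod>a\<in>#proots f. [:- a, 1:]))"
    by (simp only: complex_poly_decompose_multiset)
  also have "\<dots> = lead_coeff f \<cdot>\<^sub>m hev b M (size (proots f)) (\<Prod>a\<in>#proots f. [:- a, 1:])"
    by (simp only: hev_smult[OF M] size_proots_complex)
  finally have "det (hev b M (degree f) f) = lead_coeff f ^ n * det (hev b M (size (proots f)) (\<Prod>a\<in>#proots f. [:- a, 1:]))"
    using carrier_matD[OF hev_carrier[OF M]] by (simp only: det_smult)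
  thus ?thesis using *[of "proots f"] by (simp only:)
qed

lemma (in comm_ring_hom) hev_hom:
  "M \<in> carrier_mat n n \<Longrightarrow> mat_hom (hev b M q f) = hev (hom b) (mat_hom M) q (map_poly hom f)"
proof (induction q arbitrary: f)
  case 0
  thus ?case by (intro eq_matI) (auto simp: coeff_map_poly)
next
  case (Suc q)
  have s: "poly_shift 1 (map_poly hom f) = map_poly hom (poly_shift 1 f)"
    by (rule poly_eqI) (simp add: coeff_poly_shift coeff_map_poly)
  have m: "mat_hom (M * hev b M q (poly_shift 1 f)) = mat_hom M * mat_hom (hev b M q (poly_shift 1 f))"
    using Suc.prems by (intro mat_hom_mult[of _ n n _ n]) auto
  show ?case unfolding hev.simps s Suc.IH[OF Suc.prems, symmetric] m[symmetric]
    using Suc.prems by (intro eq_matI) (auto simp: coeff_map_poly hom_distribs carrier_matD[OF hev_carrier[OF Suc.prems]])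
qed

lemma smult_one_mat_vec:
  assumes "v \<in> carrier_vec n"
  shows "(c \<cdot>\<^sub>m 1\<^sub>m n) *\<^sub>v v = c \<cdot>\<^sub>v (v :: 'a :: comm_ring_1 Matrix.vec)"
proof (rule eq_vecI)
  fix i assume "i < dim_vec (c \<cdot>\<^sub>v v)"
  hence i: "i < n" using assms by simp
  have "vec_index ((c \<cdot>\<^sub>m 1\<^sub>m n) *\<^sub>v v) i = (\<Sum>j = 0..<n. (if i = j then c else 0) * vec_index v j)"
    using i assms by (auto simp: mult_mat_vec_def scalar_prod_def intro!: sum.cong)
  also have "\<dots> = (\<Sum>j = 0..<n. if i = j then c * vec_index v j else 0)" by (intro sum.cong) auto
  also have "\<dots> = c * vec_index v i" using i by simp
  finally show "vec_index ((c \<cdot>\<^sub>m 1\<^sub>m n) *\<^sub>v v) i = vec_index (c \<cdot>\<^sub>v v) i" using i assms by simp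
qed (use assms in auto)

lemma mat_vec_smult:
  assumes "M \<in> carrier_mat n n" "v \<in> carrier_vec n"
  shows "M *\<^sub>v (c \<cdot>\<^sub>v v) = c \<cdot>\<^sub>v (M *\<^sub>v (v :: 'a :: comm_ring_1 Matrix.vec))"
  using assms by (intro eq_vecI) (auto simp: scalar_prod_def sum_distrib_left mult_ac)

text \<open>Horner's scheme acts on an eigenvector through the eigenvalue. This ties the norm back
  to the value of \<open>f\<close> at \<open>y\<close>.\<close>

lemma hev_eigen:
  fixes y :: "'a :: comm_ring_1"
  assumes M: "M \<in> carrier_mat n n" and v: "v \<in> carrier_vec n" and e: "M *\<^sub>v v = (b * y) \<cdot>\<^sub>v v"
    and "degree f \<le> q"
  shows "hev b M q f *\<^sub>v v = (b ^ q * poly f y) \<cdot>\<^sub>v v"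
  using assms(4)
proof (induction q arbitrary: f)
  case 0
  then obtain c where c: "f = [:c:]" using degree_eq_zeroE by blast
  have "(c \<cdot>\<^sub>m 1\<^sub>m n) *\<^sub>v v = c \<cdot>\<^sub>v v" using v by (intro smult_one_mat_vec)
  thus ?case using M v c by simp
next
  case (Suc q)
  define g where "g = poly_shift 1 f"
  have fg: "f = pCons (coeff f 0) g"
    by (rule poly_eqI) (simp add: g_def coeff_pCons coeff_poly_shift split: nat.split)
  have "degree g \<le> q"
    by (rule degree_le) (use Suc.prems in \<open>auto simp: g_def coeff_poly_shift intro!: coeff_eq_0\<close>)
  note IH = Suc.IH[OF this]
  have "hev b M (Suc q) f *\<^sub>v v = ((coeff f 0 * b ^ Suc q) \<cdot>\<^sub>m 1\<^sub>m n) *\<^sub>v v + (M * hev b M q g) *\<^sub>v v"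
    unfolding hev.simps g_def[symmetric] using M v by (subst add_mult_distrib_mat_vec[of _ n n]) auto
  also have "((coeff f 0 * b ^ Suc q) \<cdot>\<^sub>m 1\<^sub>m n) *\<^sub>v v = (coeff f 0 * b ^ Suc q) \<cdot>\<^sub>v v"
    using v by (rule smult_one_mat_vec)
  also have "(M * hev b M q g) *\<^sub>v v = M *\<^sub>v (hev b M q g *\<^sub>v v)"
    using M v by (intro assoc_mult_mat_vec[of _ n n _ n]) auto
  also have "\<dots> = (b ^ q * poly g y) \<cdot>\<^sub>v (M *\<^sub>v v)"
    unfolding IH using M v by (rule mat_vec_smult)
  also have "\<dots> = (b ^ q * poly g y * (b * y)) \<cdot>\<^sub>v v" unfolding e by (simp add: smult_smult_assoc)
  also have "(coeff f 0 * b ^ Suc q) \<cdot>\<^sub>v v + (b ^ q * poly g y * (b * y)) \<cdot>\<^sub>v v =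
     (coeff f 0 * b ^ Suc q + b ^ q * poly g y * (b * y)) \<cdot>\<^sub>v v"
    by (rule add_smult_distrib_vec[symmetric])
  also have "coeff f 0 * b ^ Suc q + b ^ q * poly g y * (b * y) = b ^ Suc q * poly f y"
    by (subst (2) fg) (simp add: algebra_simps)
  finally show ?case .
qed

lemma degree_hev_entry:
  fixes M :: "'a :: comm_ring_1 poly mat"
  assumes M: "M \<in> carrier_mat n n" and d: "\<And>i j. i < n \<Longrightarrow> j < n \<Longrightarrow> degree (M $$ (i, j)) \<le> d" "degree b \<le> d"
    and f: "\<And>k. degree (coeff f k) = 0" and ij: "i < n" "j < n"
  shows "degree (hev b M q f $$ (i, j)) \<le> q * d"
  using f ij
proof (induction q arbitrary: f i j)
  case 0
  thus ?case using M by auto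
next
  case (Suc q)
  have H: "hev b M q (poly_shift 1 f) \<in> carrier_mat n n" using M by simp
  have IH: "degree (hev b M q (poly_shift 1 f) $$ (i, j)) \<le> q * d" if "i < n" "j < n" for i j
    by (rule Suc.IH) (use that Suc.prems in \<open>auto simp: coeff_poly_shift\<close>)
  have 1: "degree (\<Sum>k = 0..<n. M $$ (i, k) * hev b M q (poly_shift 1 f) $$ (k, j)) \<le> Suc q * d"
  proof (rule degree_sum_le)
    fix k assume "k \<in> {0..<n}"
    hence "degree (M $$ (i, k)) + degree (hev b M q (poly_shift 1 f) $$ (k, j)) \<le> d + q * d"
      using d(1)[of i k] IH[of k j] Suc.prems by (intro add_mono) auto
    thus "degree (M $$ (i, k) * hev b M q (poly_shift 1 f) $$ (k, j)) \<le> Suc q * d"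
      using degree_mult_le[of "M $$ (i, k)" "hev b M q (poly_shift 1 f) $$ (k, j)"] by simp
  qed simp
  have 2: "degree (coeff f 0 * b ^ Suc q) \<le> Suc q * d"
  proof -
    have "degree (coeff f 0 * b ^ Suc q) \<le> degree (coeff f 0) + degree (b ^ Suc q)" by (rule degree_mult_le)
    also have "degree (b ^ Suc q) \<le> degree b * Suc q" by (rule degree_power_le)
    also have "\<dots> \<le> d * Suc q" by (rule mult_le_mono1) (rule d)
    finally show ?thesis using Suc.prems by (simp add: mult.commute)
  qed
  have "hev b M (Suc q) f $$ (i, j) = coeff f 0 * b ^ Suc q * (if i = j then 1 else 0) +
     (\<Sum>k = 0..<n. M $$ (i, k) * hev b M q (poly_shift 1 f) $$ (k, j))"
  proof -
    have c: "M * hev b M q (poly_shift 1 f) \<in> carrier_mat n n" using M H by simp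
    have "(M * hev b M q (poly_shift 1 f)) $$ (i, j) = (\<Sum>k = 0..<n. M $$ (i, k) * hev b M q (poly_shift 1 f) $$ (k, j))"
      using M Suc.prems(2,3) carrier_matD[OF H] by (simp add: scalar_prod_def)
    thus ?thesis using M Suc.prems(2,3) carrier_matD[OF c] by simp
  qed
  also have "degree \<dots> \<le> Suc q * d"
    using 1 2 by (intro degree_add_le) auto
  finally show ?case .
qed

lemma cmod_det_le:
  fixes A :: "complex mat"
  assumes A: "A \<in> carrier_mat n n" and K: "\<And>i j. i < n \<Longrightarrow> j < n \<Longrightarrow> cmod (A $$ (i, j)) \<le> K"
  shows "cmod (det A) \<le> fact n * K ^ n"
proof -
  have "cmod (det A) \<le> (\<Sum>p\<in>{p. p permutes {0..<n}}. K ^ n)"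
    unfolding det_def'[OF A]
  proof (rule sum_norm_le)
    fix p assume "p \<in> {p. p permutes {0..<n}}"
    hence p: "p permutes {0..<n}" by simp
    have "cmod (signof p) = 1" by (simp add: sign_def)
    moreover have "(\<Prod>i = 0..<n. cmod (A $$ (i, p i))) \<le> (\<Prod>i = 0..<n. K)"
      using permutes_in_image[OF p] by (intro prod_mono) (auto intro!: K)
    ultimately show "cmod (signof p * (\<Prod>i = 0..<n. A $$ (i, p i))) \<le> K ^ n"
      by (simp add: norm_mult prod_norm[symmetric])
  qed
  also have "\<dots> = fact n * K ^ n" by (simp add: card_permutations)
  finally show ?thesis .
qed

text \<open>By Cramer's rule, replacing column \<open>r\<close> of \<open>A\<close> by
  \<open>A v\<close> multiplies the determinant by entry \<open>r\<close> of \<open>v\<close>; so a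
  vector that is nearly annihilated makes \<open>det A\<close> small.\<close>

lemma cmod_det_le_of_small_image:
  fixes A :: "complex mat"
  assumes A: "A \<in> carrier_mat n n" and K: "\<And>i j. i < n \<Longrightarrow> j < n \<Longrightarrow> cmod (A $$ (i, j)) \<le> K" "K \<ge> 1"
    and v: "v \<in> carrier_vec n" and r: "r < n" and e: "e > 0"
    and small: "\<And>i. i < n \<Longrightarrow> cmod (vec_index (A *\<^sub>v v) i) \<le> e"
  shows "cmod (vec_index v r) * cmod (det A) \<le> fact n * K ^ n * e"
proof -
  \<comment> \<open>Rescaled so that the image has entries at most 1, hence at most
    \<open>K\<close>; the general bound then applies to the matrix with the new column.\<close>
  define w where "w = complex_of_real (1 / e) \<cdot>\<^sub>v v"
  have w: "w \<in> carrier_vec n" using v by (simp add: w_def)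
  have Aw: "A *\<^sub>v w = complex_of_real (1 / e) \<cdot>\<^sub>v (A *\<^sub>v v)"
    unfolding w_def using A v by (intro mult_mat_vec[of _ n n]) auto
  have le: "cmod (vec_index (A *\<^sub>v w) i) \<le> K" if "i < n" for i
  proof -
    have "vec_index (A *\<^sub>v w) i = complex_of_real (1 / e) * vec_index (A *\<^sub>v v) i"
      unfolding Aw using that A by simp
    hence "cmod (vec_index (A *\<^sub>v w) i) = cmod (vec_index (A *\<^sub>v v) i) / e" using e by (simp add: norm_mult norm_divide)
    also have "\<dots> \<le> 1" using small[OF that] e by simp
    finally show ?thesis using K by simp
  qed
  have "cmod (det (replace_col A (A *\<^sub>v w) r)) \<le> fact n * K ^ n"
  proof (rule cmod_det_le)
    show "replace_col A (A *\<^sub>v w) r \<in> carrier_mat n n" using A by (simp add: replace_col_def)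
    fix i j assume "i < n" "j < n"
    thus "cmod (replace_col A (A *\<^sub>v w) r $$ (i, j)) \<le> K"
      using A K le by (simp add: replace_col_def)
  qed
  also have "det (replace_col A (A *\<^sub>v w) r) = vec_index w r * det A" by (rule cramer_lemma_mat[OF A w r])
  also have "vec_index w r = complex_of_real (1 / e) * vec_index v r" using v r by (simp add: w_def)
  finally have "cmod (vec_index v r) * cmod (det A) / e \<le> fact n * K ^ n"
    using e by (simp add: norm_mult norm_divide)
  thus ?thesis using e by (simp add: field_simps)
qed

subsection \<open>Algebraic extensions inside the complex numbers\<close>

text \<open>The scalars of a vector space have to form a type. Both base fields, the rationals and
  \<rat>(\<theta>), are therefore given by an embedding of an abstract field.\<close>

locale complex_embedding =
  fixes h :: "'k::field \<Rightarrow> complex"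
  assumes h_add: "h (a + b) = h a + h b" and h_mult: "h (a * b) = h a * h b" and h_1: "h 1 = 1"
begin

sublocale vector_space "\<lambda>c z. h c * z"
  by unfold_locales (auto simp: h_add h_mult h_1 algebra_simps)

lemma h_0: "h 0 = 0"
  using h_add[of 0 0] by simp

lemma h_minus: "h (- a) = - h a"
  using h_add[of a "- a"] by (simp add: h_0 eq_neg_iff_add_eq_0 add.commute)

lemma h_diff: "h (a - b) = h a - h b"
  using h_add[of a "- b"] by (simp add: h_minus)

lemma h_inverse: "h (inverse a) = inverse (h a)"
proof (cases "a = 0")
  case False
  hence "h a * h (inverse a) = 1" using h_mult[of a "inverse a"] h_1 by simp
  thus ?thesis by (metis inverse_unique)
qed (simp add: h_0)

lemma h_eq_0_iff: "h a = 0 \<longleftrightarrow> a = 0"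
  using h_inverse[of a] h_mult[of a "inverse a"] h_1 h_0 by (cases "a = 0") auto

lemma is_subfield_range: "is_subfield (range h)"
  unfolding is_subfield_def
proof (intro conjI ballI)
  show "0 \<in> range h" using h_0 by (metis rangeI)
  show "1 \<in> range h" using h_1 by (metis rangeI)
  fix x y assume "x \<in> range h" "y \<in> range h"
  then obtain a b where "x = h a" "y = h b" by auto
  thus "x - y \<in> range h" "x * y \<in> range h" "inverse x \<in> range h"
    by (metis h_diff rangeI, metis h_mult rangeI, metis h_inverse rangeI)
qed

lemma mult_span:
  assumes "\<And>v. v \<in> t \<Longrightarrow> z * v \<in> span u" and w: "w \<in> span t"
  shows "z * w \<in> span u"
  using w
proof (induction rule: span_induct_alt)
  case base
  show ?case by (simp add: span_zero)
next
  case (step c x y)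
  have "z * (h c * x + y) = h c * (z * x) + z * y" by (simp add: algebra_simps)
  thus ?case using step assms(1)[of x] by (metis span_add span_scale)
qed

lemma algebraic_power_in_span:
  assumes z: "algebraic_over (range h) z"
  shows "\<exists>d. z ^ d \<in> span ((\<lambda>i. z ^ i) ` {..<d})"
proof -
  obtain p where p: "p \<noteq> 0" "\<forall>i. coeff p i \<in> range h" "poly p z = 0"
    using z by (auto simp: algebraic_over_def)
  let ?d = "degree p"
  have "\<forall>i. \<exists>k. coeff p i = h k" using p(2) by auto
  then obtain k where k: "\<And>i. coeff p i = h (k i)" by metis
  have lc: "h (k ?d) \<noteq> 0" using p(1) k[of ?d] by auto
  have "0 = (\<Sum>i\<le>?d. coeff p i * z ^ i)" using p(3) by (simp add: poly_altdef)
  also have "\<dots> = (\<Sum>i<?d. h (k i) * z ^ i) + h (k ?d) * z ^ ?d"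
    by (simp add: k lessThan_Suc_atMost[symmetric])
  finally have "h (k ?d) * z ^ ?d = - (\<Sum>i<?d. h (k i) * z ^ i)" by (simp add: eq_neg_iff_add_eq_0 add.commute)
  hence "z ^ ?d = inverse (h (k ?d)) * (- (\<Sum>i<?d. h (k i) * z ^ i))" using lc by (simp add: field_simps)
  also have "\<dots> = h (- inverse (k ?d)) * (\<Sum>i<?d. h (k i) * z ^ i)" by (simp add: h_minus h_inverse)
  also have "\<dots> \<in> span ((\<lambda>i. z ^ i) ` {..<?d})"
    by (intro span_scale span_sum span_base) auto
  finally show ?thesis by blast
qed

text \<open>One number at a time: multiplying a spanning set by the powers \<open>z ^ i\<close> with
  \<open>i < d\<close> gives a space stable under \<open>z\<close> as well, since
  \<open>z ^ d\<close> reduces to lower powers.\<close>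

lemma exists_finite_invariant_span:
  assumes "finite I" "\<And>k. k \<in> I \<Longrightarrow> algebraic_over (range h) (\<xi> k)"
  shows "\<exists>t. finite t \<and> 1 \<in> span t \<and> (\<forall>k\<in>I. \<forall>v\<in>span t. \<xi> k * v \<in> span t)"
  using assms
proof (induction I rule: finite_induct)
  case empty
  show ?case by (intro exI[of _ "{1}"]) (auto intro: span_base)
next
  case (insert x I)
  then obtain t where t: "finite t" "1 \<in> span t" "\<forall>k\<in>I. \<forall>v\<in>span t. \<xi> k * v \<in> span t" by auto
  define z where "z = \<xi> x"
  obtain d where d: "z ^ d \<in> span ((\<lambda>i. z ^ i) ` {..<d})"
    using algebraic_power_in_span[of z] insert.prems z_def by auto
  have d0: "d > 0"
  proof (rule ccontr)
    assume "\<not> d > 0"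
    thus False using d by simp
  qed
  define t' where "t' = (\<lambda>(i, v). z ^ i * v) ` ({..<d} \<times> t)"
  have pw: "z ^ i * v \<in> span t'" if "i < d" "v \<in> span t" for i v
  proof (rule mult_span[OF _ that(2)])
    fix v assume "v \<in> t"
    thus "z ^ i * v \<in> span t'" using that(1) by (intro span_base) (auto simp: t'_def)
  qed
  have "1 \<in> span t'" using pw[OF d0 t(2)] by simp
  moreover have "z * v \<in> span t'" if "v \<in> span t'" for v
  proof (rule mult_span[OF _ that])
    fix v assume "v \<in> t'"
    then obtain i w where w: "i < d" "w \<in> t" "v = z ^ i * w" by (auto simp: t'_def)
    show "z * v \<in> span t'"
    proof (cases "Suc i < d")
      case True
      thus ?thesis using pw[OF True, of w] w span_base by (simp add: mult.assoc)
    next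
      case False
      hence "z * v = w * z ^ d" using w by (metis Suc_lessI mult.assoc mult.commute power_Suc)
      also have "w * z ^ d \<in> span t'"
      proof (rule mult_span[OF _ d])
        fix u assume "u \<in> (\<lambda>i. z ^ i) ` {..<d}"
        then obtain i where "i < d" "u = z ^ i" by auto
        thus "w * u \<in> span t'" using pw[of i w] w span_base by (simp add: mult.commute)
      qed
      finally show ?thesis .
    qed
  qed
  moreover have "\<xi> k * v \<in> span t'" if "k \<in> I" "v \<in> span t'" for k v
  proof (rule mult_span[OF _ that(2)])
    fix v assume "v \<in> t'"
    then obtain i w where w: "i < d" "w \<in> t" "v = z ^ i * w" by (auto simp: t'_def)
    have "\<xi> k * w \<in> span t" using t(3) that(1) span_base[OF w(2)] by blast
    hence "z ^ i * (\<xi> k * w) \<in> span t'" by (rule pw[OF w(1)])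
    thus "\<xi> k * v \<in> span t'" by (simp add: w(3) mult_ac)
  qed
  moreover have "finite t'" using t by (simp add: t'_def)
  ultimately show ?case by (intro exI[of _ t']) (auto simp: z_def)
qed

text \<open>More than \<open>card t\<close> powers in a space spanned by \<open>t\<close> are
  linearly dependent. If two powers coincide, the set of powers is too small for a dimension count,
  but the coincidence is itself an equation.\<close>

lemma algebraic_of_powers_in_span:
  assumes t: "finite t" and z: "\<And>i. z ^ i \<in> span t"
  shows "algebraic_over (range h) z"
proof -
  have "\<exists>c. (\<exists>i\<le>card t. c i \<noteq> 0) \<and> (\<Sum>i\<le>card t. h (c i) * z ^ i) = 0"
  proof (cases "inj_on (\<lambda>i. z ^ i) {..card t}")
    case False
    then obtain i j where ij: "i \<le> card t" "j \<le> card t" "i \<noteq> j" "z ^ i = z ^ j" by (auto simp: inj_on_def)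
    define c :: "nat \<Rightarrow> 'k" where "c = (\<lambda>n. if n = i then 1 else if n = j then -1 else 0)"
    have "(\<Sum>n\<le>card t. h (c n) * z ^ n) = (\<Sum>n\<in>{i, j}. h (c n) * z ^ n)"
      by (rule sum.mono_neutral_right) (use ij in \<open>auto simp: c_def h_0\<close>)
    also have "\<dots> = 0" using ij by (simp add: c_def h_1 h_minus)
    finally show ?thesis using ij by (intro exI[of _ c]) (auto simp: c_def)
  next
    case True
    let ?S = "(\<lambda>i. z ^ i) ` {..card t}"
    have "card ?S = Suc (card t)" using card_image[OF True] by simp
    hence "dependent ?S"
      using independent_span_bound[OF t, of ?S] z by fastforce
    then obtain u where u: "\<exists>v\<in>?S. u v \<noteq> 0" "(\<Sum>v\<in>?S. h (u v) * v) = 0"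
      using dependent_finite[of ?S] by auto
    show ?thesis using u
      by (intro exI[of _ "\<lambda>i. u (z ^ i)"]) (auto simp: sum.reindex[OF True])
  qed
  then obtain c where c: "\<exists>i\<le>card t. c i \<noteq> 0" "(\<Sum>i\<le>card t. h (c i) * z ^ i) = 0" by blast
  define p where "p = (\<Sum>i\<le>card t. monom (h (c i)) i)"
  have cp: "coeff p i = (if i \<le> card t then h (c i) else 0)" for i
    by (auto simp: p_def coeff_sum)
  have "p \<noteq> 0" using c(1) cp by (metis coeff_0 h_eq_0_iff)
  moreover have "poly p z = 0" using c(2) by (simp add: p_def poly_sum poly_monom)
  moreover have "coeff p i \<in> range h" for i using cp h_0 by (metis rangeI)
  ultimately show ?thesis by (auto simp: algebraic_over_def)
qed

text \<open>An equation of least degree has a non-zero constant term \<open>c\<close>; solving for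
  it expresses the inverse as a polynomial in \<open>z\<close>.\<close>

lemma inverse_in_subring:
  assumes L: "range h \<subseteq> L" "\<And>x y. x \<in> L \<Longrightarrow> y \<in> L \<Longrightarrow> x - y \<in> L" "\<And>x y. x \<in> L \<Longrightarrow> y \<in> L \<Longrightarrow> x * y \<in> L"
    and z: "z \<in> L" "z \<noteq> 0" and alg: "algebraic_over (range h) z"
  shows "inverse z \<in> L"
proof -
  have "0 \<in> L" using L(1) h_0 by (metis rangeI subsetD)
  have neg: "- x \<in> L" if "x \<in> L" for x using L(2)[OF \<open>0 \<in> L\<close> that] by simp
  have add: "x + y \<in> L" if "x \<in> L" "y \<in> L" for x y using L(2)[OF that(1) neg[OF that(2)]] by simp
  obtain p0 where p0: "p0 \<noteq> 0 \<and> (\<forall>i. coeff p0 i \<in> range h) \<and> poly p0 z = 0"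
    using alg by (auto simp: algebraic_over_def)
  define S where "S = (\<lambda>p. p \<noteq> 0 \<and> (\<forall>i. coeff p i \<in> range h) \<and> poly p z = 0)"
  obtain p where p: "S p" "\<And>q. S q \<Longrightarrow> degree p \<le> degree q"
    using ex_has_least_nat[of S p0 degree] p0 by (auto simp: S_def)
  obtain c q where pq: "p = pCons c q" by (cases p) auto
  have cq: "coeff q i \<in> range h" for i using p(1) unfolding S_def pq by (metis coeff_pCons_Suc)
  have c: "c \<in> range h" using p(1) unfolding S_def pq by (metis coeff_pCons_0)
  have "c \<noteq> 0"
  proof
    assume "c = 0"
    hence "S q" using p(1) z cq by (auto simp: S_def pq)
    hence "degree p \<le> degree q" by (rule p(2))
    moreover have "q \<noteq> 0" using \<open>S q\<close> by (simp add: S_def)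
    ultimately show False by (simp add: pq)
  qed
  have "(\<Sum>i\<in>A. coeff q i * z ^ i) \<in> L" if "finite A" for A
    using that
  proof (induction A rule: finite_induct)
    case (insert x A)
    have "z ^ n \<in> L" for n
    proof (induction n)
      case 0
      show ?case using L(1) h_1 by (metis power_0 rangeI subsetD)
    qed (use L(3) z in auto)
    hence "coeff q x * z ^ x \<in> L" using cq[of x] L(1,3) by blast
    thus ?case using insert.hyps insert.IH by (simp add: add)
  qed (simp add: \<open>0 \<in> L\<close>)
  hence "poly q z \<in> L" by (simp add: poly_altdef)
  moreover have "inverse c \<in> L"
  proof -
    obtain a where "c = h a" using c by blast
    hence "inverse c = h (inverse a)" by (simp add: h_inverse)
    thus ?thesis using L(1) by blast
  qed
  ultimately have inL: "- (inverse c * poly q z) \<in> L" using L(3) neg by blast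
  have "c + z * poly q z = 0" using p(1) by (simp add: S_def pq)
  hence "z * poly q z = - c" by (simp add: eq_neg_iff_add_eq_0 add.commute)
  hence "- inverse c * (z * poly q z) = 1" using \<open>c \<noteq> 0\<close> by simp
  hence "z * (- (inverse c * poly q z)) = 1" by (simp add: mult_ac)
  from inverse_unique[OF this] show ?thesis using inL by (simp only:)
qed

text \<open>The multipliers of an invariant span form a ring of algebraic elements, hence a field by
  \<open>inverse_in_subring\<close>; it contains all \<open>\<xi> k\<close> and so the field they
  generate.\<close>

lemma generated_field_algebraic:
  assumes I: "finite I" "\<And>k. k \<in> I \<Longrightarrow> algebraic_over (range h) (\<xi> k)" and z: "z \<in> generated_field (\<xi> ` I)"
  shows "algebraic_over (range h) z"
proof -
  obtain t where "finite t \<and> 1 \<in> span t \<and> (\<forall>k\<in>I. \<forall>v\<in>span t. \<xi> k * v \<in> span t)"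
    using exists_finite_invariant_span[OF I] ..
  hence t: "finite t" "1 \<in> span t" "\<And>k v. k \<in> I \<Longrightarrow> v \<in> span t \<Longrightarrow> \<xi> k * v \<in> span t" by simp_all
  define L where "L = {z. \<forall>v\<in>span t. z * v \<in> span t}"
  have pw: "z ^ i * v \<in> span t" if "z \<in> L" "v \<in> span t" for z i v
  proof (induction i)
    case (Suc i)
    hence "z * (z ^ i * v) \<in> span t" using that(1) unfolding L_def by blast
    thus ?case by (simp add: mult.assoc)
  qed (use that in simp)
  have alg: "algebraic_over (range h) z" if "z \<in> L" for z
    by (rule algebraic_of_powers_in_span[OF t(1)]) (use pw[OF that t(2)] in simp)
  have hL: "range h \<subseteq> L" by (auto simp: L_def span_scale)
  have diff: "x - y \<in> L" if "x \<in> L" "y \<in> L" for x y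
    using that by (auto simp: L_def left_diff_distrib intro: span_diff)
  have mult: "x * y \<in> L" if "x \<in> L" "y \<in> L" for x y
    using that by (auto simp: L_def mult.assoc)
  have "0 \<in> L" "1 \<in> L" by (auto simp: L_def span_zero)
  have "is_subfield L"
    unfolding is_subfield_def
  proof (intro conjI ballI)
    fix x assume "x \<in> L"
    thus "inverse x \<in> L" using inverse_in_subring[OF hL diff mult] alg \<open>0 \<in> L\<close>
      by (cases "x = 0") auto
  qed (use \<open>0 \<in> L\<close> \<open>1 \<in> L\<close> diff mult in auto)
  moreover have "\<xi> ` I \<subseteq> L" using t(3) by (auto simp: L_def)
  ultimately have "generated_field (\<xi> ` I) \<subseteq> L" unfolding generated_field_def by (intro hull_minimal)
  thus ?thesis using alg z by blast
qed

end

interpretation rat_embedding: complex_embedding "of_rat :: rat \<Rightarrow> complex"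
  by unfold_locales (auto simp: of_rat_add of_rat_mult)

section \<open>Transcendental numbers and the embedding of the rational function field\<close>

definition transc :: "complex \<Rightarrow> bool" where
  "transc z \<longleftrightarrow> (\<forall>p :: int poly. p \<noteq> 0 \<longrightarrow> poly (of_int_poly p) z \<noteq> 0)"

lemma not_transc_imp_algebraic_over:
  assumes "\<not> transc z"
  shows "algebraic_over (range (of_rat :: rat \<Rightarrow> complex)) z"
proof -
  obtain p :: "int poly" where "p \<noteq> 0" "poly (of_int_poly p) z = 0" using assms by (auto simp: transc_def)
  moreover have "coeff (of_int_poly p :: complex poly) i \<in> range (of_rat :: rat \<Rightarrow> complex)" for i
    by (rule range_eqI[of _ _ "of_int (coeff p i)"]) (simp add: coeff_map_poly)
  ultimately show ?thesis unfolding algebraic_over_def by (intro exI[of _ "of_int_poly p"]) auto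
qed

lemma algebraic_over_imp_not_transc:
  assumes "algebraic_over (range (of_rat :: rat \<Rightarrow> complex)) z"
  shows "\<not> transc z"
proof -
  obtain p where p: "p \<noteq> 0" "\<forall>i. coeff p i \<in> range (of_rat :: rat \<Rightarrow> complex)" "poly p z = 0"
    using assms by (auto simp: algebraic_over_def)
  have "\<forall>i. \<exists>r. coeff p i = of_rat r" using p(2) by auto
  then obtain r where r: "\<And>i. coeff p i = of_rat (r i)" by metis
  define q where "q = (\<Sum>i\<le>degree p. monom (r i) i)"
  have "r i = 0" if "i > degree p" for i using r[of i] that by (simp add: coeff_eq_0)
  hence "coeff q i = r i" for i by (auto simp: q_def coeff_sum not_le)
  hence q: "crp q = p" by (intro poly_eqI) (simp add: coeff_map_poly r)
  hence q0: "q \<noteq> 0" using p by auto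
  obtain c where "c \<noteq> 0" "crp q = Polynomial.smult c (of_int_poly (prim q))" using crp_prim[OF q0] by blast
  hence "poly (of_int_poly (prim q)) z = 0" using p(3) q by simp
  thus ?thesis using prim_nonzero[OF q0] by (auto simp: transc_def)
qed

text \<open>Monomials in the one indeterminate \<open>z\<close> correspond to exponents, so an
  integer polynomial becomes a finitely supported map with the same value at
  \<open>z\<close>.\<close>

lemma transc_of_independent:
  assumes "algebraically_independent {z}"
  shows "transc z"
  unfolding transc_def
proof (intro allI impI)
  fix p :: "int poly" assume p: "p \<noteq> 0"
  define s where "s = (\<lambda>i. Poly_Mapping.single z (i::nat))"
  have inj: "inj s" by (rule injI) (auto simp: s_def dest: arg_cong[of _ _ "\<lambda>u. Poly_Mapping.lookup u z"])
  define g where "g = (\<lambda>u. if u \<in> range s then rat_of_int (coeff p (Poly_Mapping.lookup u z)) else 0)"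
  have gs: "g (s i) = of_int (coeff p i)" for i by (simp add: g_def s_def)
  have gs2: "g (Poly_Mapping.single z i) = of_int (coeff p i)" for i using gs[of i] by (simp add: s_def)
  have g0: "g 0 = of_int (coeff p 0)" using gs2[of 0] by simp
  have supp: "{u. g u \<noteq> 0} = s ` {i. coeff p i \<noteq> 0}"
  proof -
    have "(g u \<noteq> 0) = (u \<in> s ` {i. coeff p i \<noteq> 0})" for u
    proof (cases "u \<in> range s")
      case True
      then obtain i where "u = s i" by blast
      thus ?thesis using gs[of i] inj_image_mem_iff[OF inj, of i "{i. coeff p i \<noteq> 0}"] by simp
    next
      case False
      hence "g u = 0" by (simp add: g_def)
      thus ?thesis using False by blast
    qed
    thus ?thesis by blast
  qed
  have finp: "finite {i. coeff p i \<noteq> 0}" by (rule finite_subset[of _ "{..degree p}"]) (auto intro: le_degree)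
  define P where "P = Abs_poly_mapping g"
  have look: "Poly_Mapping.lookup P = g" unfolding P_def
    by (rule lookup_Abs_poly_mapping) (use supp finp in simp)
  have keys: "Poly_Mapping.keys P = s ` {i. coeff p i \<noteq> 0}"
    using supp by (auto simp: in_keys_iff look)
  have "P \<noteq> 0"
  proof
    assume "P = 0"
    hence "g (s (degree p)) = 0" using look by (metis lookup_zero)
    thus False using p gs by simp
  qed
  moreover have "\<forall>u\<in>Poly_Mapping.keys P. Poly_Mapping.keys u \<subseteq> {z}"
    by (auto simp: keys s_def split: if_splits)
  ultimately have "eval_mpoly P \<noteq> 0" using assms by (auto simp: algebraically_independent_def)
  moreover have "eval_mpoly P = (\<Sum>i\<in>{i. coeff p i \<noteq> 0}. of_int (coeff p i) * z ^ i)"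
    unfolding eval_mpoly_def keys look
    by (subst sum.reindex[OF inj_on_subset[OF inj]]) (auto simp: gs2 g0 s_def intro!: sum.cong)
  also have "\<dots> = (\<Sum>i\<le>degree p. of_int (coeff p i) * z ^ i)"
    by (rule sum.mono_neutral_left) (auto intro: le_degree)
  also have "\<dots> = poly (of_int_poly p) z" by (simp add: poly_altdef)
  finally show "poly (of_int_poly p) z \<noteq> 0" by simp
qed

abbreviation ev :: "complex \<Rightarrow> int poly \<Rightarrow> complex" where
  "ev z p \<equiv> poly (of_int_poly p) z"

lemma ev_hom: "comm_ring_hom (ev z)"
  by unfold_locales (auto simp: of_int_poly_hom.hom_add of_int_poly_hom.hom_mult)

text \<open>Evaluation of rational functions at \<open>z\<close>. A transcendental \<open>z\<close>
  is no root of a denominator, so the choice of the fraction does not matter.\<close>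

definition fev :: "complex \<Rightarrow> int poly fract \<Rightarrow> complex" where
  "fev z c = (SOME w. \<exists>p q. q \<noteq> 0 \<and> c = Fract p q \<and> w = ev z p / ev z q)"

lemma fev_Fract:
  assumes z: "transc z" and q: "q \<noteq> 0"
  shows "fev z (Fract p q) = ev z p / ev z q"
proof -
  have "\<exists>w p' q'. q' \<noteq> 0 \<and> Fract p q = Fract p' q' \<and> w = ev z p' / ev z q'" using q by blast
  from someI_ex[OF this] obtain p' q' where *: "q' \<noteq> 0" "Fract p q = Fract p' q'" "fev z (Fract p q) = ev z p' / ev z q'"
    unfolding fev_def by blast
  hence "p * q' = p' * q" using q by (simp add: eq_fract)
  hence "ev z p * ev z q' = ev z p' * ev z q"
    by (metis of_int_poly_hom.hom_mult poly_mult)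
  moreover have "ev z q \<noteq> 0" "ev z q' \<noteq> 0" using z q * by (auto simp: transc_def)
  ultimately have "ev z p' / ev z q' = ev z p / ev z q" by (simp add: frac_eq_eq)
  thus ?thesis using *(3) by simp
qed

lemma complex_embedding_fev:
  assumes z: "transc z"
  shows "complex_embedding (fev z)"
proof
  interpret ev: comm_ring_hom "ev z" by (rule ev_hom)
  have *: "fev z (a + b) = fev z a + fev z b \<and> fev z (a * b) = fev z a * fev z b" for a b
  proof -
    obtain p q where a: "a = Fract p q" "q \<noteq> 0" by (cases a) auto
    obtain p' q' where b: "b = Fract p' q'" "q' \<noteq> 0" by (cases b) auto
    have nz: "ev z q \<noteq> 0" "ev z q' \<noteq> 0" using z a(2) b(2) unfolding transc_def by blast+
    have q: "q * q' \<noteq> 0" using a(2) b(2) by simp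
    have "fev z (a + b) = ev z (p * q' + p' * q) / ev z (q * q')"
      unfolding a(1) b(1) add_fract[OF a(2) b(2)] by (rule fev_Fract[OF z q])
    also have "\<dots> = ev z p / ev z q + ev z p' / ev z q'"
      unfolding ev.hom_add ev.hom_mult by (rule add_frac_eq[OF nz, symmetric])
    finally have 1: "fev z (a + b) = fev z a + fev z b"
      unfolding a(1) b(1) fev_Fract[OF z a(2)] fev_Fract[OF z b(2)] .
    have "fev z (a * b) = ev z (p * p') / ev z (q * q')"
      unfolding a(1) b(1) mult_fract by (rule fev_Fract[OF z q])
    also have "\<dots> = ev z p / ev z q * (ev z p' / ev z q')"
      unfolding ev.hom_mult by simp
    finally have "fev z (a * b) = fev z a * fev z b"
      unfolding a(1) b(1) fev_Fract[OF z a(2)] fev_Fract[OF z b(2)] .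
    with 1 show ?thesis by blast
  qed
  show "fev z (a + b) = fev z a + fev z b" for a b using * by blast
  show "fev z (a * b) = fev z a * fev z b" for a b using * by blast
  show "fev z 1 = 1" using fev_Fract[OF z, of 1 1] by (simp add: One_fract_def[symmetric])
qed

lemma common_denominator:
  assumes "finite C"
  shows "\<exists>b. b \<noteq> 0 \<and> (\<forall>c\<in>C. \<exists>N. c = Fract N (b :: int poly))"
  using assms
proof (induction C rule: finite_induct)
  case empty
  show ?case by (intro exI[of _ 1]) auto
next
  case (insert c C)
  then obtain b where b: "b \<noteq> 0" "\<forall>c\<in>C. \<exists>N. c = Fract N b" by blast
  obtain p q where c: "c = Fract p q" "q \<noteq> 0" by (cases c) auto
  have bq: "b * q \<noteq> 0" using b(1) c(2) by simp
  have "\<exists>N. c' = Fract N (b * q)" if c': "c' \<in> insert c C" for c'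
  proof (cases "c' = c")
    case True
    have "Fract p q = Fract (p * b) (b * q)" using eq_fract(1)[OF c(2) bq, of p "p * b"] by (simp add: mult_ac)
    thus ?thesis unfolding True c(1) by blast
  next
    case False
    then obtain N where N: "c' = Fract N b" using b(2) c' by blast
    have "Fract N b = Fract (N * q) (b * q)" using eq_fract(1)[OF b(1) bq, of N "N * q"] by (simp add: mult_ac)
    thus ?thesis unfolding N by blast
  qed
  with bq show ?case by blast
qed

text \<open>A basis of a finite-dimensional \<open>\<rat>(z)\<close>-subspace of the complex numbers which is stable under
  multiplication by the given numbers, with the matrices of these multiplications cleared of
  denominators.\<close>

lemma exists_multiplication_matrices:
  assumes z: "transc z" and I: "finite I" "\<And>k. k \<in> I \<Longrightarrow> algebraic_over (generated_field {z}) (\<xi> k)"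
  obtains D :: nat and \<omega> b N where "\<And>v. (\<Sum>r<D. ev z (v r) * \<omega> r) = 0 \<Longrightarrow> \<forall>r<D. v r = 0"
    and "\<exists>r<D. \<omega> r \<noteq> 0" and "b \<noteq> 0"
    and "\<And>k r. k \<in> I \<Longrightarrow> r < D \<Longrightarrow> ev z b * \<xi> k * \<omega> r = (\<Sum>s<D. ev z (N k r s) * \<omega> s)"
proof -
  interpret E: complex_embedding "fev z" by (rule complex_embedding_fev[OF z])
  have "fev z (Fract [:0, 1:] 1) = z" using fev_Fract[OF z, of 1 "[:0, 1:]"] by simp
  hence "{z} \<subseteq> range (fev z)" by (metis empty_subsetI insert_subset rangeI)
  hence "generated_field {z} \<subseteq> range (fev z)"
    unfolding generated_field_def using E.is_subfield_range by (intro hull_minimal)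
  hence alg: "algebraic_over (range (fev z)) (\<xi> k)" if "k \<in> I" for k
    using I(2)[OF that] unfolding algebraic_over_def by blast
  obtain t where "finite t \<and> 1 \<in> E.span t \<and> (\<forall>k\<in>I. \<forall>v\<in>E.span t. \<xi> k * v \<in> E.span t)"
    using E.exists_finite_invariant_span[OF I(1) alg] ..
  hence t: "finite t" "1 \<in> E.span t" "\<And>k v. k \<in> I \<Longrightarrow> v \<in> E.span t \<Longrightarrow> \<xi> k * v \<in> E.span t" by simp_all
  obtain B where B: "B \<subseteq> t" "E.independent B" "t \<subseteq> E.span B"
    using E.maximal_independent_subset by blast
  have spB: "E.span B = E.span t" using B(1,3) by (metis E.span_mono E.span_span subset_antisym)
  have finB: "finite B" using B(1) t(1) finite_subset by blast
  obtain \<omega> where \<omega>: "bij_betw \<omega> {..<card B} B" using ex_bij_betw_nat_finite[OF finB] by (auto simp: atLeast0LessThan)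
  define D where "D = card B"
  have \<omega>B: "\<omega> r \<in> B" if "r < D" for r using bij_betwE[OF \<omega>] that by (auto simp: D_def)
  have sumB: "(\<Sum>v\<in>B. f v) = (\<Sum>r<D. f (\<omega> r))" for f :: "complex \<Rightarrow> complex"
    using sum.reindex_bij_betw[OF \<omega>, of f] by (simp add: D_def)
  have "\<exists>u. \<xi> k * \<omega> r = (\<Sum>s<D. fev z (u s) * \<omega> s)" if "k \<in> I" "r < D" for k r
  proof -
    have "\<xi> k * \<omega> r \<in> E.span B" using t(3)[OF that(1)] E.span_base[OF \<omega>B[OF that(2)]] unfolding spB by blast
    then obtain u where "\<xi> k * \<omega> r = (\<Sum>v\<in>B. fev z (u v) * v)" unfolding E.span_finite[OF finB] by auto
    thus ?thesis unfolding sumB by (intro exI[of _ "\<lambda>s. u (\<omega> s)"])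
  qed
  then obtain c where c: "\<And>k r. k \<in> I \<Longrightarrow> r < D \<Longrightarrow> \<xi> k * \<omega> r = (\<Sum>s<D. fev z (c k r s) * \<omega> s)"
    by metis
  have "finite ((\<lambda>(k, r, s). c k r s) ` (I \<times> {..<D} \<times> {..<D}))" using I(1) by simp
  from common_denominator[OF this] obtain b where b: "b \<noteq> 0"
    "\<And>k r s. k \<in> I \<Longrightarrow> r < D \<Longrightarrow> s < D \<Longrightarrow> \<exists>N. c k r s = Fract N b" by fastforce
  then obtain N where N: "\<And>k r s. k \<in> I \<Longrightarrow> r < D \<Longrightarrow> s < D \<Longrightarrow> c k r s = Fract (N k r s) b"
    by metis
  have evb: "ev z b \<noteq> 0" using z b by (auto simp: transc_def)
  show thesis
  proof
    show "b \<noteq> 0" by (rule b)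
    fix k r assume kr: "k \<in> I" "r < D"
    have "ev z b * \<xi> k * \<omega> r = ev z b * (\<Sum>s<D. fev z (c k r s) * \<omega> s)" using c[OF kr] by simp
    also have "\<dots> = (\<Sum>s<D. ev z (N k r s) * \<omega> s)"
      unfolding sum_distrib_left using evb
      by (intro sum.cong) (auto simp: N[OF kr] fev_Fract[OF z b(1)])
    finally show "ev z b * \<xi> k * \<omega> r = (\<Sum>s<D. ev z (N k r s) * \<omega> s)" .
  next
    fix v assume v: "(\<Sum>r<D. ev z (v r) * \<omega> r) = 0"
    define u where "u = (\<lambda>x. Fract (v (inv_into {..<D} \<omega> x)) 1)"
    have inv: "inv_into {..<D} \<omega> (\<omega> r) = r" if "r < D" for r
      using \<omega> that by (simp add: D_def bij_betw_def inv_into_f_f)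
    have "(\<Sum>x\<in>B. fev z (u x) * x) = (\<Sum>r<D. ev z (v r) * \<omega> r)"
      unfolding sumB by (intro sum.cong) (auto simp: u_def inv fev_Fract[OF z])
    hence "\<forall>x\<in>B. u x = 0" using E.independentD[OF B(2) finB subset_refl, of u] v by simp
    hence "u (\<omega> r) = 0" if "r < D" for r using \<omega>B[OF that] by blast
    thus "\<forall>r<D. v r = 0" by (auto simp: u_def inv Zero_fract_def eq_fract)
  next
    have "1 \<in> E.span B" using t(2) spB by simp
    hence one: "1 \<in> E.span B" .
    have "\<not> B \<subseteq> {0}"
    proof
      assume "B \<subseteq> {0}"
      hence "E.span B \<subseteq> {0}" using E.subspace_single_0 by (rule E.span_minimal)
      hence "(1::complex) \<in> {0}" using one by (rule subsetD)
      thus False by simp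
    qed
    then obtain x where "x \<in> B" "x \<noteq> 0" by blast
    moreover have "\<omega> ` {..<D} = B" using \<omega> by (simp add: D_def bij_betw_def)
    ultimately obtain r where "r < D" "\<omega> r = x" by blast
    thus "\<exists>r<D. \<omega> r \<noteq> 0" using \<open>x \<noteq> 0\<close> by blast
  qed
qed

subsection \<open>Transfer to the transcendental generator\<close>

lemma prod_mset_le_exp:
  assumes "\<And>a. a \<in># A \<Longrightarrow> 0 \<le> u a \<and> u a \<le> exp (w a)"
  shows "(\<Prod>a\<in>#A. u a) \<le> exp (\<Sum>a\<in>#A. (w a :: real)) \<and> 0 \<le> (\<Prod>a\<in>#A. u a)"
  using assms
proof (induction A)
  case (add x A)
  have "u x * (\<Prod>a\<in>#A. u a) \<le> exp (w x) * exp (\<Sum>a\<in>#A. w a)"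
    using add by (intro mult_mono) auto
  thus ?case using add by (simp add: exp_add)
qed simp

text \<open>The difference quotient at \<open>z\<close> is given by synthetic division; it is a
  polynomial and hence bounded on the disc.\<close>

lemma int_poly_lipschitz:
  fixes S :: "int poly set"
  assumes "finite S"
  shows "\<exists>B\<ge>1. \<forall>p\<in>S. \<forall>x. cmod x \<le> R \<longrightarrow> cmod (ev x p) \<le> B \<and> cmod (ev x p - ev z p) \<le> B * cmod (x - z)"
proof -
  have bd: "\<exists>c\<ge>0. \<forall>x. cmod x \<le> R \<longrightarrow> cmod (poly q x) \<le> c" for q :: "complex poly"
  proof (intro exI[of _ "\<Sum>i\<le>degree q. cmod (coeff q i) * \<bar>R\<bar> ^ i"] conjI allI impI)
    fix x assume x: "cmod x \<le> R"
    show "cmod (poly q x) \<le> (\<Sum>i\<le>degree q. cmod (coeff q i) * \<bar>R\<bar> ^ i)"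
      unfolding poly_altdef using x
      by (intro sum_norm_le) (auto simp: norm_mult norm_power intro!: mult_left_mono power_mono)
  qed (auto intro!: sum_nonneg)
  have "\<exists>c\<ge>0. \<forall>x. cmod x \<le> R \<longrightarrow> cmod (ev x p) \<le> c \<and> cmod (ev x p - ev z p) \<le> c * cmod (x - z)" for p :: "int poly"
  proof -
    let ?q = "synthetic_div (of_int_poly p) z"
    obtain c where c: "c \<ge> 0" "\<And>x. cmod x \<le> R \<Longrightarrow> cmod (ev x p) \<le> c" using bd[of "of_int_poly p"] by blast
    obtain d where d: "d \<ge> 0" "\<And>x. cmod x \<le> R \<Longrightarrow> cmod (poly ?q x) \<le> d" using bd[of ?q] by blast
    have eq: "ev x p - ev z p = (x - z) * poly ?q x" for x
    proof -
      have "poly (of_int_poly p) x = poly ([:- z, 1:] * ?q + [:ev z p:]) x"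
        by (simp only: synthetic_div_correct')
      thus ?thesis by (simp add: algebra_simps)
    qed
    have "cmod (ev x p - ev z p) \<le> (c + d) * cmod (x - z)" if "cmod x \<le> R" for x
    proof -
      have "cmod (x - z) * cmod (poly ?q x) \<le> cmod (x - z) * (c + d)"
        using d(2)[OF that] c(1) by (intro mult_left_mono) auto
      thus ?thesis unfolding eq norm_mult by (simp only: mult.commute)
    qed
    moreover have "cmod (ev x p) \<le> c + d" if "cmod x \<le> R" for x using c(2)[OF that] d(1) by linarith
    ultimately show ?thesis using c(1) d(1) by (intro exI[of _ "c + d"]) auto
  qed
  then obtain c where c: "\<And>p. c p \<ge> 0"
    "\<And>p x. cmod x \<le> R \<Longrightarrow> cmod (ev x p) \<le> c p \<and> cmod (ev x p - ev z p) \<le> c p * cmod (x - z)"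
    by metis
  have le: "c p \<le> 1 + (\<Sum>p\<in>S. c p)" if "p \<in> S" for p
    using member_le_sum[of p S c] that assms c(1) by force
  show ?thesis
  proof (intro exI[of _ "1 + (\<Sum>p\<in>S. c p)"] conjI ballI allI impI)
    show "1 \<le> 1 + (\<Sum>p\<in>S. c p)" using c(1) by (simp add: sum_nonneg)
    fix p x assume p: "p \<in> S" and x: "cmod x \<le> R"
    show "cmod (ev x p) \<le> 1 + (\<Sum>p\<in>S. c p)" using c(2)[OF x, of p] le[OF p] by linarith
    have "c p * cmod (x - z) \<le> (1 + (\<Sum>p\<in>S. c p)) * cmod (x - z)"
      by (rule mult_right_mono[OF le[OF p]]) simp
    thus "cmod (ev x p - ev z p) \<le> (1 + (\<Sum>p\<in>S. c p)) * cmod (x - z)" using c(2)[OF x, of p] by linarith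
  qed
qed

lemma ev_smult: "ev x (Polynomial.smult c p) = of_int c * ev x p"
proof -
  have "of_int_poly (Polynomial.smult c p) = Polynomial.smult (of_int c) (of_int_poly p :: complex poly)"
    by (rule poly_eqI) (simp add: coeff_map_poly)
  thus ?thesis by simp
qed

lemma ev_const: "ev x [:c:] = of_int c"
proof -
  have "of_int_poly [:c:] = [:of_int c :: complex:]"
    by (rule poly_eqI) (simp add: coeff_map_poly coeff_pCons split: nat.split)
  thus ?thesis by simp
qed

text \<open>Multiplication by the linear form \<open>y\<close> is given by a matrix \<open>M\<close>
  of integer polynomials over a common denominator \<open>b\<close>, and \<open>G\<close> is the
  determinant of \<open>b^q f(M/b)\<close>, in essence the norm of \<open>f y\<close>. A root
  \<open>a\<close> of \<open>f\<close> near \<open>y\<close> lets \<open>M - a b\<close> nearly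
  annihilate the basis vector \<omega> at arguments near \<open>z\<close>, which makes its
  determinant small there; so the roots of \<open>G\<close> come close to \<open>z\<close>. The size
  of the coefficients \<open>j\<close> costs only \<open>ln X\<close> per root.\<close>

lemma transfer:
  fixes \<xi> :: "nat \<Rightarrow> complex"
  assumes z: "transc z" and alg: "\<And>k. k \<in> {1..m} \<Longrightarrow> algebraic_over (generated_field {z}) (\<xi> k)"
  shows "\<exists>C::real. C > 0 \<and> (\<forall>X\<ge>(2::real). \<forall>j :: nat \<Rightarrow> int. (\<forall>k\<in>{1..m}. \<bar>real_of_int (j k)\<bar> \<le> X) \<longrightarrow>
    (\<forall>f :: int poly. f \<noteq> 0 \<longrightarrow> ev (\<Sum>k=1..m. of_int (j k) * \<xi> k) f \<noteq> 0 \<longrightarrow> (\<forall>l\<ge>(0::real). \<exists>G :: int poly. G \<noteq> 0 \<and>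
      real (degree G) \<le> C * real (degree f) \<and>
      lmeas (of_int_poly G) \<le> C * (lmeas (of_int_poly f) + real (degree f) * ln X) \<and>
      prox l (of_int_poly G) z \<ge> prox l (of_int_poly f) (\<Sum>k=1..m. of_int (j k) * \<xi> k)
        - C * (lmeas (of_int_poly f) + real (degree f) * ln X))))"
proof -
  obtain D :: nat and \<omega> b N where indep: "\<And>v. (\<Sum>r<D. ev z (v r) * \<omega> r) = 0 \<Longrightarrow> \<forall>r<D. v r = 0"
    and ne: "\<exists>r<D. \<omega> r \<noteq> 0" and b0: "b \<noteq> 0"
    and N: "\<And>k r. k \<in> {1..m} \<Longrightarrow> r < D \<Longrightarrow> ev z b * \<xi> k * \<omega> r = (\<Sum>s<D. ev z (N k r s) * \<omega> s)"
    by (rule exists_multiplication_matrices[OF z finite_atLeastAtMost[of 1 m] alg]) (assumption, rule that)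
  obtain r0 where r0: "r0 < D" "\<omega> r0 \<noteq> 0" using ne by blast
  define S where "S = insert b ((\<lambda>(k, r, s). N k r s) ` ({1..m} \<times> {..<D} \<times> {..<D}))"
  have finS: "finite S" by (simp add: S_def)
  have NS: "N k r s \<in> S" if "k \<in> {1..m}" "r < D" "s < D" for k r s
    unfolding S_def using that by (intro insertI2 image_eqI[of _ _ "(k, r, s)"]) auto
  have bS: "b \<in> S" by (simp add: S_def)
  define R where "R = cmod z + 1"
  obtain B where B: "B \<ge> 1"
    "\<And>p x. p \<in> S \<Longrightarrow> cmod x \<le> R \<Longrightarrow> cmod (ev x p) \<le> B"
    "\<And>p x. p \<in> S \<Longrightarrow> cmod x \<le> R \<Longrightarrow> cmod (ev x p - ev z p) \<le> B * cmod (x - z)"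
    using int_poly_lipschitz[OF finS, of R z] by blast
  define d0 where "d0 = (\<Sum>p\<in>S. degree p)"
  have d0: "degree p \<le> d0" if "p \<in> S" for p
    unfolding d0_def using member_le_sum[of p S degree] that finS by auto
  define W where "W = 1 + (\<Sum>s<D. cmod (\<omega> s))"
  have W1: "W \<ge> 1" by (simp add: W_def sum_nonneg)
  have WW: "cmod (\<omega> r) \<le> W" if "r < D" for r
    using member_le_sum[of r "{..<D}" "\<lambda>s. cmod (\<omega> s)"] that by (simp add: W_def)
  define A where "A = fact D * ((real m + 1) * B) ^ D"
  \<comment> \<open>Absorbs the two determinant bounds: \<open>A\<close> for the plain one, the last
    summand for the one through the vector \<omega>, whose non-zero entry \<open>\<omega> r0\<close>
    is divided out.\<close>
  define C2 where "C2 = 1 + A + A * ((real m + 2) * B * W) / cmod (\<omega> r0)"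
  have A0: "A \<ge> 0" using B(1) by (simp add: A_def)
  have C2: "C2 \<ge> 1" "A \<le> C2" "A * ((real m + 2) * B * W) / cmod (\<omega> r0) \<le> C2"
    using A0 B(1) W1 by (auto simp: C2_def)
  define C3 where "C3 = 1 + (\<Sum>k=1..m. cmod (\<xi> k))"
  have C3: "C3 \<ge> 1" by (simp add: C3_def sum_nonneg)
  define c0 where "c0 = ln C2 + ln 2 + ln C3"
  have c00: "c0 \<ge> 0" using C2 C3 by (simp add: c0_def)
  define C where "C = real D + 2 + c0 / ln 2 + real (d0 * D)"
  have CC: "C > 0" using c00 by (simp add: C_def add_pos_nonneg)
  show ?thesis
  proof (intro exI[of _ C] conjI CC allI impI, goal_cases)
    case (1 X j f l)
    define y where "y = (\<Sum>k=1..m. of_int (j k) * \<xi> k)"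
    define q where "q = degree f"
    let ?F = "of_int_poly f :: complex poly"
    have X: "X \<ge> 2" and jX: "\<And>k. k \<in> {1..m} \<Longrightarrow> \<bar>real_of_int (j k)\<bar> \<le> X" and f0: "f \<noteq> 0"
      and fy: "ev y f \<noteq> 0" and l: "l \<ge> 0" using 1 by (auto simp: y_def)
    have F0: "?F \<noteq> 0" using f0 by simp
    have dF: "degree ?F = q" by (simp add: q_def)
    define MM where "MM = Matrix.mat D D (\<lambda>(r, s). \<Sum>k=1..m. [:j k:] * N k r s)"
    \<comment> \<open>The value of \<open>MM\<close> at an arbitrary \<open>x\<close>, not only at
      \<open>z\<close>, because Jensen's inequality needs a whole circle.\<close>
    define Mx where "Mx = (\<lambda>x. Matrix.mat D D (\<lambda>(r, s). \<Sum>k=1..m. of_int (j k) * ev x (N k r s)))"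
    have MM: "MM \<in> carrier_mat D D" and Mx: "Mx x \<in> carrier_mat D D" for x by (simp_all add: MM_def Mx_def)
    define Hm where "Hm = hev b MM q (map_poly (\<lambda>c. [:c:]) f)"
    have Hm: "Hm \<in> carrier_mat D D" unfolding Hm_def by (rule hev_carrier[OF MM])
    define G where "G = det Hm"
    have evH: "map_mat (ev x) Hm = hev (ev x b) (Mx x) q ?F" for x
    proof -
      interpret ev: comm_ring_hom "ev x" by (rule ev_hom)
      have "map_mat (ev x) MM = Mx x"
        by (rule eq_matI) (auto simp: MM_def Mx_def ev.hom_sum ev.hom_mult ev_smult)
      moreover have "map_poly (ev x) (map_poly (\<lambda>c. [:c:]) f) = ?F"
        by (rule poly_eqI) (simp add: coeff_map_poly ev_const del: of_int_hom.map_poly_pCons_hom)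
      ultimately show ?thesis unfolding Hm_def ev.hev_hom[OF MM] by simp
    qed
    define E where "E = (\<lambda>a x. Mx x + (- a * ev x b) \<cdot>\<^sub>m 1\<^sub>m D)"
    have E: "E a x \<in> carrier_mat D D" for a x using Mx by (simp add: E_def)
    have evG: "ev x G = lead_coeff ?F ^ D * (\<Prod>a\<in>#proots ?F. det (E a x))" for x
    proof -
      interpret ev: comm_ring_hom "ev x" by (rule ev_hom)
      have "ev x G = det (map_mat (ev x) Hm)" unfolding G_def by (rule ev.hom_det[symmetric])
      also have "\<dots> = det (hev (ev x b) (Mx x) (degree ?F) ?F)" unfolding evH dF ..
      also have "\<dots> = lead_coeff ?F ^ D * (\<Prod>a\<in>#proots ?F. det (Mx x + (- a * ev x b) \<cdot>\<^sub>m 1\<^sub>m D))"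
        by (rule det_hev_complex[OF Mx F0])
      finally show ?thesis by (simp only: E_def)
    qed
    define \<Omega> where "\<Omega> = Matrix.vec D \<omega>"
    have \<Omega>: "\<Omega> \<in> carrier_vec D" by (simp add: \<Omega>_def)
    \<comment> \<open>Exact only at \<open>z\<close>: there \<omega> is an eigenvector with
      eigenvalue \<open>ev z b * y\<close>.\<close>
    have eig: "(\<Sum>s<D. Mx z $$ (r, s) * \<omega> s) = ev z b * y * \<omega> r" if r: "r < D" for r
    proof -
      have "(\<Sum>s<D. Mx z $$ (r, s) * \<omega> s) = (\<Sum>s<D. \<Sum>k=1..m. of_int (j k) * (ev z (N k r s) * \<omega> s))"
        using r by (intro sum.cong) (auto simp: Mx_def sum_distrib_right mult.assoc)
      also have "\<dots> = (\<Sum>k=1..m. \<Sum>s<D. of_int (j k) * (ev z (N k r s) * \<omega> s))" by (rule sum.swap)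
      also have "\<dots> = (\<Sum>k=1..m. of_int (j k) * (ev z b * \<xi> k * \<omega> r))"
        using N r by (intro sum.cong) (auto simp: sum_distrib_left[symmetric])
      also have "\<dots> = ev z b * y * \<omega> r"
        by (simp add: y_def sum_distrib_left sum_distrib_right mult_ac)
      finally show ?thesis .
    qed
    have rowsum: "vec_index (A *\<^sub>v \<Omega>) r = (\<Sum>s<D. A $$ (r, s) * \<omega> s)" if "A \<in> carrier_mat D D" "r < D" for A r
      using that by (simp add: \<Omega>_def scalar_prod_def atLeast0LessThan)
    \<comment> \<open>If \<open>G = 0\<close>, a non-zero vector of polynomials annihilates
      \<open>Hm\<close> from the left. Applied to the eigenvector this gives a linear relation
      between the \<open>\<omega> r\<close>, multiplied by \<open>ev z b ^ q * ev y f\<close>, which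
      is not zero.\<close>
    have Geq0: "G \<noteq> 0"
    proof
      assume "G = 0"
      hence "det (transpose_mat Hm) = 0" using Determinant.det_transpose[OF Hm] by (simp add: G_def)
      then obtain v where v: "v \<in> carrier_vec D" "v \<noteq> 0\<^sub>v D" "transpose_mat Hm *\<^sub>v v = 0\<^sub>v D"
        using det_0_iff_vec_prod_zero[of "transpose_mat Hm" D] Hm by auto
      have col: "(\<Sum>r<D. ev z (vec_index v r) * ev z (Hm $$ (r, s))) = 0" if s: "s < D" for s
      proof -
        interpret ev: comm_ring_hom "ev z" by (rule ev_hom)
        have "(\<Sum>r<D. Hm $$ (r, s) * vec_index v r) = vec_index (transpose_mat Hm *\<^sub>v v) s"
          using Hm v(1) s by (simp add: scalar_prod_def atLeast0LessThan)
        also have "\<dots> = 0" using v(3) s by simp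
        finally have "ev z (\<Sum>r<D. Hm $$ (r, s) * vec_index v r) = 0" by simp
        thus ?thesis by (simp add: ev.hom_sum ev.hom_mult mult.commute)
      qed
      have "Mx z *\<^sub>v \<Omega> = (ev z b * y) \<cdot>\<^sub>v \<Omega>"
      proof (rule eq_vecI)
        fix r assume "r < dim_vec ((ev z b * y) \<cdot>\<^sub>v \<Omega>)"
        hence r: "r < D" by (simp add: \<Omega>_def)
        show "vec_index (Mx z *\<^sub>v \<Omega>) r = vec_index ((ev z b * y) \<cdot>\<^sub>v \<Omega>) r"
          unfolding rowsum[OF Mx r] eig[OF r] using r by (simp add: \<Omega>_def)
      qed (use Mx in \<open>simp add: \<Omega>_def Mx_def\<close>)
      from hev_eigen[OF Mx \<Omega> this, of ?F q] dF
      have he: "hev (ev z b) (Mx z) q ?F *\<^sub>v \<Omega> = (ev z b ^ q * ev y f) \<cdot>\<^sub>v \<Omega>" by simp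
      have row: "(\<Sum>s<D. ev z (Hm $$ (r, s)) * \<omega> s) = ev z b ^ q * ev y f * \<omega> r" if r: "r < D" for r
      proof -
        have c: "map_mat (ev z) Hm \<in> carrier_mat D D" using Hm by simp
        have "(\<Sum>s<D. ev z (Hm $$ (r, s)) * \<omega> s) = (\<Sum>s<D. map_mat (ev z) Hm $$ (r, s) * \<omega> s)"
          using Hm r by (intro sum.cong) auto
        also have "\<dots> = vec_index (map_mat (ev z) Hm *\<^sub>v \<Omega>) r" by (rule rowsum[OF c r, symmetric])
        also have "\<dots> = ev z b ^ q * ev y f * \<omega> r" unfolding evH he using r by (simp add: \<Omega>_def)
        finally show ?thesis .
      qed
      have "ev z b ^ q * ev y f * (\<Sum>r<D. ev z (vec_index v r) * \<omega> r) =
          (\<Sum>r<D. ev z (vec_index v r) * (\<Sum>s<D. ev z (Hm $$ (r, s)) * \<omega> s))"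
        unfolding sum_distrib_left[of "ev z b ^ q * ev y f"]
      proof (intro sum.cong refl)
        fix r assume "r \<in> {..<D}"
        hence r: "r < D" by simp
        show "ev z b ^ q * ev y f * (ev z (vec_index v r) * \<omega> r) = ev z (vec_index v r) * (\<Sum>s<D. ev z (Hm $$ (r, s)) * \<omega> s)"
          unfolding row[OF r] by (simp add: mult_ac)
      qed
      also have "\<dots> = (\<Sum>s<D. \<Sum>r<D. ev z (vec_index v r) * (ev z (Hm $$ (r, s)) * \<omega> s))"
        unfolding sum_distrib_left by (rule sum.swap)
      also have "\<dots> = (\<Sum>s<D. (\<Sum>r<D. ev z (vec_index v r) * ev z (Hm $$ (r, s))) * \<omega> s)"
        by (simp only: sum_distrib_right mult.assoc)
      also have "\<dots> = 0" by (simp add: col)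
      finally have "ev z b ^ q * ev y f * (\<Sum>r<D. ev z (vec_index v r) * \<omega> r) = 0" .
      moreover have "ev z b \<noteq> 0" using z b0 unfolding transc_def by blast
      ultimately have "(\<Sum>r<D. ev z (vec_index v r) * \<omega> r) = 0" using fy by simp
      hence "\<forall>r<D. vec_index v r = 0" by (rule indep)
      hence "v = 0\<^sub>v D" using v(1) by (intro eq_vecI) auto
      thus False using v(2) by blast
    qed
    have dG: "degree G \<le> q * d0 * D"
      unfolding G_def
    proof (rule degree_det_le[OF _ Hm])
      fix r s assume rs: "r < D" "s < D"
      show "degree (Hm $$ (r, s)) \<le> q * d0"
        unfolding Hm_def
      proof (rule degree_hev_entry[OF MM _ d0[OF bS] _ rs])
        fix r s assume rs: "r < D" "s < D"
        have "degree (\<Sum>k=1..m. [:j k:] * N k r s) \<le> d0"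
        proof (rule degree_sum_le)
          fix k assume "k \<in> {1..m}"
          hence "degree (N k r s) \<le> d0" using d0 NS rs by blast
          thus "degree ([:j k:] * N k r s) \<le> d0" using degree_mult_le[of "[:j k:]" "N k r s"] by simp
        qed simp
        thus "degree (MM $$ (r, s)) \<le> d0" using rs by (simp add: MM_def)
      next
        show "degree (coeff (map_poly (\<lambda>c. [:c:]) f) k) = 0" for k by (simp add: coeff_map_poly)
      qed
    qed
    define nx where "nx = (\<lambda>a. max 1 (cmod a))"
    have nx: "nx a \<ge> 1" "cmod a \<le> nx a" for a by (simp_all add: nx_def)
    define K where "K = (\<lambda>a. (real m + 1) * B * (X * nx a))"
    have Xnx: "X * nx a \<ge> 1" "X \<le> X * nx a" "cmod a \<le> X * nx a" for a
    proof -
      have "1 * 1 \<le> X * nx a" using X nx(1)[of a] by (intro mult_mono) auto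
      thus "X * nx a \<ge> 1" by simp
      have "X * 1 \<le> X * nx a" using X nx(1)[of a] by (intro mult_left_mono) auto
      thus "X \<le> X * nx a" by simp
      have "1 * cmod a \<le> X * nx a" using X nx[of a] by (intro mult_mono) auto
      thus "cmod a \<le> X * nx a" by simp
    qed
    have K1: "K a \<ge> 1" for a
    proof -
      have "1 * 1 * 1 \<le> (real m + 1) * B * (X * nx a)" using B(1) Xnx(1)[of a] by (intro mult_mono) auto
      thus ?thesis by (simp add: K_def)
    qed
    have entry: "cmod (E a x $$ (r, s)) \<le> K a" if x: "cmod x \<le> R" and rs: "r < D" "s < D" for a x r s
    proof -
      have "Mx x $$ (r, s) = (\<Sum>k=1..m. of_int (j k) * ev x (N k r s))" using rs by (simp add: Mx_def)
      also have "cmod \<dots> \<le> (\<Sum>k=1..m. X * B)"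
      proof (rule sum_norm_le)
        fix k assume k: "k \<in> {1..m}"
        show "cmod (of_int (j k) * ev x (N k r s)) \<le> X * B"
          unfolding norm_mult using jX[OF k] B(2)[OF NS[OF k rs] x] X by (intro mult_mono) auto
      qed
      finally have "cmod (Mx x $$ (r, s)) \<le> (\<Sum>k=1..m. X * B)" .
      hence "cmod (Mx x $$ (r, s)) \<le> m * (X * B)" by simp
      also have "\<dots> \<le> m * (X * nx a * B)" using Xnx(2)[of a] B(1) by (intro mult_left_mono mult_right_mono) auto
      finally have 1: "cmod (Mx x $$ (r, s)) \<le> m * (X * nx a * B)" .
      have "cmod (- a * ev x b * (if r = s then 1 else 0)) \<le> cmod a * cmod (ev x b)" by (simp add: norm_mult)
      also have "\<dots> \<le> (X * nx a) * B" using Xnx[of a] B(1) B(2)[OF bS x] by (intro mult_mono) auto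
      finally have 2: "cmod (- a * ev x b * (if r = s then 1 else 0)) \<le> (X * nx a) * B" .
      have "E a x $$ (r, s) = Mx x $$ (r, s) + - a * ev x b * (if r = s then 1 else 0)"
        using rs Mx[of x] by (simp add: E_def)
      hence "cmod (E a x $$ (r, s)) \<le> cmod (Mx x $$ (r, s)) + cmod (- a * ev x b * (if r = s then 1 else 0))"
        by (metis norm_triangle_ineq)
      thus ?thesis using 1 2 by (simp add: K_def algebra_simps)
    qed
    have Kpow: "fact D * K a ^ D = A * (X * nx a) ^ D" for a
      by (simp add: K_def A_def power_mult_distrib mult_ac)
    have det1: "cmod (det (E a x)) \<le> C2 * (X * nx a) ^ Suc D" if x: "cmod x \<le> R" for a x
    proof -
      have "cmod (det (E a x)) \<le> fact D * K a ^ D" by (rule cmod_det_le[OF E]) (rule entry[OF x])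
      also have "\<dots> = A * (X * nx a) ^ D" by (rule Kpow)
      also have "\<dots> \<le> C2 * (X * nx a) ^ Suc D"
        using C2 A0 Xnx(1)[of a] by (intro mult_mono power_increasing) auto
      finally show ?thesis .
    qed
    \<comment> \<open>On the circle of radius \<rho> about \<open>z\<close> the image of \<omega> is
      a multiple of \<open>y - a\<close> up to an error of order \<rho>; this yields the additional
      factor \<open>max \<rho> |y - a|\<close>.\<close>
    have det2: "cmod (det (E a x)) \<le> C2 * (X * nx a) ^ Suc D * max \<rho> (cmod (y - a))"
      if x: "cmod (x - z) = \<rho>" and \<rho>: "0 < \<rho>" "\<rho> \<le> 1" for a x \<rho>
    proof -
      have xR: "cmod x \<le> R" using x \<rho> norm_triangle_sub[of x z] by (simp add: R_def)
      define \<mu> where "\<mu> = max \<rho> (cmod (y - a))"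
      have \<mu>: "\<mu> > 0" "\<rho> \<le> \<mu>" "cmod (y - a) \<le> \<mu>" using \<rho> by (auto simp: \<mu>_def)
      define e where "e = (real m + 2) * B * W * (X * nx a) * \<mu>"
      have e0: "e > 0" using B(1) W1 Xnx(1)[of a] \<mu>(1) by (simp add: e_def)
      have small: "cmod (vec_index (E a x *\<^sub>v \<Omega>) r) \<le> e" if r: "r < D" for r
      proof -
        have ent: "E a x $$ (r, s) * \<omega> s = Mx z $$ (r, s) * \<omega> s + ((Mx x $$ (r, s) - Mx z $$ (r, s)) * \<omega> s + (if s = r then - a * ev x b * \<omega> r else 0))" if "s < D" for s
          using r that Mx[of x] by (simp add: E_def algebra_simps)
        have "vec_index (E a x *\<^sub>v \<Omega>) r = (\<Sum>s<D. E a x $$ (r, s) * \<omega> s)" by (rule rowsum[OF E r])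
        also have "\<dots> = (\<Sum>s<D. Mx z $$ (r, s) * \<omega> s) + ((\<Sum>s<D. (Mx x $$ (r, s) - Mx z $$ (r, s)) * \<omega> s) + - a * ev x b * \<omega> r)"
          using r by (simp add: ent sum.distrib)
        also have "\<dots> = (\<Sum>s<D. (Mx x $$ (r, s) - Mx z $$ (r, s)) * \<omega> s) + (- a * (ev x b - ev z b) * \<omega> r + ev z b * (y - a) * \<omega> r)"
          unfolding eig[OF r] by (simp add: algebra_simps)
        finally have "cmod (vec_index (E a x *\<^sub>v \<Omega>) r) \<le> cmod (\<Sum>s<D. (Mx x $$ (r, s) - Mx z $$ (r, s)) * \<omega> s)
            + (cmod (- a * (ev x b - ev z b) * \<omega> r) + cmod (ev z b * (y - a) * \<omega> r))"
          by (metis (no_types, lifting) add_left_mono norm_triangle_ineq order_trans)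
        also have "cmod (\<Sum>s<D. (Mx x $$ (r, s) - Mx z $$ (r, s)) * \<omega> s) \<le> (\<Sum>s<D. m * (X * (B * \<mu>)) * cmod (\<omega> s))"
        proof (rule sum_norm_le)
          fix s assume "s \<in> {..<D}"
          hence s: "s < D" by simp
          have "Mx x $$ (r, s) - Mx z $$ (r, s) = (\<Sum>k=1..m. of_int (j k) * (ev x (N k r s) - ev z (N k r s)))"
            using r s by (simp add: Mx_def sum_subtractf algebra_simps)
          also have "cmod \<dots> \<le> (\<Sum>k=1..m. X * (B * \<mu>))"
          proof (rule sum_norm_le)
            fix k assume k: "k \<in> {1..m}"
            have "cmod (ev x (N k r s) - ev z (N k r s)) \<le> B * cmod (x - z)" by (rule B(3)[OF NS[OF k r s] xR])
            also have "\<dots> \<le> B * \<mu>" using x \<mu>(2) B(1) by (intro mult_left_mono) auto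
            finally show "cmod (of_int (j k) * (ev x (N k r s) - ev z (N k r s))) \<le> X * (B * \<mu>)"
              unfolding norm_mult using jX[OF k] X by (intro mult_mono) auto
          qed
          finally have "cmod (Mx x $$ (r, s) - Mx z $$ (r, s)) \<le> m * (X * (B * \<mu>))" by simp
          thus "cmod ((Mx x $$ (r, s) - Mx z $$ (r, s)) * \<omega> s) \<le> m * (X * (B * \<mu>)) * cmod (\<omega> s)"
            unfolding norm_mult by (intro mult_right_mono) auto
        qed
        also have "\<dots> = m * (X * (B * \<mu>)) * (W - 1)" by (simp add: W_def sum_distrib_left)
        also have "\<dots> \<le> m * ((X * nx a) * (B * \<mu>)) * W"
          using Xnx(2)[of a] B(1) \<mu>(1) W1 X by (intro mult_mono mult_nonneg_nonneg) auto
        also have "cmod (- a * (ev x b - ev z b) * \<omega> r) \<le> (X * nx a) * (B * \<mu>) * W"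
        proof -
          have "cmod (ev x b - ev z b) \<le> B * cmod (x - z)" by (rule B(3)[OF bS xR])
          also have "\<dots> \<le> B * \<mu>" using x \<mu>(2) B(1) by (intro mult_left_mono) auto
          finally show ?thesis unfolding norm_mult norm_minus_cancel
            using Xnx[of a] nx(1)[of a] X B(1) \<mu>(1) WW[OF r] by (intro mult_mono mult_nonneg_nonneg) auto
        qed
        also have "cmod (ev z b * (y - a) * \<omega> r) \<le> (X * nx a) * (B * \<mu>) * W"
        proof -
          have "cmod (ev z b) \<le> B" using B(2)[OF bS, of z] by (simp add: R_def)
          hence "cmod (ev z b * (y - a)) \<le> B * \<mu>" unfolding norm_mult using \<mu> B(1) by (intro mult_mono) auto
          also have "1 * (B * \<mu>) \<le> (X * nx a) * (B * \<mu>)" using Xnx(1)[of a] B(1) \<mu>(1) by (intro mult_right_mono) auto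
          finally have "cmod (ev z b * (y - a)) \<le> (X * nx a) * (B * \<mu>)" by simp
          moreover have "0 \<le> (X * nx a) * (B * \<mu>)" using nx(1)[of a] X B(1) \<mu>(1) by (intro mult_nonneg_nonneg) auto
          ultimately show ?thesis unfolding norm_mult[of _ "\<omega> r"] using WW[OF r] by (intro mult_mono) simp_all
        qed
        finally show ?thesis by (simp add: e_def algebra_simps)
      qed
      have "cmod (vec_index \<Omega> r0) * cmod (det (E a x)) \<le> fact D * K a ^ D * e"
        by (rule cmod_det_le_of_small_image[OF E entry[OF xR] K1 \<Omega> r0(1) e0 small])
      hence "cmod (\<omega> r0) * cmod (det (E a x)) \<le> A * (X * nx a) ^ D * e" using r0 unfolding Kpow by (simp add: \<Omega>_def)
      hence "cmod (det (E a x)) \<le> A * (X * nx a) ^ D * e / cmod (\<omega> r0)" using r0(2) by (simp add: field_simps)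
      also have "\<dots> = A * ((real m + 2) * B * W) / cmod (\<omega> r0) * ((X * nx a) ^ Suc D * \<mu>)"
        by (simp add: e_def)
      also have "\<dots> \<le> C2 * ((X * nx a) ^ Suc D * \<mu>)"
        using C2(3) Xnx(1)[of a] \<mu>(1) by (intro mult_right_mono) auto
      finally show ?thesis by (simp add: \<mu>_def mult.assoc)
    qed
    define h where "h = lmeas ?F"
    define sl where "sl = (\<Sum>a\<in>#proots ?F. ln (nx a))"
    have lcge: "cmod (lead_coeff ?F) \<ge> 1"
    proof -
      have "\<bar>lead_coeff f\<bar> \<ge> 1" using f0 by (simp add: int_one_le_iff_zero_less)
      hence "real_of_int \<bar>lead_coeff f\<bar> \<ge> 1" by linarith
      thus ?thesis by simp
    qed
    define lc where "lc = ln (cmod (lead_coeff ?F))"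
    have lc0: "lc \<ge> 0" using lcge by (simp add: lc_def)
    have sl0: "sl \<ge> 0" unfolding sl_def using nx(1) sum_mset_mono[of "proots ?F" "\<lambda>_. 0" "\<lambda>a. ln (nx a)"] by simp
    have h: "h = lc + sl" by (simp add: h_def lmeas_def lc_def sl_def nx_def)
    have lX: "ln X \<ge> ln 2" using X by (intro ln_mono) auto
    have lX0: "ln X > 0" using X by simp
    \<comment> \<open>\<mu> stands for the gain at each root: 1 when the height is bounded,
      \<open>max (exp (-l)) |y - a|\<close> when the proximity is.\<close>
    have supG: "cmod (ev x G) \<le> exp (D * lc + (q * (ln C2 + Suc D * ln X) + Suc D * sl + (\<Sum>a\<in>#proots ?F. ln (\<mu> a))))"
      if "\<And>a. \<mu> a > 0" "\<And>a. cmod (det (E a x)) \<le> C2 * (X * nx a) ^ Suc D * \<mu> a" for x \<mu>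
    proof -
      have "cmod (ev x G) = cmod (lead_coeff ?F) ^ D * (\<Prod>a\<in>#proots ?F. cmod (det (E a x)))"
        unfolding evG norm_mult norm_power norm_prod_mset by (simp add: image_mset.compositionality o_def)
      also have "cmod (lead_coeff ?F) ^ D = exp (D * lc)"
      proof -
        have "cmod (lead_coeff ?F) > 0" using lcge by linarith
        hence "exp lc = cmod (lead_coeff ?F)" unfolding lc_def by (rule exp_ln)
        thus ?thesis by (simp only: exp_of_nat_mult)
      qed
      also have "(\<Prod>a\<in>#proots ?F. cmod (det (E a x))) \<le> exp (\<Sum>a\<in>#proots ?F. ln C2 + Suc D * ln X + Suc D * ln (nx a) + ln (\<mu> a))"
      proof (rule conjunct1[OF prod_mset_le_exp], rule conjI)
        fix a
        have "X > 0" "nx a > 0" "C2 > 0" using X nx(1)[of a] C2(1) by linarith+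
        hence "C2 * (X * nx a) ^ Suc D * \<mu> a = exp (ln C2 + Suc D * ln X + Suc D * ln (nx a) + ln (\<mu> a))"
          using that(1)[of a] by (simp only: exp_add exp_of_nat_mult exp_ln power_mult_distrib mult.assoc)
        thus "cmod (det (E a x)) \<le> exp (ln C2 + Suc D * ln X + Suc D * ln (nx a) + ln (\<mu> a))" using that(2)[of a] by simp
      qed simp
      also have "(\<Sum>a\<in>#proots ?F. ln C2 + Suc D * ln X + Suc D * ln (nx a) + ln (\<mu> a)) =
          q * (ln C2 + Suc D * ln X) + Suc D * sl + (\<Sum>a\<in>#proots ?F. ln (\<mu> a))"
        by (simp only: sum_mset.distrib sum_mset_cmult sum_mset_constant size_proots_complex dF sl_def) (simp add: algebra_simps)
      finally show ?thesis by (simp add: exp_add)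
    qed
    have final: "real q * (c0 + (real D + 2) * ln X) + (real D + 2) * h \<le> C * (h + q * ln X)"
    proof -
      have "c0 * ln 2 \<le> c0 * ln X" using c00 lX by (intro mult_left_mono) auto
      hence "c0 \<le> c0 / ln 2 * ln X" by (simp add: field_simps)
      hence "c0 + (real D + 2) * ln X \<le> (c0 / ln 2 + (real D + 2)) * ln X" by (simp add: algebra_simps)
      also have "\<dots> \<le> C * ln X" using lX0 by (intro mult_right_mono) (auto simp: C_def)
      finally have "real q * (c0 + (real D + 2) * ln X) \<le> real q * (C * ln X)" by (rule mult_left_mono) simp
      moreover have "(real D + 2) * h \<le> C * h"
        using c00 h lc0 sl0 by (intro mult_right_mono) (auto simp: C_def)
      ultimately show ?thesis by (simp add: algebra_simps)
    qed
    have hG: "lmeas (of_int_poly G) \<le> C * (h + q * ln X)"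
    proof -
      have "lmeas (of_int_poly G) \<le> D * lc + (q * (ln C2 + Suc D * ln X) + Suc D * sl + (\<Sum>a\<in>#proots ?F. ln 1))"
      proof (rule lmeas_le_sup)
        show "of_int_poly G \<noteq> (0 :: complex poly)" using Geq0 by simp
        fix x :: complex assume "cmod x = 1"
        hence "cmod x \<le> R" by (simp add: R_def)
        thus "cmod (ev x G) \<le> exp (D * lc + (q * (ln C2 + Suc D * ln X) + Suc D * sl + (\<Sum>a\<in>#proots ?F. ln 1)))"
          using det1 by (intro supG) auto
      qed
      also have "\<dots> = D * lc + Suc D * sl + q * ln C2 + q * Suc D * ln X" by (simp add: algebra_simps)
      also have "\<dots> \<le> (real D + 2) * lc + (real D + 2) * sl + q * c0 + q * (real D + 2) * ln X"
      proof -
        have "real q * ln C2 \<le> real q * c0" using C3 by (intro mult_left_mono) (auto simp: c0_def)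
        moreover have "real q * real (Suc D) * ln X \<le> real q * (real D + 2) * ln X"
          using lX0 by (intro mult_right_mono mult_left_mono) auto
        moreover have "real D * lc \<le> (real D + 2) * lc" using lc0 by (intro mult_right_mono) auto
        moreover have "real (Suc D) * sl \<le> (real D + 2) * sl" using sl0 by (intro mult_right_mono) auto
        ultimately show ?thesis by (simp only: of_nat_mult)
      qed
      also have "\<dots> = real q * (c0 + (real D + 2) * ln X) + (real D + 2) * h" by (simp add: h algebra_simps)
      also note final
      finally show ?thesis .
    qed
    have pG: "prox l (of_int_poly G) z \<ge> prox l ?F y - C * (h + q * ln X)"
    proof -
      define \<mu> where "\<mu> = (\<lambda>a. max (exp (- l)) (cmod (y - a)))"
      have \<mu>0: "\<mu> a > 0" for a by (simp add: \<mu>_def less_max_iff_disj)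
      have yb: "max 1 (cmod y) \<le> C3 * X"
      proof -
        have "cmod y \<le> (\<Sum>k=1..m. X * cmod (\<xi> k))"
          unfolding y_def using jX by (intro sum_norm_le) (auto simp: norm_mult intro!: mult_right_mono)
        also have "\<dots> = X * (C3 - 1)" by (simp add: C3_def sum_distrib_left)
        also have "\<dots> \<le> X * C3" using X by simp
        finally have "cmod y \<le> C3 * X" by (simp add: mult.commute)
        moreover have "1 * 1 \<le> C3 * X" using C3 X by (intro mult_mono) auto
        ultimately show ?thesis by simp
      qed
      have ly: "ln (max 1 (cmod y)) \<le> ln C3 + ln X"
        using ln_mono[OF yb] C3 X by (simp add: ln_mult)
      have ln1: "ln (max 1 (cmod (y - a))) \<le> ln 2 + (ln C3 + ln X) + ln (nx a)" for a
      proof -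
        have "1 * 1 \<le> (C3 * X) * nx a" using yb nx(1)[of a] by (intro mult_mono) auto
        moreover have "cmod y * 1 \<le> (C3 * X) * nx a" using yb nx(1)[of a] by (intro mult_mono) auto
        moreover have "1 * cmod a \<le> (C3 * X) * nx a" using yb nx[of a] by (intro mult_mono) auto
        moreover have "cmod (y - a) \<le> cmod y + cmod a" by (rule norm_triangle_ineq4)
        ultimately have "max 1 (cmod (y - a)) \<le> 2 * ((C3 * X) * nx a)" by simp
        hence "ln (max 1 (cmod (y - a))) \<le> ln (2 * ((C3 * X) * nx a))" by (intro ln_mono) auto
        also have "\<dots> = ln 2 + (ln C3 + ln X) + ln (nx a)" using C3 X nx(1)[of a] by (simp add: ln_mult)
        finally show ?thesis .
      qed
      have "(\<Sum>a\<in>#proots ?F. ln (\<mu> a)) = (\<Sum>a\<in>#proots ?F. ln (max 1 (cmod (y - a)))) - prox l ?F y"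
        unfolding \<mu>_def ln_max_kap[OF l] prox_def by (simp add: sum_mset_minus)
      also have "(\<Sum>a\<in>#proots ?F. ln (max 1 (cmod (y - a)))) \<le> (\<Sum>a\<in>#proots ?F. ln 2 + (ln C3 + ln X) + ln (nx a))"
        by (rule sum_mset_mono) (rule ln1)
      also have "\<dots> = q * (ln 2 + (ln C3 + ln X)) + sl"
        by (simp only: sum_mset.distrib sum_mset_constant size_proots_complex dF sl_def) (simp add: algebra_simps)
      finally have s\<mu>: "(\<Sum>a\<in>#proots ?F. ln (\<mu> a)) \<le> q * (ln 2 + (ln C3 + ln X)) + sl - prox l ?F y" by simp
      have "prox l (of_int_poly G) z \<ge> - (D * lc + (q * (ln C2 + Suc D * ln X) + Suc D * sl + (\<Sum>a\<in>#proots ?F. ln (\<mu> a))))"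
      proof (rule prox_ge_of_sup[OF Geq0 l])
        fix x assume x: "cmod (x - z) = exp (- l)"
        have "cmod (ev x G) \<le> exp (D * lc + (q * (ln C2 + Suc D * ln X) + Suc D * sl + (\<Sum>a\<in>#proots ?F. ln (\<mu> a))))"
          by (rule supG[OF \<mu>0]) (unfold \<mu>_def, rule det2[OF x], use l in auto)
        thus "cmod (poly (of_int_poly G) x) \<le> exp (- (- (D * lc + (q * (ln C2 + Suc D * ln X) + Suc D * sl + (\<Sum>a\<in>#proots ?F. ln (\<mu> a))))))"
          by (simp only: minus_minus)
      qed
      moreover have "D * lc + (q * (ln C2 + Suc D * ln X) + Suc D * sl + (q * (ln 2 + (ln C3 + ln X)) + sl))
         \<le> real q * (c0 + (real D + 2) * ln X) + (real D + 2) * h"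
        using lc0 by (simp add: h c0_def algebra_simps)
      ultimately show ?thesis using s\<mu> final by linarith
    qed
    have "real (degree G) \<le> C * q"
    proof -
      have "real (degree G) \<le> real (d0 * D) * q" using dG by (metis mult.assoc mult.commute of_nat_le_iff of_nat_mult)
      also have "\<dots> \<le> C * q" using c00 by (intro mult_right_mono) (auto simp: C_def)
      finally show ?thesis .
    qed
    thus ?case using Geq0 hG pG unfolding h_def y_def q_def by blast
  qed
qed

subsection \<open>Asymptotics and small derivatives\<close>

lemma eventually_powr_le:
  fixes a b C :: real
  assumes "a < b"
  shows "\<forall>\<^sub>F n in sequentially. C * real n powr a * ln (real n) ^ 2 \<le> real n powr b"
proof -
  define d where "d = b - a"
  have d: "d > 0" using assms by (simp add: d_def)
  have "(\<lambda>n. ln (real n) ^ 2 * real n powr (- d)) \<longlonglongrightarrow> 0" using d by real_asymp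
  hence "(\<lambda>n. C * (ln (real n) ^ 2 * real n powr (- d))) \<longlonglongrightarrow> C * 0" by (intro tendsto_mult tendsto_const)
  hence "\<forall>\<^sub>F n in sequentially. C * (ln (real n) ^ 2 * real n powr (- d)) < 1"
    by (intro order_tendstoD) auto
  thus ?thesis using eventually_gt_at_top[of 0]
  proof eventually_elim
    case (elim n)
    have "C * real n powr a * ln (real n) ^ 2 = C * (ln (real n) ^ 2 * real n powr (- d)) * real n powr b"
      by (simp add: d_def powr_diff powr_minus field_simps elim(2))
    also have "\<dots> \<le> 1 * real n powr b" using elim by (intro mult_right_mono) auto
    finally show ?case by simp
  qed
qed

lemma eventually_powr_le':
  fixes a b C :: real
  assumes "a < b"
  shows "\<forall>\<^sub>F n in sequentially. C * real n powr a * ln (real n) \<le> real n powr b"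
    and "\<forall>\<^sub>F n in sequentially. C * real n powr a \<le> real n powr b"
proof -
  have "\<forall>\<^sub>F n in sequentially. \<bar>C\<bar> * real n powr a * ln (real n) ^ 2 \<le> real n powr b \<and> ln (real n) \<ge> 1"
  proof (rule eventually_conj)
    show "\<forall>\<^sub>F n in sequentially. 1 \<le> ln (real n)" by real_asymp
  qed (rule eventually_powr_le[OF assms])
  hence "\<forall>\<^sub>F n in sequentially. C * real n powr a * ln (real n) \<le> real n powr b \<and> C * real n powr a \<le> real n powr b"
  proof eventually_elim
    case (elim n)
    define L where "L = ln (real n)"
    define E where "E = \<bar>C\<bar> * real n powr a"
    have E: "E \<ge> 0" "C * real n powr a \<le> E" by (auto simp: E_def intro!: mult_right_mono)
    have L: "L \<ge> 1" using elim by (simp add: L_def)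
    have "L * 1 \<le> L * L" using L by (intro mult_left_mono) auto
    hence "L \<le> L ^ 2" by (simp add: power2_eq_square)
    moreover from this have "1 \<le> L ^ 2" using L by linarith
    ultimately have "E * L \<le> E * L ^ 2" "E * 1 \<le> E * L ^ 2" using E by (auto intro!: mult_left_mono simp del: mult_1_right)
    moreover have "C * real n powr a * L \<le> E * L" using E L by (intro mult_right_mono) auto
    moreover have "E * L ^ 2 \<le> real n powr b" using elim by (simp add: E_def L_def)
    ultimately show ?case using E unfolding L_def[symmetric] by linarith
  qed
  thus "\<forall>\<^sub>F n in sequentially. C * real n powr a * ln (real n) \<le> real n powr b"
    "\<forall>\<^sub>F n in sequentially. C * real n powr a \<le> real n powr b"
    by (auto elim: eventually_mono)
qed

section \<open>Small derivatives and the reduction to primitive polynomials\<close>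

lemma coeff_pcompose_shift:
  fixes P :: "complex poly"
  shows "coeff (pcompose P [:x, 1:]) j = poly (divided_deriv j P) x"
proof -
  have "(pderiv ^^ j) (pcompose P [:x, 1:]) = pcompose ((pderiv ^^ j) P) [:x, 1:]"
    by (induction j) (simp_all add: pderiv_pcompose pderiv_pCons)
  moreover have "coeff (pcompose P [:x, 1:]) j = coeff ((pderiv ^^ j) (pcompose P [:x, 1:])) 0 / fact j"
    by (simp add: coeff_higher_pderiv pochhammer_fact[symmetric])
  ultimately show ?thesis
    by (simp add: divided_deriv_def poly_0_coeff_0[symmetric] poly_pcompose field_simps)
qed

lemma taylor_divided_deriv:
  fixes P :: "complex poly"
  assumes "degree P \<le> n"
  shows "poly P z = (\<Sum>j\<le>n. poly (divided_deriv j P) x * (z - x) ^ j)"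
proof -
  have "poly P z = poly (pcompose P [:x, 1:]) (z - x)" by (simp add: poly_pcompose)
  also have "\<dots> = (\<Sum>j\<le>degree P. coeff (pcompose P [:x, 1:]) j * (z - x) ^ j)"
    by (simp add: poly_altdef degree_pcompose)
  also have "\<dots> = (\<Sum>j\<le>n. coeff (pcompose P [:x, 1:]) j * (z - x) ^ j)"
    using assms by (intro sum.mono_neutral_left) (auto simp: coeff_eq_0 degree_pcompose)
  finally show ?thesis by (simp only: coeff_pcompose_shift)
qed

lemma cmod_divided_deriv_le:
  fixes P :: "complex poly"
  assumes P: "degree P \<le> n" "\<And>i. cmod (coeff P i) \<le> H" and r: "cmod x \<le> r" "r \<ge> 1" and H: "H \<ge> 0"
  shows "cmod (poly (divided_deriv j P) x) \<le> (real n + 1) * H * (2 * r) ^ n"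
proof -
  have c: "coeff (divided_deriv j P) i = of_nat ((i + j) choose j) * coeff P (i + j)" for i
  proof -
    have "pochhammer (of_nat (Suc i)) j / fact j = (of_nat ((i + j) choose j) :: complex)"
      using gbinomial_pochhammer'[of "of_nat (i + j) :: complex" j]
      by (simp add: binomial_gbinomial add.commute)
    thus ?thesis by (simp add: divided_deriv_def coeff_higher_pderiv field_simps)
  qed
  have b: "cmod (coeff (divided_deriv j P) i * x ^ i) \<le> H * (2 * r) ^ n" for i
  proof (cases "i + j \<le> n")
    case True
    have "real ((i + j) choose j) \<le> 2 ^ (i + j)" using binomial_le_pow2[of "i + j" j] by (metis of_nat_le_iff of_nat_numeral of_nat_power)
    also have "\<dots> \<le> 2 ^ n" using True by (intro power_increasing) auto
    finally have 1: "real ((i + j) choose j) \<le> 2 ^ n" .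
    have "cmod x ^ i \<le> r ^ i" using r by (intro power_mono) auto
    also have "\<dots> \<le> r ^ n" using r True by (intro power_increasing) auto
    finally have 2: "cmod x ^ i \<le> r ^ n" .
    have "cmod (coeff (divided_deriv j P) i * x ^ i) = real ((i + j) choose j) * cmod (coeff P (i + j)) * cmod x ^ i"
      by (simp add: c norm_mult norm_power)
    also have "\<dots> \<le> 2 ^ n * H * r ^ n" using 1 2 P(2)[of "i + j"] H by (intro mult_mono) auto
    finally show ?thesis by (simp add: power_mult_distrib mult_ac)
  next
    case False
    thus ?thesis using P(1) H r by (simp add: c coeff_eq_0)
  qed
  have "poly (divided_deriv j P) x = (\<Sum>i\<le>n. coeff (divided_deriv j P) i * x ^ i)"
    unfolding poly_altdef
  proof (rule sum.mono_neutral_left)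
    show "{..degree (divided_deriv j P)} \<subseteq> {..n}"
      using degree_le[of n "divided_deriv j P"] P(1) by (auto simp: c coeff_eq_0)
  qed (auto simp: coeff_eq_0)
  also have "cmod \<dots> \<le> (\<Sum>i\<le>n. H * (2 * r) ^ n)" by (rule sum_norm_le) (rule b)
  finally show ?thesis by (simp add: algebra_simps)
qed

text \<open>Taylor expansion on the circle of radius \<open>exp (-l)\<close>: the terms with
  \<open>j < T\<close> are small by hypothesis, the others because
  \<open>exp (-l j) \<le> exp (-l T)\<close>. The exponent \<open>l * T\<close> in the hypothesis
  makes both bounds equal.\<close>

lemma prox_ge_of_small_derivs:
  fixes P :: "int poly"
  assumes P: "P \<noteq> 0" "degree P \<le> n" "\<And>i. \<bar>real_of_int (coeff P i)\<bar> \<le> H" and r: "cmod x \<le> r" "r \<ge> 1"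
    and l: "l \<ge> 0" and T: "T \<ge> 0" and small: "\<And>j. real j < T \<Longrightarrow> cmod (poly (divided_deriv j (of_int_poly P)) x) \<le> exp (- (l * T))"
  shows "prox l (of_int_poly P) x \<ge> l * T - ln ((real n + 1) ^ 2 * H * (2 * r) ^ n)"
proof (rule prox_ge_of_sup[OF P(1) l])
  let ?P = "of_int_poly P :: complex poly"
  have H1: "H \<ge> 1"
  proof -
    have "\<bar>lead_coeff P\<bar> \<ge> 1" using P(1) by (simp add: int_one_le_iff_zero_less)
    hence "\<bar>real_of_int (lead_coeff P)\<bar> \<ge> 1" by linarith
    thus ?thesis using P(3)[of "degree P"] by linarith
  qed
  define V where "V = (real n + 1) * H * (2 * r) ^ n"
  have V1: "V \<ge> 1"
  proof -
    have "1 * 1 * 1 \<le> (real n + 1) * H * (2 * r) ^ n" using H1 r(2) by (intro mult_mono one_le_power) auto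
    thus ?thesis by (simp add: V_def)
  qed
  fix z assume z: "cmod (z - x) = exp (- l)"
  have z1: "cmod (z - x) \<le> 1" using z l by simp
  have bnd: "cmod (poly (divided_deriv j ?P) x * (z - x) ^ j) \<le> V * exp (- (l * T))" for j
  proof (cases "real j < T")
    case True
    have "cmod (poly (divided_deriv j ?P) x) * cmod (z - x) ^ j \<le> exp (- (l * T)) * 1"
      using small[OF True] z1 by (intro mult_mono power_le_one) auto
    also have "\<dots> \<le> V * exp (- (l * T))" using V1 by simp
    finally show ?thesis by (simp add: norm_mult norm_power)
  next
    case False
    have "cmod (z - x) ^ j = exp (- (l * j))" unfolding z by (simp add: exp_of_nat_mult[symmetric] mult.commute)
    also have "\<dots> \<le> exp (- (l * T))" using False l by (simp add: mult_left_mono)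
    finally have "cmod (z - x) ^ j \<le> exp (- (l * T))" .
    moreover have "cmod (poly (divided_deriv j ?P) x) \<le> V" unfolding V_def
      using P r H1 by (intro cmod_divided_deriv_le) auto
    ultimately show ?thesis unfolding norm_mult norm_power using V1 by (intro mult_mono) auto
  qed
  have "poly ?P z = (\<Sum>j\<le>n. poly (divided_deriv j ?P) x * (z - x) ^ j)"
    using P(2) by (intro taylor_divided_deriv) simp
  also have "cmod \<dots> \<le> (\<Sum>j\<le>n. V * exp (- (l * T)))" by (rule sum_norm_le) (rule bnd)
  also have "\<dots> = (real n + 1) * V * exp (- (l * T))" by simp
  also have "(real n + 1) * V = exp (ln ((real n + 1) ^ 2 * H * (2 * r) ^ n))"
    using H1 r(2) by (simp add: V_def power2_eq_square mult_ac)
  finally show "cmod (poly ?P z) \<le> exp (- (l * T - ln ((real n + 1) ^ 2 * H * (2 * r) ^ n)))"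
    by (simp add: exp_add[symmetric])
qed

lemma lmeas_le_of_coeffs:
  fixes P :: "int poly"
  assumes P: "P \<noteq> 0" "degree P \<le> n" "\<And>i. \<bar>real_of_int (coeff P i)\<bar> \<le> exp B"
  shows "lmeas (of_int_poly P) \<le> ln (real n + 1) + B"
proof (rule lmeas_le_sup)
  fix z :: complex assume z: "cmod z = 1"
  have "poly (of_int_poly P) z = (\<Sum>i\<le>degree P. of_int (coeff P i) * z ^ i)" by (simp add: poly_altdef)
  also have "cmod \<dots> \<le> (\<Sum>i\<le>degree P. exp B)"
    by (rule sum_norm_le) (use P(3) z in \<open>simp add: norm_mult norm_power\<close>)
  also have "\<dots> \<le> (real n + 1) * exp B" using P(2) by simp
  also have "\<dots> = exp (ln (real n + 1) + B)" by (simp add: exp_add)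
  finally show "cmod (poly (of_int_poly P) z) \<le> exp (ln (real n + 1) + B)" .
qed (use P in simp)

text \<open>\<open>poly_height\<close> ignores the content, so it bounds only the coefficients of
  the primitive part; dividing by the content makes the derivatives no larger.\<close>

lemma primitive_part_reduction:
  fixes P :: "int poly"
  assumes P: "P \<noteq> 0"
  shows "primitive_part P \<noteq> 0" "degree (primitive_part P) = degree P"
    "\<bar>real_of_int (coeff (primitive_part P) i)\<bar> \<le> real_of_rat (poly_height (rat_poly P))"
    "cmod (poly (divided_deriv j (of_int_poly (primitive_part P))) x) \<le> cmod (poly (divided_deriv j (of_int_poly P)) x)"
proof -
  have c: "content P > 0" using P
    by (metis normalize_content normalize_int_def content_eq_zero_iff zero_less_abs_iff)
  have cf: "coeff P i = content P * coeff (primitive_part P) i" for i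
    by (metis coeff_smult content_times_primitive_part)
  show "primitive_part P \<noteq> 0" using P by simp
  show "degree (primitive_part P) = degree P" by simp
  have ph: "poly_height (rat_poly P) = poly_norm (rat_poly P) / of_int (content P)"
    by (simp add: poly_height_def poly_cont_rat_poly[OF P])
  have le: "\<bar>rat_of_int (coeff P i)\<bar> \<le> poly_norm (rat_poly P)"
  proof (cases "i \<le> degree P")
    case True
    thus ?thesis unfolding poly_norm_def by (intro Max_ge) (auto simp: coeff_map_poly)
  next
    case False
    have "\<bar>coeff (rat_poly P) 0\<bar> \<le> poly_norm (rat_poly P)" unfolding poly_norm_def by (intro Max_ge) auto
    hence "0 \<le> poly_norm (rat_poly P)" using abs_ge_zero order_trans by blast
    thus ?thesis using False by (simp add: coeff_eq_0)
  qed
  have "\<bar>rat_of_int (coeff P i)\<bar> = of_int (content P) * \<bar>of_int (coeff (primitive_part P) i)\<bar>"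
    using c by (subst cf) (simp add: abs_mult)
  hence "\<bar>rat_of_int (coeff (primitive_part P) i)\<bar> \<le> poly_height (rat_poly P)"
    using le c unfolding ph by (simp add: field_simps)
  hence "real_of_rat \<bar>rat_of_int (coeff (primitive_part P) i)\<bar> \<le> real_of_rat (poly_height (rat_poly P))"
    by (simp only: of_rat_less_eq)
  moreover have "real_of_rat \<bar>rat_of_int (coeff (primitive_part P) i)\<bar> = \<bar>real_of_int (coeff (primitive_part P) i)\<bar>"
    by (cases "coeff (primitive_part P) i \<ge> 0") (simp_all add: of_rat_minus)
  ultimately show "\<bar>real_of_int (coeff (primitive_part P) i)\<bar> \<le> real_of_rat (poly_height (rat_poly P))" by simp
  have "(of_int_poly P :: complex poly) = Polynomial.smult (of_int (content P)) (of_int_poly (primitive_part P))"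
    by (rule poly_eqI) (simp add: coeff_map_poly cf[of _])
  hence "divided_deriv j (of_int_poly P :: complex poly) = Polynomial.smult (of_int (content P)) (divided_deriv j (of_int_poly (primitive_part P)))"
    by (simp add: divided_deriv_def higher_pderiv_smult smult_smult mult.commute)
  hence "cmod (poly (divided_deriv j (of_int_poly P)) x) = real_of_int (content P) * cmod (poly (divided_deriv j (of_int_poly (primitive_part P))) x)"
    using c by (simp add: norm_mult)
  moreover have "1 * cmod (poly (divided_deriv j (of_int_poly (primitive_part P))) x) \<le> real_of_int (content P) * cmod (poly (divided_deriv j (of_int_poly (primitive_part P))) x)"
    using c by (intro mult_right_mono) auto
  ultimately show "cmod (poly (divided_deriv j (of_int_poly (primitive_part P))) x) \<le> cmod (poly (divided_deriv j (of_int_poly P)) x)"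
    by simp
qed

text \<open>At most one point lies within \<open>exp (-t)\<close> of \<open>z\<close>. It costs at
  most \<open>l\<close>, each of the others at most \<open>t\<close>.\<close>

lemma sum_kap_spaced:
  fixes l t :: real
  assumes Y: "finite Y" and l: "l \<ge> 0" and t: "t \<ge> 0"
    and sp: "\<And>y y'. y \<in> Y \<Longrightarrow> y' \<in> Y \<Longrightarrow> y \<noteq> y' \<Longrightarrow> cmod (y - y') \<ge> 2 * exp (- t)"
  shows "(\<Sum>y\<in>Y. kap l z y) \<le> l + card Y * t"
proof (cases "\<exists>y0\<in>Y. cmod (y0 - z) < exp (- t)")
  case True
  then obtain y0 where y0: "y0 \<in> Y" "cmod (y0 - z) < exp (- t)" by blast
  have "kap l z y \<le> t" if "y \<in> Y - {y0}" for y
  proof (rule kap_le_ln[OF _ t])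
    have "2 * exp (- t) \<le> cmod (y - y0)" using that y0 by (intro sp) auto
    also have "\<dots> \<le> cmod (y - z) + cmod (y0 - z)" by (metis norm_minus_commute norm_triangle_ineq diff_add_cancel add_diff_eq)
    finally show "exp (- t) \<le> cmod (y - z)" using y0 by linarith
  qed
  hence "(\<Sum>y\<in>Y - {y0}. kap l z y) \<le> (\<Sum>y\<in>Y - {y0}. t)" by (rule sum_mono)
  also have "\<dots> \<le> (\<Sum>y\<in>Y. t)" using Y t by (intro sum_mono2) auto
  finally have "(\<Sum>y\<in>Y - {y0}. kap l z y) \<le> card Y * t" by simp
  moreover have "(\<Sum>y\<in>Y. kap l z y) = kap l z y0 + (\<Sum>y\<in>Y - {y0}. kap l z y)"
    using Y y0(1) by (rule sum.remove)
  ultimately show ?thesis using kap_le[of l z y0] by linarith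
next
  case False
  hence "(\<Sum>y\<in>Y. kap l z y) \<le> (\<Sum>y\<in>Y. t)" using t by (intro sum_mono kap_le_ln) (auto simp: not_less)
  thus ?thesis using l by simp
qed

text \<open>For distinct primes the product of the lower bounds would exceed the bound from the
  resultant, in which only the products of two degrees and of a degree with a height occur. The
  inequalities \<open>big\<close> compare the coefficients of these three products.\<close>

lemma gelfond_pair:
  fixes l A B A' B' :: real
  assumes g: "prime g" "prime g'" and l: "l \<ge> 0"
    and p: "prox l (crp g) x \<ge> A * degree g + B * height g"
    and p': "prox l (crp g') x \<ge> A' * degree g' + B' * height g'"
    and pos: "A \<ge> 0" "B \<ge> 0" "A' \<ge> 0" "B' \<ge> 0"
    and big: "4 * l < A * A'" "4 * l < A * B'" "4 * l < B * A'"
  shows "g = g'"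
proof (rule ccontr)
  assume ne: "g \<noteq> g'"
  define d d' h h' where "d = real (degree g)" and "d' = real (degree g')" and "h = height g" and "h' = height g'"
  have dd: "d \<ge> 1" "d' \<ge> 1" using prime_poly_monic(2)[OF g(1)] prime_poly_monic(2)[OF g(2)] by (auto simp: d_def d'_def)
  have hh: "h \<ge> 0" "h' \<ge> 0" using prime_poly_monic(3)[OF g(1)] prime_poly_monic(3)[OF g(2)]
    by (auto simp: h_def h'_def height_nonneg)
  have "(A * d + B * h) * (A' * d' + B' * h') \<le> prox l (crp g) x * prox l (crp g') x"
    using p p' pos dd hh prox_nonneg[OF l] unfolding d_def d'_def h_def h'_def
    by (intro mult_mono) auto
  also have "\<dots> \<le> 2 * l * (degree g' * height g + degree g * height g' + 2 * degree g * degree g' * ln 2)"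
    by (rule distinct_primes_close[OF g ne l])
  also have "\<dots> = 2 * l * (d' * h + d * h' + 2 * (d * d') * ln 2)" by (simp add: d_def d'_def h_def h'_def)
  also have "\<dots> \<le> 2 * l * (2 * (d' * h) + 2 * (d * h') + 2 * (d * d') * 1)"
    using l dd hh ln_2_less_1 by (intro mult_left_mono add_mono mult_left_mono) auto
  also have "\<dots> = 4 * l * (h * d') + 4 * l * (d * h') + 4 * l * (d * d')" by (simp add: algebra_simps)
  also have "\<dots> < (B * A') * (h * d') + (A * B') * (d * h') + (A * A') * (d * d')"
    using big dd hh by (intro add_le_less_mono add_mono mult_right_mono mult_strict_right_mono) auto
  also have "\<dots> \<le> (A * d + B * h) * (A' * d' + B' * h')"
    using pos hh by (simp add: algebra_simps)
  finally show False by simp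
qed

subsection \<open>Grid points\<close>

lemma is_subfield_of_nat:
  assumes "is_subfield L"
  shows "of_nat n \<in> L"
proof (induction n)
  case (Suc n)
  have "0 - (1::complex) \<in> L" using assms unfolding is_subfield_def by blast
  hence "of_nat n - (0 - 1) \<in> L" using Suc assms unfolding is_subfield_def by blast
  thus ?case by (simp add: add.commute)
qed (use assms in \<open>simp add: is_subfield_def\<close>)

lemma not_transc_diff_divide:
  assumes "\<not> transc x" "\<not> transc y" "d > 0"
  shows "\<not> transc ((x - y) / of_nat d)"
proof -
  define f where "f = (\<lambda>k::nat. if k = 0 then x else y)"
  have "(x - y) / of_nat d \<in> L" if L: "is_subfield L" "f ` {0, 1} \<subseteq> L" for L
  proof -
    have "x \<in> L" "y \<in> L" using L(2) by (auto simp: f_def)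
    moreover have "inverse (of_nat d) \<in> L" using is_subfield_of_nat[OF L(1)] L(1) unfolding is_subfield_def by blast
    ultimately show ?thesis using L(1) unfolding is_subfield_def divide_inverse by blast
  qed
  hence "(x - y) / of_nat d \<in> generated_field (f ` {0, 1})"
    unfolding generated_field_def hull_def by blast
  hence "algebraic_over (range (of_rat :: rat \<Rightarrow> complex)) ((x - y) / of_nat d)"
    by (rule rat_embedding.generated_field_algebraic[rotated 2])
       (use assms not_transc_imp_algebraic_over in \<open>auto simp: f_def\<close>)
  thus ?thesis by (rule algebraic_over_imp_not_transc)
qed

text \<open>\<open>k0\<close> marks a transcendental generator; exceptional grid points are counted
  along lines in its direction.\<close>

locale curve_points =
  fixes m :: nat and \<xi> :: "nat \<Rightarrow> complex" and \<theta> :: complex and k0 :: nat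
  assumes th: "transc \<theta>"
    and alg: "\<And>k. k \<in> {1..m} \<Longrightarrow> algebraic_over (generated_field {\<theta>}) (\<xi> k)"
    and k0: "k0 \<in> {1..m}" "transc (\<xi> k0)"
    and indep: "\<And>j :: nat \<Rightarrow> int. (\<Sum>k=1..m. of_int (j k) * \<xi> k) = 0 \<Longrightarrow> \<forall>k\<in>{1..m}. j k = 0"
begin

definition lin :: "(nat \<Rightarrow> int) \<Rightarrow> complex" where
  "lin j = (\<Sum>k=1..m. of_int (j k) * \<xi> k)"

definition pt :: "(nat \<Rightarrow> nat) \<Rightarrow> complex" where
  "pt i = (\<Sum>k=1..m. of_nat (i k) * \<xi> k)"

lemma pt_lin: "pt i = lin (\<lambda>k. int (i k))"
  by (simp add: pt_def lin_def)

lemma pt_diff: "pt i - pt i' = lin (\<lambda>k. int (i k) - int (i' k))"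
  by (simp add: pt_def lin_def sum_subtractf[symmetric] algebra_simps)

lemma pt_mult: "of_nat a * pt i = pt (\<lambda>k. a * i k)"
  by (simp add: pt_def sum_distrib_left mult.assoc)

lemma xi_k0_nonzero: "\<xi> k0 \<noteq> 0"
proof
  assume "\<xi> k0 = 0"
  hence "ev (\<xi> k0) [:0, 1:] = 0" by simp
  thus False using k0(2) unfolding transc_def by (metis pCons_eq_0_iff zero_neq_one)
qed

definition grid :: "nat \<Rightarrow> (nat \<Rightarrow> nat) set" where
  "grid B = PiE {1..m} (\<lambda>_. {0..B})"

text \<open>Away from 0, powers of \<open>T\<close> can be split off at little cost; at a
  transcendental point no non-zero polynomial vanishes, as the norm requires.\<close>

definition good :: "nat \<Rightarrow> (nat \<Rightarrow> nat) set" where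
  "good B = {i \<in> grid B. cmod (pt i) \<ge> cmod (\<xi> k0) / 2 \<and> transc (pt i)}"

lemma finite_grid: "finite (grid B)"
  unfolding grid_def by (intro finite_PiE) auto

lemma card_grid: "card (grid B) = (B + 1) ^ m"
  unfolding grid_def by (subst card_PiE) auto

lemma inj_on_pt: "inj_on pt (grid B)"
proof (rule inj_onI)
  fix i i' assume i: "i \<in> grid B" "i' \<in> grid B" "pt i = pt i'"
  hence "lin (\<lambda>k. int (i k) - int (i' k)) = 0" using pt_diff[of i i'] by simp
  hence "\<forall>k\<in>{1..m}. int (i k) - int (i' k) = 0" unfolding lin_def by (rule indep)
  thus "i = i'" using i unfolding grid_def by (intro PiE_ext) auto
qed

lemma grid_diff_line:
  assumes i: "i \<in> grid B" "i' \<in> grid B" "restrict i ({1..m} - {k0}) = restrict i' ({1..m} - {k0})"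
  shows "pt i - pt i' = (of_nat (i k0) - of_nat (i' k0)) * \<xi> k0"
    and "i k0 = i' k0 \<Longrightarrow> i = i'"
proof -
  have eq: "i k = i' k" if "k \<in> {1..m} - {k0}" for k
    using fun_cong[OF i(3), of k] that by simp
  have "pt i - pt i' = (\<Sum>k=1..m. (of_nat (i k) - of_nat (i' k)) * \<xi> k)"
    by (simp add: pt_def sum_subtractf[symmetric] algebra_simps)
  also have "\<dots> = (\<Sum>k\<in>{k0}. (of_nat (i k) - of_nat (i' k)) * \<xi> k)"
    by (rule sum.mono_neutral_right) (use k0 eq in auto)
  finally show "pt i - pt i' = (of_nat (i k0) - of_nat (i' k0)) * \<xi> k0" by simp
  assume "i k0 = i' k0"
  hence "i k = i' k" if "k \<in> {1..m}" for k using eq[of k] that by (cases "k = k0") auto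
  thus "i = i'" using i unfolding grid_def by (intro PiE_ext) auto
qed

text \<open>Forgetting the coordinate \<open>k0\<close> is injective on \<open>X\<close> when no
  line in this direction meets \<open>X\<close> twice.\<close>

lemma card_line_le:
  assumes X: "X \<subseteq> grid B"
    and line: "\<And>i i'. i \<in> X \<Longrightarrow> i' \<in> X \<Longrightarrow> i k0 > i' k0 \<Longrightarrow> pt i - pt i' = of_nat (i k0 - i' k0) * \<xi> k0 \<Longrightarrow> False"
  shows "card X \<le> (B + 1) ^ (m - 1)"
proof -
  let ?I = "{1..m} - {k0}"
  have "inj_on (\<lambda>i. restrict i ?I) X"
  proof (rule inj_onI)
    fix i i' assume i: "i \<in> X" "i' \<in> X" "restrict i ?I = restrict i' ?I"
    have b: "i \<in> grid B" "i' \<in> grid B" using i X by auto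
    consider "i k0 = i' k0" | "i k0 > i' k0" | "i' k0 > i k0" by linarith
    thus "i = i'"
    proof cases
      case 1
      thus ?thesis using grid_diff_line(2)[OF b i(3)] by blast
    next
      case 2
      thus ?thesis using line[OF i(1,2) 2] grid_diff_line(1)[OF b i(3)] by (simp add: of_nat_diff)
    next
      case 3
      thus ?thesis using line[OF i(2,1) 3] grid_diff_line(1)[OF b(2,1) i(3)[symmetric]] by (simp add: of_nat_diff)
    qed
  qed
  moreover have "(\<lambda>i. restrict i ?I) ` X \<subseteq> PiE ?I (\<lambda>_. {0..B})"
  proof (rule image_subsetI)
    fix i assume "i \<in> X"
    hence "i \<in> grid B" using X by blast
    hence "i k \<in> {0..B}" if "k \<in> {1..m}" for k using that by (auto simp: grid_def PiE_iff)
    thus "restrict i ?I \<in> PiE ?I (\<lambda>_. {0..B})" by (simp add: PiE_iff)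
  qed
  ultimately have "card X \<le> card (PiE ?I (\<lambda>_. {0..B}))"
    by (intro card_inj_on_le) (auto intro: finite_PiE)
  also have "\<dots> = (B + 1) ^ (m - 1)" using k0 by (subst card_PiE) auto
  finally show ?thesis .
qed

text \<open>On such a line two points of modulus below \<open>|\<xi> k0| / 2\<close> would be closer
  than one step, and two algebraic points would make \<open>\<xi> k0\<close> algebraic; so each kind
  occurs at most once.\<close>

lemma card_good:
  shows "(B + 1) ^ m \<le> card (good B) + 2 * (B + 1) ^ (m - 1)"
proof -
  define X1 where "X1 = {i \<in> grid B. cmod (pt i) < cmod (\<xi> k0) / 2}"
  define X2 where "X2 = {i \<in> grid B. \<not> transc (pt i)}"
  have eq: "grid B = good B \<union> (X1 \<union> X2)" by (auto simp: good_def X1_def X2_def)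
  have "card (grid B) \<le> card (good B) + (card X1 + card X2)"
    unfolding eq using card_Un_le[of "good B" "X1 \<union> X2"] card_Un_le[of X1 X2] by linarith
  moreover have "card X1 \<le> (B + 1) ^ (m - 1)"
  proof (rule card_line_le)
    fix i i' assume i: "i \<in> X1" "i' \<in> X1" "i k0 > i' k0" "pt i - pt i' = of_nat (i k0 - i' k0) * \<xi> k0"
    have "cmod (pt i - pt i') \<le> cmod (pt i) + cmod (pt i')" by (rule norm_triangle_ineq4)
    also have "\<dots> < cmod (\<xi> k0)" using i by (simp add: X1_def)
    finally have "real (i k0 - i' k0) * cmod (\<xi> k0) < cmod (\<xi> k0)" unfolding i(4) by (simp add: norm_mult)
    moreover have "1 * cmod (\<xi> k0) \<le> real (i k0 - i' k0) * cmod (\<xi> k0)" using i(3) by (intro mult_right_mono) auto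
    ultimately show False by simp
  qed (auto simp: X1_def)
  moreover have "card X2 \<le> (B + 1) ^ (m - 1)"
  proof (rule card_line_le)
    fix i i' assume i: "i \<in> X2" "i' \<in> X2" "i k0 > i' k0" "pt i - pt i' = of_nat (i k0 - i' k0) * \<xi> k0"
    have d: "i k0 - i' k0 > 0" using i(3) by simp
    have "\<not> transc ((pt i - pt i') / of_nat (i k0 - i' k0))"
      using i d by (intro not_transc_diff_divide) (auto simp: X2_def)
    moreover have "(pt i - pt i') / of_nat (i k0 - i' k0) = \<xi> k0" unfolding i(4) using d by simp
    ultimately show False using k0 by simp
  qed (auto simp: X2_def)
  ultimately show ?thesis unfolding card_grid by linarith
qed

lemma good_nonempty:
  assumes "B \<ge> 1"
  shows "card (good B) \<ge> 1"
proof -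
  \<comment> \<open>The grid point with value \<open>\<xi> k0\<close>; outside \<open>{1..m}\<close>
    the value is \<open>undefined\<close>, as membership in \<open>PiE\<close> demands.\<close>
  define i where "i = (\<lambda>k. if k \<in> {1..m} then (if k = k0 then 1 else 0) else undefined :: nat)"
  have "pt i = (\<Sum>k\<in>{k0}. of_nat (i k) * \<xi> k)"
    unfolding pt_def by (rule sum.mono_neutral_right) (use k0 in \<open>auto simp: i_def\<close>)
  hence "pt i = \<xi> k0" using k0 by (simp add: i_def)
  hence "i \<in> good B" using k0 assms by (auto simp: good_def grid_def i_def PiE_iff extensional_def)
  moreover have "finite (good B)" using finite_grid by (simp add: good_def)
  ultimately show ?thesis by (metis One_nat_def Suc_leI card_gt_0_iff empty_iff)
qed

lemma card_good_half:
  assumes "B \<ge> 3"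
  shows "real ((B + 1) ^ m) / 2 \<le> card (good B)"
proof -
  have m: "m \<ge> 1" using k0 by simp
  have "4 * (B + 1) ^ (m - 1) \<le> (B + 1) * (B + 1) ^ (m - 1)" using assms by (intro mult_right_mono) auto
  also have "\<dots> = (B + 1) ^ m" using m by (cases m) auto
  finally have "2 * (2 * (B + 1) ^ (m - 1)) \<le> (B + 1) ^ m" by simp
  hence "(B + 1) ^ m \<le> 2 * card (good B)" using card_good[of B] by linarith
  hence "real ((B + 1) ^ m) \<le> real (2 * card (good B))" by (simp only: of_nat_le_iff)
  thus ?thesis by simp
qed

end

text \<open>\<open>count\<close> makes the bad points of \<open>card_bad_points\<close> fewer than
  all points, so at some point the common divisor \<open>Q\<close> retains half of the
  proximity.\<close>

lemma exists_good_point: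
  fixes P :: "rat poly" and l L N :: real and A n :: nat
  assumes P: "P \<noteq> 0" "coeff P 0 \<noteq> 0" "degree P \<le> n" and A: "A \<ge> 1" and Y: "finite Y" and l: "l \<ge> 0"
    and N: "N > 0" and L: "\<And>z. (\<Sum>y\<in>Y. kap l z y) \<le> L"
    and small: "\<And>y a. y \<in> Y \<Longrightarrow> 1 \<le> a \<Longrightarrow> a \<le> A \<Longrightarrow> prox l (crp P) (of_nat a * y) \<ge> N"
    and count: "16 * L * (real n * height P + real n ^ 2 * ln (real A) + real n ^ 2) < card Y * N ^ 2"
  shows "\<exists>y\<in>Y. \<exists>Q. Q \<noteq> 0 \<and> prox l (crp Q) y \<ge> N / 2 \<and> degree Q \<le> degree P \<and> height Q \<le> height P \<and>
    card {p. prime p \<and> p \<le> A} * real (degree Q) \<le> log 2 n * degree P \<and>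
    card {p. prime p \<and> p \<le> A} * height Q \<le> log 2 n * (height P + degree P * ln A)"
proof -
  define S where "S = insert 1 {p::nat. prime p \<and> p \<le> A}"
  have S1: "1 \<in> S" by (simp add: S_def)
  have S: "S \<subseteq> {1..A}" using A prime_ge_1_nat by (auto simp: S_def)
  obtain Q where Q: "Q \<noteq> 0" "\<And>a. a \<in> S \<Longrightarrow> Q dvd dil (of_nat a) P"
    "\<And>g. prime g \<Longrightarrow> \<exists>a\<in>S. \<not> g * Q dvd dil (of_nat a) P"
    by (rule gcd_of_dilates[OF P(1) S1]) (rule that)
  have "card {y \<in> Y. prox l (crp Q) y < N / 2} * N ^ 2 \<le> 16 * L * (n * height P + n ^ 2 * ln A + n ^ 2)"
    by (rule card_bad_points[OF P(1,3) S1 S Q l Y L N small]) (use S in auto)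
  hence "card {y \<in> Y. prox l (crp Q) y < N / 2} * N ^ 2 < card Y * N ^ 2" using count by simp
  hence "card {y \<in> Y. prox l (crp Q) y < N / 2} < card Y" using N by simp
  hence "{y \<in> Y. prox l (crp Q) y < N / 2} \<noteq> Y" by force
  then obtain y where y: "y \<in> Y" "prox l (crp Q) y \<ge> N / 2" by fastforce
  have QP: "Q dvd P" using Q(2)[OF S1] by simp
  have Qp: "Q dvd dil (of_nat p) P" if "prime p" "p \<le> A" for p
    by (rule Q(2)) (use that in \<open>simp add: S_def\<close>)
  have "degree Q \<le> degree P" by (rule dvd_imp_degree_le[OF QP P(1)])
  moreover have "height Q \<le> height P" by (rule height_dvd_le[OF QP P(1)])
  moreover note common_divisor_small[OF P QP A Qp]
  ultimately show ?thesis using y Q(1) by (intro bexI[OF _ y(1)] exI[of _ Q]) auto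
qed

text \<open>The primes up to \<open>n\<^sup>\<alpha>\<close> already make the common divisor small; for \<open>\<alpha> = 0\<close> the trivial bounds suffice.\<close>

lemma eventually_divisor_bounds:
  fixes \<alpha> \<beta> \<epsilon> :: real
  assumes a: "0 \<le> \<alpha>" "\<alpha> \<le> 1" and b: "\<beta> > 1" and e: "\<epsilon> > 0"
  shows "\<forall>\<^sub>F n in sequentially. \<forall>(dP::real) (hP::real) (dQ::real) (hQ::real). dP \<le> n \<longrightarrow> hP \<le> 2 * real n powr \<beta> \<longrightarrow> 0 \<le> dP \<longrightarrow> 0 \<le> hP \<longrightarrow>
     dQ \<le> dP \<longrightarrow> hQ \<le> hP \<longrightarrow>
     card {p. prime p \<and> p \<le> nat \<lfloor>real n powr \<alpha>\<rfloor>} * dQ \<le> log 2 n * dP \<longrightarrow>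
     card {p. prime p \<and> p \<le> nat \<lfloor>real n powr \<alpha>\<rfloor>} * hQ \<le> log 2 n * (hP + dP * ln (nat \<lfloor>real n powr \<alpha>\<rfloor>)) \<longrightarrow>
     dQ \<le> real n powr (1 - \<alpha> + \<epsilon>) \<and> hQ \<le> real n powr (\<beta> - \<alpha> + \<epsilon>)"
proof (cases "\<alpha> = 0")
  case True
  have "\<forall>\<^sub>F n in sequentially. 2 * real n powr \<beta> \<le> real n powr (\<beta> + \<epsilon>)"
    using e by (intro eventually_powr_le') auto
  moreover have "\<forall>\<^sub>F n in sequentially. 1 * real n powr 1 \<le> real n powr (1 + \<epsilon>)"
    using e by (intro eventually_powr_le') auto
  ultimately show ?thesis
    by eventually_elim (use True in auto)
next
  case False
  hence a0: "\<alpha> > 0" using a by simp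
  have 1: "\<forall>\<^sub>F n in sequentially. 6 * real n powr 0 \<le> real n powr \<alpha>" by (rule eventually_powr_le'[OF a0])
  have 2: "\<forall>\<^sub>F n in sequentially. 2 / ln 2 ^ 2 * real n powr (1 - \<alpha>) * ln (real n) ^ 2 \<le> real n powr (1 - \<alpha> + \<epsilon>)"
    using e by (intro eventually_powr_le) auto
  have 3: "\<forall>\<^sub>F n in sequentially. 6 / ln 2 ^ 2 * real n powr (\<beta> - \<alpha>) * ln (real n) ^ 2 \<le> real n powr (\<beta> - \<alpha> + \<epsilon>)"
    using e by (intro eventually_powr_le) auto
  have 4: "\<forall>\<^sub>F n in sequentially. 1 * real n powr 1 * ln (real n) \<le> real n powr \<beta>"
    by (rule eventually_powr_le'[OF b])
  show ?thesis using 1 2 3 4 eventually_ge_at_top[of 2]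
  proof eventually_elim
    case (elim n)
    define x where "x = real n powr \<alpha>"
    define A where "A = nat \<lfloor>x\<rfloor>"
    define \<pi>A where "\<pi>A = real (card {p. prime p \<and> p \<le> A})"
    have n2: "n \<ge> 2" by (rule elim)
    have x6: "x \<ge> 6" using elim(1) n2 by (simp add: x_def)
    have A: "real A \<le> x" "x < real A + 1" using x6 by (auto simp: A_def)
    have A2: "A \<ge> 2" using A x6 by linarith
    have xn: "x \<le> real n" using a n2 powr_mono[of \<alpha> 1 "real n"] by (simp add: x_def)
    have lA: "ln A \<le> ln n" "ln A > 0" using A xn A2 by (auto intro!: ln_mono)
    have ln0: "ln n > 0" using n2 by simp
    \<comment> \<open>Here \<open>real A - 2 > x - 3 \<ge> x / 2\<close>, because
      \<open>x \<ge> 6\<close>.\<close>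
    have "x / 2 * ln 2 \<le> (real A - 2) * ln 2" using A x6 by (intro mult_right_mono) auto
    also have "\<dots> \<le> \<pi>A * ln A" unfolding \<pi>A_def by (rule prime_count_lower[OF A2])
    also have "\<dots> \<le> \<pi>A * ln n" using lA by (intro mult_left_mono) (auto simp: \<pi>A_def)
    finally have pi: "x * ln 2 / (2 * ln n) \<le> \<pi>A" using ln0 by (simp add: field_simps)
    have x0: "x > 0" using x6 by simp
    \<comment> \<open>Division by the prime count, in a form that serves both degree and
      height.\<close>
    have key: "w \<le> (2 / ln 2 ^ 2) * (v / x) * ln n ^ 2" if w: "w \<ge> 0" "\<pi>A * w \<le> log 2 n * v" "v \<ge> 0" for w v :: real
    proof -
      have "x * ln 2 / (2 * ln n) * w \<le> \<pi>A * w" by (rule mult_right_mono[OF pi w(1)])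
      also have "\<dots> \<le> ln n / ln 2 * v" using w(2) by (simp add: log_def)
      finally have "x * ln 2 / (2 * ln n) * w * (2 * ln n / (x * ln 2)) \<le> ln n / ln 2 * v * (2 * ln n / (x * ln 2))"
        using x0 ln0 by (intro mult_right_mono) auto
      moreover have "x * ln 2 / (2 * ln n) * w * (2 * ln n / (x * ln 2)) = w" using x0 ln0 by simp
      moreover have "ln n / ln 2 * v * (2 * ln n / (x * ln 2)) = (2 / ln 2 ^ 2) * (v / x) * ln n ^ 2"
        by (simp add: power2_eq_square mult_ac)
      ultimately show ?thesis by simp
    qed
    show ?case unfolding x_def[symmetric] A_def[symmetric] \<pi>A_def[symmetric]
    proof (intro allI impI)
      fix dP hP dQ hQ :: real
      assume H: "dP \<le> n" "hP \<le> 2 * real n powr \<beta>" "0 \<le> dP" "0 \<le> hP" "dQ \<le> dP" "hQ \<le> hP"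
        "\<pi>A * dQ \<le> log 2 n * dP" "\<pi>A * hQ \<le> log 2 n * (hP + dP * ln A)"
      have dQ: "dQ \<le> real n powr (1 - \<alpha> + \<epsilon>)"
      proof (cases "dQ \<ge> 0")
        case True
        have "dQ \<le> (2 / ln 2 ^ 2) * (dP / x) * ln n ^ 2" by (rule key[OF True H(7,3)])
        also have "\<dots> \<le> (2 / ln 2 ^ 2) * (n / x) * ln n ^ 2"
          using H x0 by (intro mult_right_mono mult_left_mono divide_right_mono) auto
        also have "n / x = real n powr (1 - \<alpha>)" using n2 by (simp add: x_def powr_diff)
        also note elim(2)
        finally show ?thesis .
      next
        case False
        thus ?thesis using powr_ge_zero[of "real n" "1 - \<alpha> + \<epsilon>"] by linarith
      qed
      have hQ: "hQ \<le> real n powr (\<beta> - \<alpha> + \<epsilon>)"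
      proof (cases "hQ \<ge> 0")
        case True
        have "dP * ln A \<le> n * ln n" using H lA by (intro mult_mono) auto
        also have "\<dots> \<le> real n powr \<beta>" using elim(4) n2 by simp
        finally have v: "hP + dP * ln A \<le> 3 * real n powr \<beta>" using H by simp
        have v0: "0 \<le> hP + dP * ln A" using H lA by (intro add_nonneg_nonneg mult_nonneg_nonneg) auto
        have "hQ \<le> (2 / ln 2 ^ 2) * ((hP + dP * ln A) / x) * ln n ^ 2" by (rule key[OF True H(8) v0])
        also have "\<dots> \<le> (2 / ln 2 ^ 2) * ((3 * real n powr \<beta>) / x) * ln n ^ 2"
          using v x0 by (intro mult_right_mono mult_left_mono divide_right_mono) auto
        also have "\<dots> = 6 / ln 2 ^ 2 * (real n powr \<beta> / x) * ln n ^ 2" by simp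
        also have "real n powr \<beta> / x = real n powr (\<beta> - \<alpha>)" using n2 by (simp add: x_def powr_diff)
        also note elim(3)
        finally show ?thesis .
      next
        case False
        thus ?thesis using powr_ge_zero[of "real n" "\<beta> - \<alpha> + \<epsilon>"] by linarith
      qed
      show "dQ \<le> real n powr (1 - \<alpha> + \<epsilon>) \<and> hQ \<le> real n powr (\<beta> - \<alpha> + \<epsilon>)" using dQ hQ by blast
    qed
  qed
qed

context curve_points
begin

text \<open>The exceptional polynomial \<open>T\<close> serves the case of a small linear form, which may be algebraic.\<close>

definition transfer_const :: "real \<Rightarrow> bool" where
  "transfer_const C \<longleftrightarrow> C > 0 \<and>
    (\<forall>X\<ge>(2::real). \<forall>j. (\<forall>k\<in>{1..m}. \<bar>real_of_int (j k)\<bar> \<le> X) \<longrightarrow>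
    (\<forall>(Q::rat poly) (Ds::real) (Hs::real) (N::real) (l::real).
      Q \<noteq> 0 \<longrightarrow> (transc (lin j) \<or> Q = [:0, 1:] \<and> lin j \<noteq> 0) \<longrightarrow>
      prox l (crp Q) (lin j) \<ge> N \<longrightarrow> N > 0 \<longrightarrow> l \<ge> 0 \<longrightarrow>
      0 < Ds \<longrightarrow> real (degree Q) \<le> Ds \<longrightarrow> height Q \<le> Hs \<longrightarrow> Ds * ln X \<le> Hs \<longrightarrow> 8 * C * Hs \<le> N \<longrightarrow>
      (\<exists>g. prime g \<and> prox l (crp g) \<theta> \<ge> N / (32 * C) * (degree g / Ds + height g / Hs))))"

text \<open>A factor is selected twice, for \<open>Q\<close> at the linear form and for the norm
  \<open>G\<close> at \<theta>. \<open>S\<close> is the share of the first factor in the budgets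
  \<open>Ds\<close> and \<open>Hs\<close>; proximity, degree and height of \<open>G\<close> are all
  measured against it, so it cancels in the result. By \<open>8 * C * Hs \<le> N\<close> the norm
  loses at most half of the proximity.\<close>

lemma transfer_prime: "\<exists>C. transfer_const C"
proof -
  obtain C :: real where C: "C > 0 \<and> (\<forall>X\<ge>2. \<forall>j. (\<forall>k\<in>{1..m}. \<bar>real_of_int (j k)\<bar> \<le> X) \<longrightarrow>
    (\<forall>f. f \<noteq> 0 \<longrightarrow> ev (lin j) f \<noteq> 0 \<longrightarrow> (\<forall>l\<ge>0. \<exists>G :: int poly. G \<noteq> 0 \<and>
      real (degree G) \<le> C * real (degree f) \<and>
      lmeas (of_int_poly G) \<le> C * (lmeas (of_int_poly f) + real (degree f) * ln X) \<and>
      prox l (of_int_poly G) \<theta> \<ge> prox l (of_int_poly f) (lin j) - C * (lmeas (of_int_poly f) + real (degree f) * ln X))))"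
    using transfer[of \<theta> m \<xi>, OF th alg] unfolding lin_def[symmetric] ..
  hence C1: "C > 0" ..
  note C2 = conjunct2[OF C, rule_format]
  show ?thesis unfolding transfer_const_def
  proof (intro exI[of _ C] conjI C1 allI impI, goal_cases)
    case (1 X j Q Ds Hs N l)
    define y where "y = lin j"
    have X: "X \<ge> 2" and lX: "ln X > 0" using 1 by auto
    have Hs: "Hs > 0" using 1 lX by (metis less_le_trans mult_pos_pos)
    obtain g where g: "prime g" "g dvd Q" "prox l (crp g) y \<ge> N / 4 * (degree g / Ds + height g / Hs)"
      using exists_close_prime_factor[of Q N l y Ds Hs] 1 Hs unfolding y_def by blast
    have g0: "g \<noteq> 0" "degree g > 0" using prime_poly_monic[OF g(1)] by blast+
    define d h where "d = real (degree g)" and "h = height g"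
    have d1: "d \<ge> 1" using g0 by (simp add: d_def)
    have h0: "h \<ge> 0" using height_nonneg[OF g0(1)] by (simp add: h_def)
    have evg: "ev y (prim g) \<noteq> 0"
    proof -
      have "transc y \<or> Q = [:0, 1:] \<and> y \<noteq> 0" using 1 by (simp add: y_def)
      thus ?thesis
      proof
        assume "transc y"
        thus ?thesis using prim_nonzero[OF g0(1)] unfolding transc_def by blast
      next
        assume Q: "Q = [:0, 1:] \<and> y \<noteq> 0"
        obtain k where k: "Q = g * k" using g(2) by blast
        have "crp Q = [:0, 1:]" using Q by (intro poly_eqI) (simp add: coeff_map_poly coeff_pCons split: nat.split)
        hence "poly (crp g) y * poly (crp k) y \<noteq> 0" using Q unfolding k crp_mult poly_mult[symmetric] by simp
        hence ne: "poly (crp g) y \<noteq> 0" by simp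
        obtain c where "crp g = Polynomial.smult c (of_int_poly (prim g))" using crp_prim[OF g0(1)] by blast
        thus ?thesis using ne by auto
      qed
    qed
    obtain G where G: "G \<noteq> 0" "real (degree G) \<le> C * real (degree (prim g))"
      "lmeas (of_int_poly G) \<le> C * (lmeas (of_int_poly (prim g)) + real (degree (prim g)) * ln X)"
      "prox l (of_int_poly G) \<theta> \<ge> prox l (of_int_poly (prim g)) y - C * (lmeas (of_int_poly (prim g)) + real (degree (prim g)) * ln X)"
      using C2[of X j "prim g" l] 1 prim_nonzero[OF g0(1)] evg unfolding y_def by blast
    have G': "real (degree G) \<le> C * d" "lmeas (of_int_poly G) \<le> C * (h + d * ln X)"
      "prox l (of_int_poly G) \<theta> \<ge> prox l (crp g) y - C * (h + d * ln X)"
      using G unfolding degree_prim[OF g0(1)] prox_prim[OF g0(1)] height_def[symmetric] d_def h_def by blast+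
    define HG where "HG = C * (h + d * ln X)"
    have HG0: "HG > 0" using C1 h0 d1 lX by (simp add: HG_def add_nonneg_pos)
    define S where "S = d / Ds + h / Hs"
    have Ds: "Ds > 0" "Ds * ln X \<le> Hs" "8 * C * Hs \<le> N" "N > 0" "l \<ge> 0" using 1 by auto
    have S0: "S > 0" using Ds d1 h0 Hs by (simp add: S_def add_pos_nonneg)
    have Sge: "(h + d * ln X) / Hs \<le> S"
    proof -
      have "d * (Ds * ln X) \<le> d * Hs" using Ds d1 by (intro mult_left_mono) auto
      hence "d * ln X / Hs \<le> d / Ds" using Ds Hs by (simp add: field_simps)
      thus ?thesis by (simp add: S_def add_divide_distrib)
    qed
    have HGle: "HG \<le> N / 8 * S"
    proof -
      have "HG = C * Hs * ((h + d * ln X) / Hs)" using Hs by (simp add: HG_def)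
      also have "\<dots> \<le> C * Hs * S" using Sge C1 Hs by (intro mult_left_mono) auto
      also have "\<dots> \<le> N / 8 * S" using Ds S0 by (intro mult_right_mono) auto
      finally show ?thesis .
    qed
    have "prox l (crp g) y \<ge> N / 4 * S" using g(3) by (simp add: S_def d_def h_def)
    hence pG: "prox l (crp (rat_poly G)) \<theta> \<ge> N / 8 * S" using G'(3) HGle unfolding HG_def[symmetric] by simp
    have rG: "rat_poly G \<noteq> 0" using G(1) by simp
    have "degree (rat_poly G) \<le> C * d" using G'(1) by simp
    moreover have "height (rat_poly G) \<le> HG" using height_rat_poly_le[OF G(1)] G'(2) by (simp add: HG_def)
    moreover have "C * d > 0" "N / 8 * S > 0" using C1 d1 Ds S0 by auto
    ultimately obtain g2 where g2: "prime g2" "prox l (crp g2) \<theta> \<ge> (N / 8 * S) / 4 * (degree g2 / (C * d) + height g2 / HG)"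
      using exists_close_prime_factor[OF rG _ pG, of "C * d" HG] HG0 by blast
    have g20: "height g2 \<ge> 0" using prime_poly_monic(3)[OF g2(1)] by (rule height_nonneg)
    have "N / (32 * C) * (degree g2 / Ds + height g2 / Hs) \<le> (N / 8 * S) / 4 * (degree g2 / (C * d) + height g2 / HG)"
    proof -
      have "1 / Ds \<le> S / d"
      proof -
        have "d / Ds \<le> S" using h0 Hs by (simp add: S_def)
        thus ?thesis using d1 Ds by (simp add: field_simps)
      qed
      hence "degree g2 * (1 / Ds) \<le> degree g2 * (S / d)" by (rule mult_left_mono) simp
      moreover have "1 / Hs \<le> C * S / HG"
      proof -
        have "C * ((h + d * ln X) / Hs) \<le> C * S" using Sge C1 by (intro mult_left_mono) auto
        hence "HG / Hs \<le> C * S" by (simp add: HG_def)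
        thus ?thesis using HG0 Hs by (simp add: field_simps)
      qed
      hence "height g2 * (1 / Hs) \<le> height g2 * (C * S / HG)" using g20 by (rule mult_left_mono)
      ultimately have "degree g2 * (1 / Ds) + height g2 * (1 / Hs) \<le> degree g2 * (S / d) + height g2 * (C * S / HG)"
        by (rule add_mono)
      hence "N / (32 * C) * (degree g2 * (1 / Ds) + height g2 * (1 / Hs)) \<le>
          N / (32 * C) * (degree g2 * (S / d) + height g2 * (C * S / HG))"
        using Ds C1 by (intro mult_left_mono) auto
      also have "\<dots> = (N / 8 * S) / 4 * (degree g2 / (C * d) + height g2 / HG)"
        using C1 by (simp add: field_simps)
      finally show ?thesis by simp
    qed
    from order_trans[OF this g2(2)] show ?case using g2(1) by blast
  qed
qed

end

section \<open>The polynomial \<open>T\<close>: its proximity, and splitting off its powers\<close>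

lemma crp_X: "crp [:0, 1:] = [:0, 1:]"
  by (rule poly_eqI) (simp add: coeff_map_poly coeff_pCons split: nat.split)

lemma height_X: "height [:0, 1:] = 0"
proof -
  have 1: "rat_poly [:0, 1:] = [:0, 1:]" "of_int_poly [:0, 1:] = ([:0, 1:] :: complex poly)"
    by (rule poly_eqI, simp add: coeff_map_poly coeff_pCons split: nat.split)+
  have "height (rat_poly [:0, 1:]) \<le> lmeas (of_int_poly [:0, 1:])"
    by (rule height_rat_poly_le) simp
  moreover have "lmeas ([:0, 1:] :: complex poly) = 0" using proots_linear_factor[of "0::complex"] by (simp add: lmeas_def)
  moreover have "height [:0, 1:] \<ge> 0" by (rule height_nonneg) simp
  ultimately show ?thesis unfolding 1 by simp
qed

lemma prox_X: "prox l [:0, 1:] x = kap l 0 x"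
  using proots_linear_factor[of "0::complex"] by (simp add: prox_def)

lemma prox_power: "F \<noteq> 0 \<Longrightarrow> prox l (F ^ k) x = real k * prox l F x"
proof (induction k)
  case 0
  thus ?case by (simp add: prox_def)
next
  case (Suc k)
  have "prox l (F ^ Suc k) x = prox l F x + prox l (F ^ k) x"
    unfolding power_Suc by (rule prox_mult) (use Suc in auto)
  thus ?case using Suc by (simp add: algebra_simps)
qed

text \<open>Dilation is not free on \<open>T\<close>, so the powers of \<open>T\<close> are split
  off. Each costs at most \<open>t\<close> of proximity at points of modulus at least
  \<open>exp (-t)\<close>.\<close>

lemma strip_zero_root:
  fixes P :: "rat poly"
  assumes P: "P \<noteq> 0"
  shows "\<exists>P1. P1 \<noteq> 0 \<and> coeff P1 0 \<noteq> 0 \<and> degree P1 \<le> degree P \<and> height P1 \<le> height P \<and>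
    (\<forall>(l::real) (t::real) y. l \<ge> 0 \<longrightarrow> t \<ge> 0 \<longrightarrow> cmod y \<ge> exp (- t) \<longrightarrow> prox l (crp P1) y \<ge> prox l (crp P) y - degree P * t)"
proof -
  let ?X = "[:0, 1:] :: rat poly"
  obtain P1 where P1: "P = ?X ^ order 0 P * P1" "\<not> ?X dvd P1"
    using order_decomp[OF P, of 0] by auto
  have P1_0: "P1 \<noteq> 0" using P1 by auto
  have c0: "coeff P1 0 \<noteq> 0"
  proof
    assume "coeff P1 0 = 0"
    hence "poly P1 0 = 0" by (simp add: poly_0_coeff_0)
    hence "[:- 0, 1:] dvd P1" by (simp only: poly_eq_0_iff_dvd)
    thus False using P1(2) by simp
  qed
  have dvd: "P1 dvd P" by (subst P1(1)) simp
  have "prox l (crp P1) y \<ge> prox l (crp P) y - degree P * t"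
    if "l \<ge> 0" "t \<ge> 0" "cmod y \<ge> exp (- t)" for l t :: real and y
  proof -
    let ?k = "order 0 P"
    have pw: "crp (?X ^ k) = [:0, 1:] ^ k" for k
      by (induction k) (simp_all only: power_0 power_Suc crp_mult crp_X, simp)
    have "crp P = [:0, 1:] ^ ?k * crp P1" by (subst P1(1)) (simp only: crp_mult pw)
    hence "prox l (crp P) y = prox l ([:0, 1:] ^ ?k) y + prox l (crp P1) y"
      using P1_0 by (simp only:) (intro prox_mult, auto)
    also have "prox l ([:0, 1:] ^ ?k) y = ?k * kap l 0 y"
      by (simp only: prox_X prox_power[of "[:0, 1:]"] pCons_eq_0_iff one_neq_zero simp_thms not_False_eq_True)
    also have "?k * kap l 0 y \<le> degree P * t"
    proof (rule mult_mono)
      show "real ?k \<le> real (degree P)" using order_degree[OF P, of 0] by simp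
      show "kap l 0 y \<le> t" using that by (intro kap_le_ln) auto
    qed (use that kap_nonneg in auto)
    finally show ?thesis by simp
  qed
  thus ?thesis
    using P1_0 c0 dvd_imp_degree_le[OF dvd P] height_dvd_le[OF dvd P] by blast
qed

context curve_points
begin

text \<open>To a linear form below \<open>2 * exp (-n^\<kappa>)\<close> the polynomial
  \<open>T\<close> has proximity nearly \<open>n^\<kappa>\<close>, although its degree is 1 and its
  height 0; the norm carries this to \<theta>. Linear independence keeps the form non-zero.\<close>

lemma close_prime_of_small_form:
  fixes \<sigma> \<kappa> \<epsilon> :: real
  assumes k: "\<kappa> > 0" and e: "\<epsilon> > 0" and s: "\<sigma> \<ge> 0"
  shows "\<forall>\<^sub>F n in sequentially. (\<exists>j. (\<forall>k\<in>{1..m}. \<bar>real_of_int (j k)\<bar> \<le> real n powr \<sigma>) \<and> (\<exists>k\<in>{1..m}. j k \<noteq> 0) \<and>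
        cmod (lin j) < 2 * exp (- (real n powr \<kappa>))) \<longrightarrow>
     (\<exists>g. prime g \<and> prox (real n powr \<kappa>) (crp g) \<theta> \<ge> real n powr (\<kappa> - \<epsilon>) * degree g + real n powr (\<kappa> - \<epsilon>) * height g)"
proof -
  obtain C where C: "transfer_const C" using transfer_prime ..
  note C1 = C[unfolded transfer_const_def, THEN conjunct1]
    and C2 = C[unfolded transfer_const_def, THEN conjunct2, rule_format]
  have 1: "\<forall>\<^sub>F n in sequentially. (16 * C * (\<sigma> + 2)) * real n powr 0 * ln (real n) \<le> real n powr \<kappa>"
    by (rule eventually_powr_le'(1)[OF k])
  have 2: "\<forall>\<^sub>F n in sequentially. (64 * C) * real n powr (\<kappa> - \<epsilon>) \<le> real n powr \<kappa>"
    using e by (intro eventually_powr_le'(2)) auto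
  have 3: "\<forall>\<^sub>F n in sequentially. (64 * C * (\<sigma> + 2)) * real n powr (\<kappa> - \<epsilon>) * ln (real n) \<le> real n powr \<kappa>"
    using e by (intro eventually_powr_le'(1)) auto
  have 4: "\<forall>\<^sub>F n in sequentially. (2 * ln 2) * real n powr 0 \<le> real n powr \<kappa>"
    by (rule eventually_powr_le'(2)[OF k])
  show ?thesis using 1 2 3 4 eventually_ge_at_top[of 2]
  proof eventually_elim
    case (elim n)
    show ?case
    proof
      assume "\<exists>j. (\<forall>k\<in>{1..m}. \<bar>real_of_int (j k)\<bar> \<le> real n powr \<sigma>) \<and> (\<exists>k\<in>{1..m}. j k \<noteq> 0) \<and>
          cmod (lin j) < 2 * exp (- (real n powr \<kappa>))"
      then obtain j where j: "\<forall>k\<in>{1..m}. \<bar>real_of_int (j k)\<bar> \<le> real n powr \<sigma>" "\<exists>k\<in>{1..m}. j k \<noteq> 0"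
        "cmod (lin j) < 2 * exp (- (real n powr \<kappa>))" by blast
      have n: "real n \<ge> 2" using elim(5) by simp
      define l where "l = real n powr \<kappa>"
      define X where "X = real n powr (\<sigma> + 2)"
      have l0: "l > 0" "2 * ln 2 \<le> l" using n elim(4) by (simp_all add: l_def)
      have "real n powr 1 \<le> X" unfolding X_def using n s by (intro powr_mono) auto
      hence X: "X \<ge> 2" using n by simp
      have lX: "ln X = (\<sigma> + 2) * ln n" using n by (simp add: X_def ln_powr)
      have lX0: "ln X > 0" using X by simp
      have jX: "\<bar>real_of_int (j k)\<bar> \<le> X" if "k \<in> {1..m}" for k
      proof -
        have "\<bar>real_of_int (j k)\<bar> \<le> real n powr \<sigma>" using j(1) that by blast
        also have "\<dots> \<le> X" unfolding X_def using n by (intro powr_mono) auto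
        finally show ?thesis .
      qed
      have ne: "lin j \<noteq> 0" using j(2) indep[of j] unfolding lin_def by blast
      have "l - ln 2 \<le> kap l 0 (lin j)"
      proof (rule kap_ge)
        have "exp (- (l - ln 2)) = exp (- l) * 2" by (simp add: exp_add[symmetric] exp_diff exp_minus field_simps)
        thus "cmod (lin j - 0) \<le> exp (- (l - ln 2))" using j(3) by (simp add: l_def)
      qed simp
      hence p: "prox l (crp [:0, 1:]) (lin j) \<ge> l / 2" unfolding crp_X prox_X using l0 by simp
      have "8 * C * ln X \<le> l / 2" using elim(1) n by (simp add: lX l_def)
      \<comment> \<open>Degree budget 1 and height budget \<open>ln X\<close>, the smallest that
        \<open>Ds * ln X \<le> Hs\<close> allows.\<close>
      hence "\<exists>g. prime g \<and> prox l (crp g) \<theta> \<ge> (l / 2) / (32 * C) * (degree g / 1 + height g / ln X)"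
        by (intro C2[of X j "[:0, 1:]" "l / 2" l 1 "ln X"]) (use X jX ne p l0 lX0 height_X in auto)
      then obtain g where g: "prime g" "prox l (crp g) \<theta> \<ge> (l / 2) / (32 * C) * (degree g / 1 + height g / ln X)" by blast
      have h0: "height g \<ge> 0" using prime_poly_monic(3)[OF g(1)] by (rule height_nonneg)
      have "real n powr (\<kappa> - \<epsilon>) * degree g + real n powr (\<kappa> - \<epsilon>) * height g \<le>
          l / (64 * C) * degree g + l / (64 * C * ln X) * height g"
      proof (intro add_mono mult_right_mono h0)
        show "real n powr (\<kappa> - \<epsilon>) \<le> l / (64 * C)" using elim(2) C1 by (simp add: l_def field_simps)
        show "real n powr (\<kappa> - \<epsilon>) \<le> l / (64 * C * ln X)"
        proof -
          have "64 * C * ln X > 0" using C1 lX0 by simp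
          moreover have "real n powr (\<kappa> - \<epsilon>) * (64 * C * ln X) \<le> l" using elim(3) by (simp add: l_def lX algebra_simps)
          ultimately show ?thesis by (subst pos_le_divide_eq)
        qed
      qed simp
      also have "\<dots> = (l / 2) / (32 * C) * (degree g / 1 + height g / ln X)"
      proof -
        have "l / (64 * C * ln X) * height g = l / (64 * C) * (height g / ln X)" "(l / 2) / (32 * C) = l / (64 * C)" by simp_all
        thus ?thesis by (simp only: div_by_1 distrib_left)
      qed
      also note g(2)
      finally show "\<exists>g. prime g \<and> prox (real n powr \<kappa>) (crp g) \<theta> \<ge> real n powr (\<kappa> - \<epsilon>) * degree g + real n powr (\<kappa> - \<epsilon>) * height g"
        using g(1) unfolding l_def by blast
    qed
  qed
qed

text \<open>The truncation \<open>n^(\<nu>-\<tau>)\<close> times the bound \<open>n^\<tau>\<close>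
  on the order of the derivatives is \<open>n^\<nu>\<close>; coefficients, degree and size of the
  point cost at most half of it since \<nu> > \<beta> > 1.\<close>

lemma prox_grid_points:
  fixes \<beta> \<sigma> \<tau> \<nu> :: real
  assumes b: "\<beta> > 1" "\<nu> > \<beta>" and s: "\<sigma> \<ge> 0"
  shows "\<forall>\<^sub>F n in sequentially. \<forall>(P::int poly) i. P \<noteq> 0 \<longrightarrow> degree P \<le> n \<longrightarrow>
     (\<forall>k. \<bar>real_of_int (coeff P k)\<bar> \<le> exp (real n powr \<beta>)) \<longrightarrow> (\<forall>k\<in>{1..m}. real (i k) \<le> real n powr \<sigma>) \<longrightarrow>
     (\<forall>j. real j < real n powr \<tau> \<longrightarrow> cmod (poly (divided_deriv j (of_int_poly P)) (pt i)) \<le> exp (- (real n powr \<nu>))) \<longrightarrow>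
     prox (real n powr (\<nu> - \<tau>)) (of_int_poly P) (pt i) \<ge> real n powr \<nu> / 2"
proof -
  define R where "R = 1 + (\<Sum>k=1..m. cmod (\<xi> k))"
  have R: "R \<ge> 1" by (simp add: R_def sum_nonneg)
  have 1: "\<forall>\<^sub>F n in sequentially. 4 * real n powr \<beta> \<le> real n powr \<nu>"
    by (rule eventually_powr_le'(2)[OF b(2)])
  have 2: "\<forall>\<^sub>F n in sequentially. (4 * (4 + ln (2 * R) + \<sigma>)) * real n powr 1 * ln (real n) \<le> real n powr \<nu>"
    using b by (intro eventually_powr_le'(1)) auto
  have 4: "\<forall>\<^sub>F n in sequentially. ln (real n) \<ge> 1" by real_asymp
  show ?thesis using 1 2 4 eventually_ge_at_top[of 2]
  proof eventually_elim
    case (elim n)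
    show ?case
    proof (intro allI impI)
      fix P :: "int poly" and i
      assume P: "P \<noteq> 0" "degree P \<le> n" "\<forall>k. \<bar>real_of_int (coeff P k)\<bar> \<le> exp (real n powr \<beta>)"
        and i: "\<forall>k\<in>{1..m}. real (i k) \<le> real n powr \<sigma>"
        and small: "\<forall>j. real j < real n powr \<tau> \<longrightarrow> cmod (poly (divided_deriv j (of_int_poly P)) (pt i)) \<le> exp (- (real n powr \<nu>))"
      have n: "real n \<ge> 2" using elim(4) by simp
      define r where "r = R * real n powr \<sigma>"
      have ns: "real n powr \<sigma> \<ge> 1" using n s by (intro ge_one_powr_ge_zero) auto
      have r1: "r \<ge> 1" using mult_mono[OF R ns] R by (simp add: r_def)
      have "cmod (pt i) \<le> (\<Sum>k=1..m. real n powr \<sigma> * cmod (\<xi> k))"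
        unfolding pt_def by (rule sum_norm_le) (use i in \<open>auto simp: norm_mult intro!: mult_right_mono\<close>)
      also have "\<dots> \<le> r" using ns by (simp add: r_def R_def algebra_simps sum_distrib_left)
      finally have pr: "cmod (pt i) \<le> r" .
      have eq: "real n powr (\<nu> - \<tau>) * real n powr \<tau> = real n powr \<nu>" by (simp add: powr_add[symmetric])
      have "prox (real n powr (\<nu> - \<tau>)) (of_int_poly P) (pt i) \<ge>
          real n powr (\<nu> - \<tau>) * real n powr \<tau> - ln ((real n + 1) ^ 2 * exp (real n powr \<beta>) * (2 * r) ^ n)"
        by (rule prox_ge_of_small_derivs[OF P(1,2) _ pr r1]) (use P(3) small eq in auto)
      moreover have "ln ((real n + 1) ^ 2 * exp (real n powr \<beta>) * (2 * r) ^ n) \<le> real n powr \<nu> / 2"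
      proof -
        have "ln ((real n + 1) ^ 2 * exp (real n powr \<beta>) * (2 * r) ^ n)
            = 2 * ln (real n + 1) + real n powr \<beta> + n * ln (2 * r)"
          using r1 by (simp add: ln_mult ln_realpow algebra_simps)
        also have "ln (2 * r) = ln (2 * R) + \<sigma> * ln n" using n R by (simp add: r_def ln_mult ln_powr)
        also have "ln (real n + 1) \<le> 2 * ln n"
        proof -
          have "real n + 1 \<le> real n ^ 2" proof -
            have "2 * real n \<le> real n * real n" using n by (intro mult_right_mono) auto
            thus ?thesis using n unfolding power2_eq_square by linarith
          qed
          hence "ln (real n + 1) \<le> ln (real n ^ 2)" using n by (intro ln_mono) auto
          thus ?thesis using n by (simp add: ln_realpow)
        qed
        hence "2 * ln (real n + 1) + real n powr \<beta> + n * (ln (2 * R) + \<sigma> * ln n) \<le>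
           4 * ln n + real n powr \<beta> + n * (ln (2 * R) + \<sigma> * ln n)" by simp
        also have "\<dots> \<le> 4 * (n * ln n) + real n powr \<beta> + n * (ln (2 * R) * ln n + \<sigma> * ln n)"
        proof (intro add_mono mult_left_mono order_refl)
          show "ln n \<le> n * ln n" using mult_right_mono[of 1 "real n" "ln n"] n elim(3) by simp
          show "ln (2 * R) \<le> ln (2 * R) * ln n" using mult_left_mono[of 1 "ln n" "ln (2 * R)"] R elim(3) by simp
        qed (use s in auto)
        also have "\<dots> = real n powr \<beta> + (4 + ln (2 * R) + \<sigma>) * n * ln n" by (simp add: algebra_simps)
        also have "\<dots> \<le> real n powr \<nu> / 4 + real n powr \<nu> / 4"
          using elim(1,2) n by (intro add_mono) (simp_all add: algebra_simps)
        finally show ?thesis by simp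
      qed
      ultimately show "prox (real n powr (\<nu> - \<tau>)) (of_int_poly P) (pt i) \<ge> real n powr \<nu> / 2" using eq by simp
    qed
  qed
qed

end

subsection \<open>Gelfond sequences\<close>

text \<open>The margins \<epsilon> absorb constants and logarithms. \<open>n3\<close> and
  \<open>n4\<close> serve the averaging over the grid, \<open>n4\<close> also the comparison of two
  factors of \<open>type2\<close>, \<open>n7\<close> that of \<open>type1\<close> with
  \<open>type2\<close>; \<open>n5\<close> keeps the loss of the norm below \<open>n^\<nu>\<close>,
  and \<open>n9\<close> with \<open>b\<close> lets the bound of \<open>type2\<close> grow with
  \<open>n\<close>.\<close>

locale parameter_choice = curve_points +
  fixes \<beta> \<sigma> \<tau> \<nu> \<alpha> \<kappa> \<epsilon> :: real
  assumes e: "\<epsilon> > 0" and k1: "\<kappa> > 2 * \<epsilon>" and s: "\<sigma> \<ge> 0"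
    and a: "0 \<le> \<alpha>" "\<alpha> \<le> 1" "\<alpha> \<le> \<sigma>" "\<sigma> > 0 \<Longrightarrow> \<alpha> < \<sigma>" "real m * (\<sigma> - \<alpha>) = 2 * \<alpha>"
    and b: "\<beta> > 1" and n1: "\<nu> > \<beta>" and n3: "1 + \<beta> + \<kappa> < 2 * \<nu>" and n4: "1 + \<beta> - \<tau> - 2 * \<alpha> + 4 * \<epsilon> < \<nu>"
    and n5: "\<beta> - \<alpha> + \<epsilon> < \<nu>" and n6: "\<kappa> \<le> \<nu> - \<tau>" and n7: "\<beta> - \<alpha> - \<tau> + 3 * \<epsilon> < \<kappa>"
    and n9: "\<nu> - \<beta> + \<alpha> - 2 * \<epsilon> > 0"
begin

text \<open>For factors obtained from a small linear form; their degree and height budgets are at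
  most logarithmic, so one exponent serves for both.\<close>

definition type1 :: "nat \<Rightarrow> rat poly \<Rightarrow> bool" where
  "type1 n g \<longleftrightarrow> prime g \<and>
     prox (real n powr \<kappa>) (crp g) \<theta> \<ge> real n powr (\<kappa> - \<epsilon>) * degree g + real n powr (\<kappa> - \<epsilon>) * height g"

text \<open>For factors obtained from a grid point. The exponents are
  \<open>\<nu> - \<epsilon>\<close> minus the exponents \<open>1 - \<alpha> + \<epsilon>\<close> and
  \<open>\<beta> - \<alpha> + \<epsilon>\<close> that bound degree and height of the common
  divisor.\<close>

definition type2 :: "nat \<Rightarrow> rat poly \<Rightarrow> bool" where
  "type2 n g \<longleftrightarrow> prime g \<and>
     prox (real n powr (\<nu> - \<tau>)) (crp g) \<theta> \<ge>
       real n powr (\<nu> - 1 + \<alpha> - 2 * \<epsilon>) * degree g + real n powr (\<nu> - \<beta> + \<alpha> - 2 * \<epsilon>) * height g"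

definition spaced :: "nat \<Rightarrow> bool" where
  "spaced n \<longleftrightarrow> (\<forall>j. (\<forall>k\<in>{1..m}. \<bar>real_of_int (j k)\<bar> \<le> real n powr \<sigma>) \<longrightarrow> (\<exists>k\<in>{1..m}. j k \<noteq> 0) \<longrightarrow>
     cmod (lin j) \<ge> 2 * exp (- (real n powr \<kappa>)))"

lemma eventually_type1: "\<forall>\<^sub>F n in sequentially. \<not> spaced n \<longrightarrow> (\<exists>g. type1 n g)"
proof -
  have "\<kappa> > 0" using k1 e by simp
  from close_prime_of_small_form[OF this e s] show ?thesis
  proof eventually_elim
    case (elim n)
    show ?case
    proof
      assume "\<not> spaced n"
      hence "\<exists>j. (\<forall>k\<in>{1..m}. \<bar>real_of_int (j k)\<bar> \<le> real n powr \<sigma>) \<and> (\<exists>k\<in>{1..m}. j k \<noteq> 0) \<and>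
          cmod (lin j) < 2 * exp (- (real n powr \<kappa>))" unfolding spaced_def not_all not_imp not_le by blast
      thus "\<exists>g. type1 n g" unfolding type1_def by (rule mp[OF elim])
    qed
  qed
qed

lemma eventually_grid_size:
  "\<forall>\<^sub>F n in sequentially. real n powr (2 * \<alpha>) / 4 \<le> card (good (nat \<lfloor>real n powr (\<sigma> - \<alpha>)\<rfloor>))"
proof (cases "\<sigma> = 0")
  case True
  \<comment> \<open>Here the coordinates are 0 or 1 for every \<open>n \<ge> 1\<close>, and the left
    side is 1/4.\<close>
  hence a0: "\<alpha> = 0" using a by simp
  show ?thesis using eventually_ge_at_top[of 1]
  proof eventually_elim
    case (elim n)
    have "card (good 1) \<ge> 1" by (rule good_nonempty) simp
    hence "real (card (good 1)) \<ge> 1" by simp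
    thus ?case using elim True a0 by simp
  qed
next
  case False
  have "\<forall>\<^sub>F n in sequentially. 4 * real n powr 0 \<le> real n powr (\<sigma> - \<alpha>)"
    using False a s by (intro eventually_powr_le'(2)) auto
  thus ?thesis using eventually_ge_at_top[of 1]
  proof eventually_elim
    case (elim n)
    define x where "x = real n powr (\<sigma> - \<alpha>)"
    define B where "B = nat \<lfloor>x\<rfloor>"
    have x4: "x \<ge> 4" using elim by (simp add: x_def)
    have B: "x < real B + 1" "B \<ge> 3" using x4 by (auto simp: B_def le_nat_iff le_floor_iff)
    have "real n powr (2 * \<alpha>) = x powr real m"
      unfolding x_def powr_powr a(5)[symmetric] by (simp add: mult.commute)
    also have "\<dots> = x ^ m" using x4 by (simp add: powr_realpow)
    also have "\<dots> \<le> (real B + 1) ^ m" using B x4 by (intro power_mono) auto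
    also have "\<dots> = real ((B + 1) ^ m)" by (simp add: add.commute)
    finally have "real n powr (2 * \<alpha>) \<le> real ((B + 1) ^ m)" .
    moreover have "real ((B + 1) ^ m) / 2 \<le> card (good B)" by (rule card_good_half[OF B(2)])
    moreover have "real n powr (2 * \<alpha>) \<ge> 0" by simp
    ultimately show ?case unfolding B_def x_def by linarith
  qed
qed

text \<open>When the grid is spaced, a root can be very close to one grid point only, so the
  averaging yields a grid point with large proximity to the common divisor, which the norm moves to
  \<theta>.\<close>

lemma eventually_type2:
  "\<forall>\<^sub>F n in sequentially. \<forall>P::int poly. spaced n \<longrightarrow> P \<noteq> 0 \<longrightarrow> degree P \<le> n \<longrightarrow>
     (\<forall>k. \<bar>real_of_int (coeff P k)\<bar> \<le> exp (real n powr \<beta>)) \<longrightarrow>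
     (\<forall>i j. (\<forall>k\<in>{1..m}. real (i k) \<le> real n powr \<sigma>) \<longrightarrow> real j < real n powr \<tau> \<longrightarrow>
        cmod (poly (divided_deriv j (of_int_poly P)) (pt i)) \<le> exp (- (real n powr \<nu>))) \<longrightarrow>
     (\<exists>g. type2 n g)"
proof -
  obtain C where C: "transfer_const C" using transfer_prime ..
  note C1 = C[unfolded transfer_const_def, THEN conjunct1]
    and C2 = C[unfolded transfer_const_def, THEN conjunct2, rule_format]
  define c0 where "c0 = cmod (\<xi> k0) / 2"
  have c0: "c0 > 0" using xi_k0_nonzero by (simp add: c0_def)
  define t where "t = max 0 (- ln c0)"
  have t0: "t \<ge> 0" and tc: "exp (- t) \<le> c0"
  proof -
    show "t \<ge> 0" by (simp add: t_def)
    have "exp (- t) \<le> exp (ln c0)" by (subst exp_le_cancel_iff) (simp add: t_def)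
    thus "exp (- t) \<le> c0" using c0 by simp
  qed
  have 1: "\<forall>\<^sub>F n in sequentially. (4 * t) * real n powr 1 \<le> real n powr \<nu>"
    using b n1 by (intro eventually_powr_le'(2)) auto
  have 2: "\<forall>\<^sub>F n in sequentially. 2 * real n powr 1 * ln (real n) \<le> real n powr \<beta>"
    using b by (intro eventually_powr_le'(1)) auto
  have 3: "\<forall>\<^sub>F n in sequentially. 16384 * real n powr (1 + \<beta> - \<tau> - 2 * \<alpha>) \<le> real n powr \<nu>"
    using n4 e by (intro eventually_powr_le'(2)) auto
  have 4: "\<forall>\<^sub>F n in sequentially. 4096 * real n powr (1 + \<beta> + \<kappa>) \<le> real n powr (2 * \<nu>)"
    using n3 by (intro eventually_powr_le'(2)) auto
  have 5: "\<forall>\<^sub>F n in sequentially. (\<sigma> + 2) * real n powr (1 - \<alpha> + \<epsilon>) * ln (real n) \<le> real n powr (\<beta> - \<alpha> + \<epsilon>)"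
    using b by (intro eventually_powr_le'(1)) auto
  have 6: "\<forall>\<^sub>F n in sequentially. (64 * C) * real n powr (\<beta> - \<alpha> + \<epsilon>) \<le> real n powr \<nu>"
    using n5 by (intro eventually_powr_le'(2)) auto
  have 7: "\<forall>\<^sub>F n in sequentially. (256 * C) * real n powr (\<nu> - \<epsilon>) \<le> real n powr \<nu>"
    using e by (intro eventually_powr_le'(2)) auto
  have 8: "\<forall>\<^sub>F n in sequentially. ln (real n) \<ge> 1" by real_asymp
  show ?thesis
    using 1 2 3 4 5 6 7 8 eventually_ge_at_top[of 2] eventually_grid_size prox_grid_points[OF b n1 s, of \<tau>]
      eventually_divisor_bounds[OF a(1,2) b e]
  proof eventually_elim
    case (elim n)
    show ?case
    proof (intro allI impI)
      fix P :: "int poly"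
      assume sp: "spaced n" and P: "P \<noteq> 0" "degree P \<le> n" "\<forall>k. \<bar>real_of_int (coeff P k)\<bar> \<le> exp (real n powr \<beta>)"
        and small: "\<forall>i j. (\<forall>k\<in>{1..m}. real (i k) \<le> real n powr \<sigma>) \<longrightarrow> real j < real n powr \<tau> \<longrightarrow>
          cmod (poly (divided_deriv j (of_int_poly P)) (pt i)) \<le> exp (- (real n powr \<nu>))"
      have n2: "real n \<ge> 2" using elim(9) by simp
      have n0: "n > 0" using elim(9) by simp
      define l where "l = real n powr (\<nu> - \<tau>)"
      have l0: "l \<ge> 0" by (simp add: l_def)
      \<comment> \<open>Half of \<open>n^\<nu>\<close> survives in \<open>prox_grid_points\<close>;
        a further quarter is reserved for the powers of \<open>T\<close>.\<close>
      define N where "N = real n powr \<nu> / 4"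
      have N0: "N > 0" using n2 by (simp add: N_def)
      have rP: "rat_poly P \<noteq> 0" using P by simp
      obtain P1 where P1: "P1 \<noteq> 0" "coeff P1 0 \<noteq> 0" "degree P1 \<le> degree (rat_poly P)" "height P1 \<le> height (rat_poly P)"
        "\<And>(l::real) (t::real) y. l \<ge> 0 \<Longrightarrow> t \<ge> 0 \<Longrightarrow> cmod y \<ge> exp (- t) \<Longrightarrow>
           prox l (crp P1) y \<ge> prox l (crp (rat_poly P)) y - degree (rat_poly P) * t"
        using strip_zero_root[OF rP] by blast
      have dP1: "degree P1 \<le> n" using P1(3) P(2) by simp
      have nb: "real n * ln n \<le> real n powr \<beta> / 2" using elim(2) n2 by simp
      have hP1: "height P1 \<le> 2 * real n powr \<beta>"
      proof -
        have "height P1 \<le> lmeas (of_int_poly P)" using P1(4) height_rat_poly_le[OF P(1)] by linarith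
        also have "\<dots> \<le> ln (real n + 1) + real n powr \<beta>" by (rule lmeas_le_of_coeffs[OF P(1,2)]) (use P(3) in blast)
        also have "ln (real n + 1) \<le> real n powr \<beta>"
        proof -
          have "ln (real n + 1) \<le> ln (2 * real n)" using n2 by (intro ln_mono) auto
          also have "\<dots> = ln 2 + ln n" using n2 by (simp add: ln_mult)
          also have "\<dots> \<le> 2 * ln n" using n2 ln_mono[of 2 "real n"] by simp
          also have "\<dots> \<le> real n * ln n" using n2 elim(8) by (intro mult_right_mono) auto
          also have "\<dots> \<le> real n powr \<beta>" using nb powr_ge_zero[of "real n" \<beta>] by linarith
          finally show ?thesis .
        qed
        finally show ?thesis by simp
      qed
      have hP10: "height P1 \<ge> 0" by (rule height_nonneg[OF P1(1)])
      define A where "A = nat \<lfloor>real n powr \<alpha>\<rfloor>"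
      define B where "B = nat \<lfloor>real n powr (\<sigma> - \<alpha>)\<rfloor>"
      have A1: "A \<ge> 1" "real A \<le> real n powr \<alpha>"
        using ge_one_powr_ge_zero[of "real n" \<alpha>] n2 a by (auto simp: A_def le_nat_iff le_floor_iff)
      have B1: "real B \<le> real n powr (\<sigma> - \<alpha>)" by (simp add: B_def)
      have B2: "real B \<le> real n powr \<sigma>" using B1 powr_mono[of "\<sigma> - \<alpha>" \<sigma> "real n"] a(1) n2 by linarith
      define Y where "Y = pt ` good B"
      have fg: "finite (good B)" using finite_grid by (simp add: good_def)
      have Y: "finite Y" using fg by (simp add: Y_def)
      have cY: "card Y = card (good B)"
        unfolding Y_def by (rule card_image) (use inj_on_pt[of B] in \<open>auto simp: good_def inj_on_def\<close>)
      have gr: "i k \<le> B" if "i \<in> good B" "k \<in> {1..m}" for i k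
        using that by (auto simp: good_def grid_def PiE_iff)
      have spY: "cmod (y - y') \<ge> 2 * exp (- (real n powr \<kappa>))" if yy: "y \<in> Y" "y' \<in> Y" "y \<noteq> y'" for y y'
      proof -
        obtain i i' where i: "i \<in> good B" "y = pt i" "i' \<in> good B" "y' = pt i'" using yy by (auto simp: Y_def)
        define j where "j = (\<lambda>k. int (i k) - int (i' k))"
        have eq: "y - y' = lin j" using pt_diff[of i i'] i by (simp add: j_def)
        have "\<exists>k\<in>{1..m}. j k \<noteq> 0"
        proof (rule ccontr)
          assume "\<not> ?thesis"
          hence "lin j = 0" unfolding lin_def by (intro sum.neutral) auto
          thus False using eq yy(3) by simp
        qed
        moreover have "\<forall>k\<in>{1..m}. \<bar>real_of_int (j k)\<bar> \<le> real n powr \<sigma>"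
        proof
          fix k assume k: "k \<in> {1..m}"
          have "\<bar>j k\<bar> \<le> int B" using gr[OF i(1) k] gr[OF i(3) k] by (auto simp: j_def)
          hence "\<bar>real_of_int (j k)\<bar> \<le> real B" by linarith
          thus "\<bar>real_of_int (j k)\<bar> \<le> real n powr \<sigma>" using B2 by linarith
        qed
        ultimately have "cmod (lin j) \<ge> 2 * exp (- (real n powr \<kappa>))" using sp unfolding spaced_def by blast
        thus ?thesis by (simp only: eq)
      qed
      define L where "L = l + card Y * real n powr \<kappa>"
      have L: "(\<Sum>y\<in>Y. kap l z y) \<le> L" for z
        unfolding L_def by (rule sum_kap_spaced[OF Y l0 powr_ge_zero spY])
      have smallY: "prox l (crp P1) (of_nat q * y) \<ge> N" if y: "y \<in> Y" and q: "1 \<le> q" "q \<le> A" for y q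
      proof -
        obtain i where i: "i \<in> good B" "y = pt i" using y by (auto simp: Y_def)
        have y0: "cmod y \<ge> c0" using i by (simp add: good_def c0_def)
        have "1 * cmod y \<le> real q * cmod y" using q by (intro mult_right_mono) auto
        hence qy: "cmod (of_nat q * y) \<ge> exp (- t)" using y0 tc by (simp add: norm_mult)
        have qi: "of_nat q * y = pt (\<lambda>k. q * i k)" by (simp add: i pt_mult)
        \<comment> \<open>The dilated point stays in the range of the hypothesis, as
          \<open>A * B\<close> is at most \<open>n^\<alpha> * n^(\<sigma>-\<alpha>)\<close>.\<close>
        have bd: "\<forall>k\<in>{1..m}. real (q * i k) \<le> real n powr \<sigma>"
        proof
          fix k assume k: "k \<in> {1..m}"
          have "real q * real (i k) \<le> real n powr \<alpha> * real n powr (\<sigma> - \<alpha>)"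
            by (intro mult_mono) (use q A1 gr[OF i(1) k] B1 in auto)
          also have "\<dots> = real n powr \<sigma>" by (simp add: powr_add[symmetric])
          finally show "real (q * i k) \<le> real n powr \<sigma>" by simp
        qed
        have "prox l (of_int_poly P) (pt (\<lambda>k. q * i k)) \<ge> real n powr \<nu> / 2"
          unfolding l_def
        proof (rule elim(11)[THEN spec, THEN spec, THEN mp, THEN mp, THEN mp, THEN mp, THEN mp, OF P bd], intro allI impI)
          fix j assume "real j < real n powr \<tau>"
          thus "cmod (poly (divided_deriv j (of_int_poly P)) (pt (\<lambda>k. q * i k))) \<le> exp (- (real n powr \<nu>))"
            by (rule small[THEN spec, THEN spec, THEN mp, THEN mp, OF bd])
        qed
        moreover have "prox l (crp P1) (of_nat q * y) \<ge> prox l (crp (rat_poly P)) (of_nat q * y) - degree (rat_poly P) * t"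
          by (rule P1(5)[OF l0 t0 qy])
        moreover have "degree (rat_poly P) * t \<le> real n powr \<nu> / 4"
        proof -
          have "real (degree P) * t \<le> n * t" using P(2) t0 by (intro mult_right_mono) auto
          also have "\<dots> \<le> real n powr \<nu> / 4" using elim(1) n2 by (simp add: mult_ac)
          finally show ?thesis by simp
        qed
        ultimately show ?thesis unfolding qi N_def by simp
      qed
      have cYge: "real n powr (2 * \<alpha>) / 4 \<le> real (card Y)" using elim(10) by (simp add: cY B_def)
      have cYpos: "real (card Y) > 0" using cYge n2 by (smt (verit) divide_pos_pos powr_gt_zero)
      have count: "16 * L * (real n * height P1 + real n ^ 2 * ln (real A) + real n ^ 2) < card Y * N ^ 2"
      proof -
        define E where "E = real n powr (1 + \<beta>)"
        have E: "E = real n * real n powr \<beta>" using n2 by (simp add: E_def powr_add)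
        have E0: "E > 0" using n2 by (simp add: E_def)
        have lA: "ln (real A) \<le> ln n"
        proof -
          have "real A \<le> real n" using A1 powr_mono[of \<alpha> 1 "real n"] a n2 by simp
          thus ?thesis using A1 by (intro ln_mono) auto
        qed
        have "real n * height P1 + real n ^ 2 * ln (real A) + real n ^ 2 \<le>
            real n * (2 * real n powr \<beta>) + real n ^ 2 * ln n + real n ^ 2 * ln n"
          using hP1 lA elim(8) mult_left_mono[of 1 "ln (real n)" "real n ^ 2"]
          by (intro add_mono mult_left_mono) auto
        also have "\<dots> = 2 * E + 2 * (real n * (real n * ln n))" by (simp add: E power2_eq_square algebra_simps)
        also have "real n * (real n * ln n) \<le> real n * (real n powr \<beta> / 2)" using nb by (intro mult_left_mono) auto
        also have "2 * E + 2 * (real n * (real n powr \<beta> / 2)) = 3 * E" by (simp add: E)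
        finally have br: "real n * height P1 + real n ^ 2 * ln (real A) + real n ^ 2 \<le> 3 * E" by simp
        have L0: "L \<ge> 0" using l0 by (simp add: L_def)
        define V where "V = real n powr (2 * \<nu>)"
        have V0: "V > 0" using n2 by (simp add: V_def)
        have N2: "N ^ 2 = V / 16"
          by (simp add: N_def V_def power2_eq_square powr_add[symmetric])
        \<comment> \<open>Contribution of the one point that may be very close to a root; here the
          hypothesis on \<nu> enters, in the form \<open>n4\<close>.\<close>
        have lE: "4096 * (l * E) \<le> card Y * V"
        proof -
          have "16384 * real n powr (1 + \<beta> - \<tau> - 2 * \<alpha>) * real n powr (\<nu> + 2 * \<alpha>) \<le> real n powr \<nu> * real n powr (\<nu> + 2 * \<alpha>)"
            by (rule mult_right_mono[OF elim(3)]) simp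
          moreover have "real n powr (1 + \<beta> - \<tau> - 2 * \<alpha>) * real n powr (\<nu> + 2 * \<alpha>) = l * E"
            "real n powr \<nu> * real n powr (\<nu> + 2 * \<alpha>) = real n powr (2 * \<alpha>) * V"
            unfolding l_def E_def V_def powr_add[symmetric] by (simp_all add: algebra_simps)
          ultimately have "16384 * (l * E) \<le> real n powr (2 * \<alpha>) * V" by (simp only: mult.assoc)
          moreover have "real n powr (2 * \<alpha>) / 4 * V \<le> card Y * V" by (rule mult_right_mono[OF cYge]) (use V0 in simp)
          ultimately show ?thesis by linarith
        qed
        \<comment> \<open>Contribution of the other points, each at most \<open>n^\<kappa>\<close>
          by the spacing.\<close>
        have kE: "4096 * (card Y * real n powr \<kappa> * E) \<le> card Y * V"
        proof -
          have "4096 * (real n powr \<kappa> * E) \<le> V"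
            using elim(4) by (simp add: E_def V_def powr_add[symmetric] algebra_simps)
          hence "card Y * (4096 * (real n powr \<kappa> * E)) \<le> card Y * V" by (rule mult_left_mono) simp
          thus ?thesis by (simp add: algebra_simps)
        qed
        have "16 * L * (real n * height P1 + real n ^ 2 * ln (real A) + real n ^ 2) \<le> 16 * L * (3 * E)"
          by (rule mult_left_mono[OF br]) (use L0 in simp)
        also have "\<dots> = 48 * (l * E) + 48 * (card Y * real n powr \<kappa> * E)" by (simp add: L_def algebra_simps)
        also have "\<dots> < card Y * (V / 16)"
        proof -
          have "card Y * V > 0" using cYpos V0 by simp
          thus ?thesis using lE kE by (simp add: field_simps)
        qed
        finally show ?thesis unfolding N2 .
      qed
      obtain y Q where yQ: "y \<in> Y" "Q \<noteq> 0" "prox l (crp Q) y \<ge> N / 2" "degree Q \<le> degree P1" "height Q \<le> height P1"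
        "card {p. prime p \<and> p \<le> A} * real (degree Q) \<le> log 2 n * degree P1"
        "card {p. prime p \<and> p \<le> A} * height Q \<le> log 2 n * (height P1 + degree P1 * ln A)"
        using exists_good_point[OF P1(1,2) dP1 A1(1) Y l0 N0 L smallY count] by blast
      define Ds where "Ds = real n powr (1 - \<alpha> + \<epsilon>)"
      define Hs where "Hs = real n powr (\<beta> - \<alpha> + \<epsilon>)"
      have DH0: "Ds > 0" "Hs > 0" using n2 by (auto simp: Ds_def Hs_def)
      have DQ: "real (degree Q) \<le> Ds \<and> height Q \<le> Hs"
        unfolding Ds_def Hs_def
        by (rule elim(12)[rule_format, where dP = "real (degree P1)" and hP = "height P1"])
           (use dP1 hP1 hP10 yQ(4-7) in \<open>simp_all add: A_def\<close>)
      obtain i where i: "i \<in> good B" "y = pt i" using yQ(1) by (auto simp: Y_def)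
      define j where "j = (\<lambda>k. int (i k))"
      have yj: "y = lin j" using i pt_lin[of i] by (simp add: j_def)
      have tr: "transc (lin j)" using i yj by (simp add: good_def)
      define X where "X = real n powr (\<sigma> + 2)"
      have "real n powr 1 \<le> X" unfolding X_def using n2 s by (intro powr_mono) auto
      hence X: "X \<ge> 2" using n2 by simp
      have lX: "ln X = (\<sigma> + 2) * ln n" using n2 by (simp add: X_def ln_powr)
      have jX: "\<bar>real_of_int (j k)\<bar> \<le> X" if "k \<in> {1..m}" for k
      proof -
        have "\<bar>real_of_int (j k)\<bar> \<le> real B" using gr[OF i(1) that] by (simp add: j_def)
        also have "\<dots> \<le> real n powr \<sigma>" by (rule B2)
        also have "\<dots> \<le> X" unfolding X_def using n2 by (intro powr_mono) auto
        finally show ?thesis .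
      qed
      have DX: "Ds * ln X \<le> Hs" using elim(5) by (simp add: Ds_def Hs_def lX mult_ac)
      have HN: "8 * C * Hs \<le> N / 2" using elim(6) by (simp add: Hs_def N_def)
      have "\<exists>g. prime g \<and> prox l (crp g) \<theta> \<ge> (N / 2) / (32 * C) * (degree g / Ds + height g / Hs)"
      proof (rule C2[of X j Q "N / 2" l Ds Hs])
        show "transc (lin j) \<or> Q = [:0, 1:] \<and> lin j \<noteq> 0" using tr by blast
        show "N / 2 \<le> prox l (crp Q) (lin j)" using yQ(3) yj by simp
      qed (use X jX yQ(2) N0 l0 DH0 DQ DX HN in auto)
      then obtain g where g: "prime g" "prox l (crp g) \<theta> \<ge> (N / 2) / (32 * C) * (degree g / Ds + height g / Hs)" by blast
      have h0: "height g \<ge> 0" using prime_poly_monic(3)[OF g(1)] by (rule height_nonneg)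
      have big: "real n powr (\<nu> - \<epsilon>) \<le> (N / 2) / (32 * C)"
        using elim(7) C1 by (simp add: N_def field_simps)
      have "real n powr (\<nu> - 1 + \<alpha> - 2 * \<epsilon>) * degree g + real n powr (\<nu> - \<beta> + \<alpha> - 2 * \<epsilon>) * height g
          = real n powr (\<nu> - \<epsilon>) * (degree g / Ds + height g / Hs)"
      proof -
        have "real n powr (\<nu> - 1 + \<alpha> - 2 * \<epsilon>) = real n powr (\<nu> - \<epsilon>) / Ds"
          "real n powr (\<nu> - \<beta> + \<alpha> - 2 * \<epsilon>) = real n powr (\<nu> - \<epsilon>) / Hs"
          using n0 unfolding Ds_def Hs_def by (simp_all add: powr_diff[symmetric] algebra_simps)
        thus ?thesis by (simp add: algebra_simps)
      qed
      also have "\<dots> \<le> (N / 2) / (32 * C) * (degree g / Ds + height g / Hs)"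
        by (rule mult_right_mono[OF big]) (use h0 DH0 in auto)
      also note g(2)
      finally show "\<exists>g. type2 n g" using g(1) unfolding type2_def l_def by blast
    qed
  qed
qed

section \<open>Consecutive indices and the contradiction\<close>

lemma eventually_powr_Suc:
  fixes x y z :: real
  assumes "x < y + z"
  shows "\<forall>\<^sub>F n in sequentially. 4 * real (Suc n) powr x < real n powr y * real (Suc n) powr z"
proof -
  define w where "w = \<bar>x - z\<bar>"
  have "\<forall>\<^sub>F n in sequentially. (8 * 2 powr w) * real n powr (x - z) \<le> real n powr y"
    using assms by (intro eventually_powr_le'(2)) auto
  thus ?thesis using eventually_ge_at_top[of 1]
  proof eventually_elim
    case (elim n)
    have n: "real n \<ge> 1" using elim by simp
    have "real (Suc n) powr (x - z) = real n powr (x - z) * (real (Suc n) / real n) powr (x - z)"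
      using n by (simp add: powr_divide)
    also have "(real (Suc n) / real n) powr (x - z) \<le> (real (Suc n) / real n) powr w"
      using n by (intro powr_mono) (auto simp: w_def)
    also have "\<dots> \<le> 2 powr w" using n by (intro powr_mono2) (auto simp: w_def field_simps)
    finally have 1: "real (Suc n) powr (x - z) \<le> real n powr (x - z) * 2 powr w"
      using n by (simp add: mult_left_mono)
    have "0 < real n powr y" using n by simp
    moreover have "8 * (real n powr (x - z) * 2 powr w) \<le> real n powr y" using elim(1) by (simp add: mult_ac)
    moreover have "real (Suc n) powr (x - z) \<ge> 0" by simp
    ultimately have "4 * real (Suc n) powr (x - z) < real n powr y" using 1 by linarith
    hence "4 * real (Suc n) powr (x - z) * real (Suc n) powr z < real n powr y * real (Suc n) powr z"
      by (intro mult_strict_right_mono) auto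
    thus ?case by (simp add: mult.assoc powr_add[symmetric])
  qed
qed

text \<open>Both proximities are raised to the common truncation \<open>(n+1)^x\<close>. The
  exponents keep four times this below the products needed in \<open>gelfond_pair\<close>, with room
  for the shift from \<open>n\<close> to \<open>n + 1\<close>.\<close>

lemma type_pair:
  fixes x A B A' B' l1 l2 :: real
  assumes l: "l1 \<le> x" "l2 \<le> x" "x \<ge> 0"
    and o: "x < A + A'" "x < A + B'" "x < B + A'"
  shows "\<forall>\<^sub>F n in sequentially. \<forall>g g'. prime g \<longrightarrow> prime g' \<longrightarrow>
      prox (real n powr l1) (crp g) \<theta> \<ge> real n powr A * degree g + real n powr B * height g \<longrightarrow>
      prox (real (Suc n) powr l2) (crp g') \<theta> \<ge> real (Suc n) powr A' * degree g' + real (Suc n) powr B' * height g' \<longrightarrow> g = g'"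
  using eventually_powr_Suc[OF o(1)] eventually_powr_Suc[OF o(2)] eventually_powr_Suc[OF o(3)] eventually_ge_at_top[of 1]
proof eventually_elim
  case (elim n)
  show ?case
  proof (intro allI impI)
    fix g g' :: "rat poly" assume g: "prime g" "prime g'"
      and p: "prox (real n powr l1) (crp g) \<theta> \<ge> real n powr A * degree g + real n powr B * height g"
      and p': "prox (real (Suc n) powr l2) (crp g') \<theta> \<ge> real (Suc n) powr A' * degree g' + real (Suc n) powr B' * height g'"
    have n: "real n \<ge> 1" using elim by simp
    define l where "l = real (Suc n) powr x"
    have "real n powr l1 \<le> real n powr x" using n l by (intro powr_mono) auto
    also have "\<dots> \<le> l" using n l unfolding l_def by (intro powr_mono2) auto
    finally have "prox (real n powr l1) (crp g) \<theta> \<le> prox l (crp g) \<theta>" by (rule prox_mono)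
    hence q: "prox l (crp g) \<theta> \<ge> real n powr A * degree g + real n powr B * height g" using p by linarith
    have "real (Suc n) powr l2 \<le> l" using l unfolding l_def by (intro powr_mono) auto
    hence "prox (real (Suc n) powr l2) (crp g') \<theta> \<le> prox l (crp g') \<theta>" by (rule prox_mono)
    hence q': "prox l (crp g') \<theta> \<ge> real (Suc n) powr A' * degree g' + real (Suc n) powr B' * height g'" using p' by linarith
    show "g = g'"
      by (rule gelfond_pair[OF g _ q q']) (use elim in \<open>auto simp: l_def\<close>)
  qed
qed

text \<open>The exponent conditions of \<open>type_pair\<close> come down to \<open>k1\<close> for
  two factors of \<open>type1\<close>, to \<open>n7\<close> for mixed types and to \<open>n4\<close>
  for two factors of \<open>type2\<close>.\<close>

lemma type_consecutive:
  "\<forall>\<^sub>F n in sequentially. \<forall>g g'. type1 n g \<or> type2 n g \<longrightarrow> type1 (Suc n) g' \<or> type2 (Suc n) g' \<longrightarrow> g = g'"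
proof -
  let ?A = "\<nu> - 1 + \<alpha> - 2 * \<epsilon>" and ?B = "\<nu> - \<beta> + \<alpha> - 2 * \<epsilon>" and ?K = "\<kappa> - \<epsilon>"
  have pos: "\<kappa> \<ge> 0" "\<nu> - \<tau> \<ge> 0" using k1 e n6 by auto
  have 11: "\<forall>\<^sub>F n in sequentially. \<forall>g g'. prime g \<longrightarrow> prime g' \<longrightarrow>
      prox (real n powr \<kappa>) (crp g) \<theta> \<ge> real n powr ?K * degree g + real n powr ?K * height g \<longrightarrow>
      prox (real (Suc n) powr \<kappa>) (crp g') \<theta> \<ge> real (Suc n) powr ?K * degree g' + real (Suc n) powr ?K * height g' \<longrightarrow> g = g'"
    by (rule type_pair[of \<kappa> \<kappa>]) (use k1 e in auto)
  have 12: "\<forall>\<^sub>F n in sequentially. \<forall>g g'. prime g \<longrightarrow> prime g' \<longrightarrow>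
      prox (real n powr \<kappa>) (crp g) \<theta> \<ge> real n powr ?K * degree g + real n powr ?K * height g \<longrightarrow>
      prox (real (Suc n) powr (\<nu> - \<tau>)) (crp g') \<theta> \<ge> real (Suc n) powr ?A * degree g' + real (Suc n) powr ?B * height g' \<longrightarrow> g = g'"
    by (rule type_pair[of \<kappa> "\<nu> - \<tau>"]) (use n6 n7 b pos in auto)
  have 21: "\<forall>\<^sub>F n in sequentially. \<forall>g g'. prime g \<longrightarrow> prime g' \<longrightarrow>
      prox (real n powr (\<nu> - \<tau>)) (crp g) \<theta> \<ge> real n powr ?A * degree g + real n powr ?B * height g \<longrightarrow>
      prox (real (Suc n) powr \<kappa>) (crp g') \<theta> \<ge> real (Suc n) powr ?K * degree g' + real (Suc n) powr ?K * height g' \<longrightarrow> g = g'"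
    by (rule type_pair[of "\<nu> - \<tau>" "\<nu> - \<tau>"]) (use n6 n7 b pos in auto)
  have 22: "\<forall>\<^sub>F n in sequentially. \<forall>g g'. prime g \<longrightarrow> prime g' \<longrightarrow>
      prox (real n powr (\<nu> - \<tau>)) (crp g) \<theta> \<ge> real n powr ?A * degree g + real n powr ?B * height g \<longrightarrow>
      prox (real (Suc n) powr (\<nu> - \<tau>)) (crp g') \<theta> \<ge> real (Suc n) powr ?A * degree g' + real (Suc n) powr ?B * height g' \<longrightarrow> g = g'"
    by (rule type_pair[of "\<nu> - \<tau>" "\<nu> - \<tau>"]) (use n4 b pos in auto)
  from 11 12 21 22 show ?thesis
  proof eventually_elim
    case (elim n)
    show ?case
    proof (intro allI impI)
      fix g g' assume "type1 n g \<or> type2 n g" "type1 (Suc n) g' \<or> type2 (Suc n) g'"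
      thus "g = g'"
      proof (elim disjE)
        assume "type1 n g" "type1 (Suc n) g'"
        thus "g = g'" unfolding type1_def using elim(1) by blast
      next
        assume "type1 n g" "type2 (Suc n) g'"
        thus "g = g'" unfolding type1_def type2_def using elim(2) by blast
      next
        assume "type2 n g" "type1 (Suc n) g'"
        thus "g = g'" unfolding type1_def type2_def using elim(3) by blast
      next
        assume "type2 n g" "type2 (Suc n) g'"
        thus "g = g'" unfolding type2_def using elim(4) by blast
      qed
    qed
  qed
qed

lemma prox_bounded_of_transc:
  assumes "g \<noteq> 0"
  shows "\<exists>K. \<forall>l. prox l (crp g) \<theta> \<le> K"
proof (intro exI allI)
  fix l :: real
  obtain c where c: "c \<noteq> 0" "crp g = Polynomial.smult c (of_int_poly (prim g))" using crp_prim[OF assms] by blast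
  have "poly (crp g) \<theta> \<noteq> 0"
    using th c prim_nonzero[OF assms] unfolding transc_def by simp
  show "prox l (crp g) \<theta> \<le> (\<Sum>z\<in>#proots (crp g). max 0 (- ln (cmod (\<theta> - z))))"
    unfolding prox_def
  proof (rule sum_mset_mono)
    fix z assume "z \<in># proots (crp g)"
    hence "poly (crp g) z = 0" using assms by simp
    hence "\<theta> \<noteq> z" using \<open>poly (crp g) \<theta> \<noteq> 0\<close> by blast
    thus "kap l z \<theta> \<le> max 0 (- ln (cmod (\<theta> - z)))" by (simp add: kap_def)
  qed
qed

lemma not_eventually_type:
  assumes "\<forall>\<^sub>F n in sequentially. \<exists>g. type1 n g \<or> type2 n g"
  shows False
proof -
  from assms type_consecutive have "\<forall>\<^sub>F n in sequentially. (\<exists>g. type1 n g \<or> type2 n g) \<and>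
     (\<forall>g g'. type1 n g \<or> type2 n g \<longrightarrow> type1 (Suc n) g' \<or> type2 (Suc n) g' \<longrightarrow> g = g')"
    by (rule eventually_conj)
  then obtain n0 where n0: "\<And>n. n \<ge> n0 \<Longrightarrow> \<exists>g. type1 n g \<or> type2 n g"
    "\<And>n g g'. n \<ge> n0 \<Longrightarrow> type1 n g \<or> type2 n g \<Longrightarrow> type1 (Suc n) g' \<or> type2 (Suc n) g' \<Longrightarrow> g = g'"
    unfolding eventually_sequentially by blast
  obtain g where g: "type1 n0 g \<or> type2 n0 g" using n0(1) by blast
  have all: "type1 n g \<or> type2 n g" if "n \<ge> n0" for n
    using that
  proof (induction n rule: dec_induct)
    case (step n)
    obtain g' where "type1 (Suc n) g' \<or> type2 (Suc n) g'" using n0(1)[of "Suc n"] step by auto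
    thus ?case using n0(2)[of n g g'] step by blast
  qed (rule g)
  have pg: "prime g" using g by (auto simp: type1_def type2_def)
  have g1: "g \<noteq> 0" "degree g > 0" using prime_poly_monic[OF pg] by blast+
  obtain K where K: "\<And>l. prox l (crp g) \<theta> \<le> K" using prox_bounded_of_transc[OF g1(1)] by blast
  have h0: "height g \<ge> 0" by (rule height_nonneg[OF g1(1)])
  have lb: "v \<le> v * degree g + w * height g" if "v \<ge> 0" "w \<ge> 0" for v w :: real
  proof -
    have "v * 1 \<le> v * degree g" using g1 that by (intro mult_left_mono) auto
    moreover have "w * height g \<ge> 0" using that h0 by simp
    ultimately show ?thesis by simp
  qed
  have 1: "\<forall>\<^sub>F n in sequentially. (K + 1) * real n powr 0 \<le> real n powr (\<kappa> - \<epsilon>)"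
    using k1 e by (intro eventually_powr_le'(2)) auto
  have 2: "\<forall>\<^sub>F n in sequentially. (K + 1) * real n powr 0 \<le> real n powr (\<nu> - 1 + \<alpha> - 2 * \<epsilon>)"
    using n9 b by (intro eventually_powr_le'(2)) auto
  from 1 2 eventually_ge_at_top[of n0] eventually_ge_at_top[of 1] have "\<forall>\<^sub>F n::nat in sequentially. False"
  proof eventually_elim
    case (elim n)
    from all[OF elim(3)] show False
    proof
      assume "type1 n g"
      hence "real n powr (\<kappa> - \<epsilon>) \<le> K"
        unfolding type1_def using K[of "real n powr \<kappa>"] lb[of "real n powr (\<kappa> - \<epsilon>)" "real n powr (\<kappa> - \<epsilon>)"] powr_ge_zero by force
      thus False using elim(1,4) by simp
    next
      assume "type2 n g"
      hence "real n powr (\<nu> - 1 + \<alpha> - 2 * \<epsilon>) \<le> K"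
        unfolding type2_def using K[of "real n powr (\<nu> - \<tau>)"]
          lb[of "real n powr (\<nu> - 1 + \<alpha> - 2 * \<epsilon>)" "real n powr (\<nu> - \<beta> + \<alpha> - 2 * \<epsilon>)"] powr_ge_zero by force
      thus False using elim(2,4) by simp
    qed
  qed
  thus False by simp
qed

lemma frequently_no_small_poly:
  "\<not> (\<forall>\<^sub>F n in sequentially. \<exists>P::int poly. P \<noteq> 0 \<and> degree P \<le> n \<and>
     (\<forall>k. \<bar>real_of_int (coeff P k)\<bar> \<le> exp (real n powr \<beta>)) \<and>
     (\<forall>i j. (\<forall>k\<in>{1..m}. real (i k) \<le> real n powr \<sigma>) \<longrightarrow> real j < real n powr \<tau> \<longrightarrow>
        cmod (poly (divided_deriv j (of_int_poly P)) (pt i)) \<le> exp (- (real n powr \<nu>))))"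
proof
  assume "\<forall>\<^sub>F n in sequentially. \<exists>P::int poly. P \<noteq> 0 \<and> degree P \<le> n \<and>
     (\<forall>k. \<bar>real_of_int (coeff P k)\<bar> \<le> exp (real n powr \<beta>)) \<and>
     (\<forall>i j. (\<forall>k\<in>{1..m}. real (i k) \<le> real n powr \<sigma>) \<longrightarrow> real j < real n powr \<tau> \<longrightarrow>
        cmod (poly (divided_deriv j (of_int_poly P)) (pt i)) \<le> exp (- (real n powr \<nu>)))"
  hence "\<forall>\<^sub>F n in sequentially. \<exists>g. type1 n g \<or> type2 n g"
    using eventually_type1 eventually_type2
  proof eventually_elim
    case (elim n)
    obtain P :: "int poly" where P: "P \<noteq> 0" "degree P \<le> n" "\<forall>k. \<bar>real_of_int (coeff P k)\<bar> \<le> exp (real n powr \<beta>)"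
      "\<forall>i j. (\<forall>k\<in>{1..m}. real (i k) \<le> real n powr \<sigma>) \<longrightarrow> real j < real n powr \<tau> \<longrightarrow>
        cmod (poly (divided_deriv j (of_int_poly P)) (pt i)) \<le> exp (- (real n powr \<nu>))"
      using elim(1) by (elim exE conjE) (rule that)
    show ?case
    proof (cases "spaced n")
      case True
      have "\<exists>g. type2 n g" by (rule elim(3)[THEN spec, THEN mp, THEN mp, THEN mp, THEN mp, THEN mp, OF True P])
      thus ?thesis by blast
    next
      case False
      thus ?thesis using elim(2) by blast
    qed
  qed
  thus False by (rule not_eventually_type)
qed

end

theorem theorem8p2:
  fixes m :: nat and \<xi> :: "nat \<Rightarrow> complex" and \<beta> \<sigma> \<tau> \<nu> :: real
  assumes "inj_on \<xi> {1..m}" and "complex_over_rat.independent (\<xi> ` {1..m})"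
    and "has_transcendence_degree (generated_field (\<xi> ` {1..m})) 1"
    and "\<sigma> \<ge> 0" and "\<tau> \<ge> 0"
    and "\<beta> > 1" and "1 > 3 * real m * \<sigma> / (real m + 2) + \<tau>"
    and "\<nu> > 1 + \<beta> - 2 * real m * \<sigma> / (real m + 2) - \<tau>"
  shows "infinite {n::nat. n \<ge> 1 \<and>
    \<not> (\<exists>P :: int poly. P \<noteq> 0 \<and> degree P \<le> n \<and>
          real_of_rat (poly_height (rat_poly P)) \<le> exp (real n powr \<beta>) \<and>
          (\<forall>(i :: nat \<Rightarrow> nat) j :: nat.
             (\<forall>k\<in>{1..m}. real (i k) \<le> real n powr \<sigma>) \<and> real j < real n powr \<tau> \<longrightarrow>
             cmod (poly (divided_deriv j (map_poly of_int P)) (\<Sum>k=1..m. of_nat (i k) * \<xi> k))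
               \<le> exp (- (real n powr \<nu>))))}"
proof
  assume fin: "finite {n::nat. n \<ge> 1 \<and>
    \<not> (\<exists>P :: int poly. P \<noteq> 0 \<and> degree P \<le> n \<and>
          real_of_rat (poly_height (rat_poly P)) \<le> exp (real n powr \<beta>) \<and>
          (\<forall>(i :: nat \<Rightarrow> nat) j :: nat.
             (\<forall>k\<in>{1..m}. real (i k) \<le> real n powr \<sigma>) \<and> real j < real n powr \<tau> \<longrightarrow>
             cmod (poly (divided_deriv j (map_poly of_int P)) (\<Sum>k=1..m. of_nat (i k) * \<xi> k))
               \<le> exp (- (real n powr \<nu>))))}" (is "finite {n. n \<ge> 1 \<and> \<not> ?S n}")
  obtain T where T: "transcendence_basis (generated_field (\<xi> ` {1..m})) T" "card T = 1"
    using assms(3) unfolding has_transcendence_degree_def by blast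
  then obtain \<theta> where \<theta>: "T = {\<theta>}" by (auto simp: card_1_singleton_iff)
  have tr: "transc \<theta>"
    by (rule transc_of_independent) (use T \<theta> in \<open>simp add: transcendence_basis_def\<close>)
  have sub: "\<xi> k \<in> generated_field (\<xi> ` {1..m})" if "k \<in> {1..m}" for k
    using that unfolding generated_field_def by (auto intro: hull_inc)
  have alg: "algebraic_over (generated_field {\<theta>}) (\<xi> k)" if "k \<in> {1..m}" for k
    using T(1) sub[OF that] unfolding transcendence_basis_def \<theta> by blast
  \<comment> \<open>If all generators were algebraic, \<theta> would be too, as it lies in the field
    they generate.\<close>
  have "\<exists>k0\<in>{1..m}. transc (\<xi> k0)"
  proof (rule ccontr)
    assume no: "\<not> ?thesis"
    have "\<theta> \<in> generated_field (\<xi> ` {1..m})" using T(1) unfolding transcendence_basis_def \<theta> by blast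
    hence "algebraic_over (range (of_rat :: rat \<Rightarrow> complex)) \<theta>"
      by (rule rat_embedding.generated_field_algebraic[rotated 2])
         (use no not_transc_imp_algebraic_over in auto)
    thus False using algebraic_over_imp_not_transc tr by blast
  qed
  then obtain k0 where k0: "k0 \<in> {1..m}" "transc (\<xi> k0)" by blast
  have indep: "\<forall>k\<in>{1..m}. j k = 0" if j: "(\<Sum>k=1..m. of_int (j k) * \<xi> k) = 0" for j :: "nat \<Rightarrow> int"
  proof
    fix k assume k: "k \<in> {1..m}"
    define u where "u = (\<lambda>z. rat_of_int (j (inv_into {1..m} \<xi> z)))"
    have "(\<Sum>z\<in>\<xi> ` {1..m}. of_rat (u z) * z) = (\<Sum>k=1..m. of_rat (u (\<xi> k)) * \<xi> k)"
      by (subst sum.reindex[OF assms(1)]) simp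
    also have "\<dots> = (\<Sum>k=1..m. of_int (j k) * \<xi> k)"
      by (rule sum.cong) (use assms(1) in \<open>auto simp: u_def\<close>)
    finally have "(\<Sum>z\<in>\<xi> ` {1..m}. of_rat (u z) * z) = 0" using j by simp
    from complex_over_rat.independentD[OF assms(2) _ subset_refl this] have "u (\<xi> k) = 0" using k by blast
    thus "j k = 0" using assms(1) k by (simp add: u_def)
  qed
  define \<alpha> where "\<alpha> = real m * \<sigma> / (real m + 2)"
  \<comment> \<open>\<open>s1\<close> and \<open>s2\<close> are the slacks in the two strict
    hypotheses. The interval from \<open>\<beta> - \<alpha> - \<tau>\<close> to
    \<open>2 * \<nu> - 1 - \<beta>\<close> available for \<kappa> has length
    \<open>2 * s1 + s2\<close>; \<kappa> lies \<open>(s1 + s2) / 2\<close> above its lower end, and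
    \<epsilon> is small enough for its multiples to fit into the slacks.\<close>
  define s1 where "s1 = \<nu> - (1 + \<beta> - 2 * \<alpha> - \<tau>)"
  define s2 where "s2 = 1 - 3 * \<alpha> - \<tau>"
  define \<kappa> where "\<kappa> = \<beta> - \<alpha> - \<tau> + (s1 + s2) / 2"
  define \<epsilon> where "\<epsilon> = min s1 s2 / 16"
  have s12: "s1 > 0" "s2 > 0" using assms(7,8) by (simp_all add: s1_def s2_def \<alpha>_def mult.assoc)
  have e: "\<epsilon> > 0" "16 * \<epsilon> \<le> s1" "16 * \<epsilon> \<le> s2" using s12 by (auto simp: \<epsilon>_def)
  have m2: "real m + 2 > 0" by simp
  have a0: "\<alpha> \<ge> 0" using assms(4) by (simp add: \<alpha>_def)
  have as: "\<sigma> - \<alpha> = 2 * \<sigma> / (real m + 2)" using m2 by (simp add: \<alpha>_def field_simps)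
  have a5: "real m * (\<sigma> - \<alpha>) = 2 * \<alpha>" unfolding as by (simp add: \<alpha>_def)
  have a34: "\<alpha> \<le> \<sigma>" "\<sigma> > 0 \<Longrightarrow> \<alpha> < \<sigma>"
  proof -
    have "2 * \<sigma> / (real m + 2) \<ge> 0" using assms(4) by simp
    thus "\<alpha> \<le> \<sigma>" using as by linarith
    assume "\<sigma> > 0"
    hence "2 * \<sigma> / (real m + 2) > 0" by simp
    thus "\<alpha> < \<sigma>" using as by linarith
  qed
  have ex: "1 + \<beta> + \<kappa> < 2 * \<nu>" "1 + \<beta> - \<tau> - 2 * \<alpha> + 4 * \<epsilon> < \<nu>" "\<beta> - \<alpha> + \<epsilon> < \<nu>" "\<kappa> \<le> \<nu> - \<tau>"
    "\<beta> - \<alpha> - \<tau> + 3 * \<epsilon> < \<kappa>" "\<nu> - \<beta> + \<alpha> - 2 * \<epsilon> > 0" "\<nu> > \<beta>" "\<kappa> > 2 * \<epsilon>" "\<alpha> \<le> 1"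
    using e s12 a0 assms(5,6) by (simp_all add: \<kappa>_def s1_def s2_def field_simps)
  interpret parameter_choice m \<xi> \<theta> k0 \<beta> \<sigma> \<tau> \<nu> \<alpha> \<kappa> \<epsilon>
    by unfold_locales (fact tr alg k0 indep e ex assms a0 a34 a5)+
  \<comment> \<open>If only finitely many \<open>n\<close> were free of such polynomials, one would
    exist for every large \<open>n\<close>.\<close>
  have "\<forall>\<^sub>F n in sequentially. n \<notin> {n. n \<ge> 1 \<and> \<not> ?S n}"
    using fin unfolding cofinite_eq_sequentially[symmetric] eventually_cofinite not_not Collect_mem_eq .
  hence "\<forall>\<^sub>F n in sequentially. ?S n" using eventually_ge_at_top[of 1] by eventually_elim blast
  hence "\<forall>\<^sub>F n in sequentially. \<exists>P::int poly. P \<noteq> 0 \<and> degree P \<le> n \<and>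
     (\<forall>k. \<bar>real_of_int (coeff P k)\<bar> \<le> exp (real n powr \<beta>)) \<and>
     (\<forall>i j. (\<forall>k\<in>{1..m}. real (i k) \<le> real n powr \<sigma>) \<longrightarrow> real j < real n powr \<tau> \<longrightarrow>
        cmod (poly (divided_deriv j (of_int_poly P)) (pt i)) \<le> exp (- (real n powr \<nu>)))"
  proof eventually_elim
    case (elim n)
    then obtain P :: "int poly" where P: "P \<noteq> 0" "degree P \<le> n" "real_of_rat (poly_height (rat_poly P)) \<le> exp (real n powr \<beta>)"
      and small: "\<And>i j. (\<forall>k\<in>{1..m}. real (i k) \<le> real n powr \<sigma>) \<Longrightarrow> real j < real n powr \<tau> \<Longrightarrow>
             cmod (poly (divided_deriv j (map_poly of_int P)) (pt i)) \<le> exp (- (real n powr \<nu>))"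
      unfolding pt_def by blast
    note R = primitive_part_reduction[OF P(1)]
    show ?case
    proof (intro exI[of _ "primitive_part P"] conjI allI impI)
      show "primitive_part P \<noteq> 0" by (rule R(1))
      show "degree (primitive_part P) \<le> n" unfolding R(2) by (rule P(2))
      show "\<bar>real_of_int (coeff (primitive_part P) k)\<bar> \<le> exp (real n powr \<beta>)" for k
        by (rule order_trans[OF R(3) P(3)])
      fix i :: "nat \<Rightarrow> nat" and j :: nat
      assume "\<forall>k\<in>{1..m}. real (i k) \<le> real n powr \<sigma>" "real j < real n powr \<tau>"
      from order_trans[OF R(4) small[OF this]]
      show "cmod (poly (divided_deriv j (of_int_poly (primitive_part P))) (pt i)) \<le> exp (- (real n powr \<nu>))" .
    qed
  qed
  thus False using frequently_no_small_poly by blast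
qed

end
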